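(* Let $\mathbb G$ be a stratified Lie group and let $\Omega\subset\mathbb G$ be a bounded open set with smooth boundary. Consider, for $u_0\in S_0^{1,\infty}(\Omega)$ with $u_0\ge 0$, $u_0\not\equiv 0$, the problem $$\begin{cases}u_t-\mathcal L_pu=\alpha|u|^{q-1}u+\beta|\nabla_Hu|^r, & x\in\Omega,\ t>0,\\ u(t,x)=0,& x\in\partial\Omega,\ t>0,\\ u(0,x)=u_0(x),& x\in\Omega,\end{cases}$$ where $\mathcal L_pf=\nabla_H\cdot(|\nabla_Hf|^{p-2}\nabla_Hf)$ is the $p$-sub-Laplacian. Assume that $\alpha<0$, $\beta>0$, $p,r>1$ and $q>0$ satisfy one of the following conditions: - $r>\max\{p,q\}$; - $r=q>p$ and $\beta\gg|\alpha|$ (that is, $\beta\ge\Lambda|\alpha|$ for a sufficiently large constant $\Lambda>0$ depending only on $p$, $r$, $\Omega$ and $\mathbb G$). Then there exists $M>0$ (independent of $u_0$) such that if $\int_\Omega u_0^{\frac{2r-p}{r-p}}\,dx>M$, then $T_{\max}<\infty$.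
   Context: A Lie group $\mathbb G=(\mathbb R^N,\circ)$ is stratified if: (1) $\mathbb R^N=\mathbb R^{N_1}\times\cdots\times\mathbb R^{N_\rho}$ and for each $\lambda>0$ the dilation $\delta_\lambda(x',x^{(2)},\dots,x^{(\rho)})=(\lambda x',\lambda^2x^{(2)},\dots,\lambda^\rho x^{(\rho)})$, with $x'\in\mathbb R^{N_1}$, $x^{(k)}\in\mathbb R^{N_k}$, is an automorphism of $\mathbb G$; (2) the left-invariant vector fields $X_1,\dots,X_{N_1}$ with $X_j(0)=\partial/\partial x_j|_0$ satisfy Hörmander's condition, i.e. together with their iterated commutators they span the Lie algebra of $\mathbb G$. Notation: $\nabla_H=(X_1,\dots,X_{N_1})$ is the horizontal gradient, and $\nabla_H\cdot(F_1,\dots,F_{N_1})=\sum_jX_jF_j$. $S^{1,s}_0(\Omega)$ is the completion of $C_0^\infty(\Omega)$ in the norm $\big(\int_\Omega(|\nabla_Hu|^s+|u|^s)dx\big)^{1/s}$ for $1<s<\infty$, with the supremum norm used when $s=\infty$. Weak solutions: put $Q_T=(0,T)\times\Omega$ and $m=\max\{p,q,r\}$. A nonnegative function $u$ is a weak super-solution (resp. sub-solution) on $Q_T$ if $u\in C([0,T)\times\overline\Omega)\cap L^m((0,T);S_0^{1,m}(\Omega))$, $\partial_tu\in L^2((0,T);L^2(\Omega))$, $u(0,\cdot)\ge u_0$ (resp. $\le$), $u|_{\partial\Omega}\ge 0$ (resp. $\le$), and $$\iint_{Q_T}\big(\partial_tu\,\phi+|\nabla_Hu|^{p-2}\nabla_Hu\cdot\nabla_H\phi\big)dx\,dt\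 \ge\ (\text{resp. }\le)\ \iint_{Q_T}\big(\alpha|u|^{q-1}u+\beta|\nabla_Hu|^r\big)\phi\,dx\,dt$$ for all $\phi\in C(\overline{Q_T})\cap L^p((0,T);S_0^{1,p}(\Omega))$ with $\phi\ge 0$ and $\phi=0$ on $(0,T)\times\partial\Omega$. A weak solution is a function that is both a weak super-solution and a weak sub-solution. $T_{\max}$ denotes the maximal existence time of a weak solution of the problem. *)

theory Defs
  imports "HOL-Analysis.Analysis"
begin

section \<open>Smooth functions on open sets\<close>

text \<open>\<open>Ck_on k S f\<close> is meant for open \<open>S\<close>: all directional derivatives up to order \<open>k\<close> exist
  and are continuous on \<open>S\<close>.\<close>

primrec Ck_on ::
  "nat \<Rightarrow> 'a::euclidean_space set \<Rightarrow> ('a \<Rightarrow> 'b::euclidean_space) \<Rightarrow> bool" where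
  "Ck_on 0 S f \<longleftrightarrow> continuous_on S f"
| "Ck_on (Suc k) S f \<longleftrightarrow>
     (\<forall>x\<in>S. f differentiable (at x)) \<and>
     (\<forall>v. Ck_on k S (\<lambda>x. frechet_derivative f (at x) v))"

definition smooth_on ::
  "'a::euclidean_space set \<Rightarrow> ('a \<Rightarrow> 'b::euclidean_space) \<Rightarrow> bool" where
  "smooth_on S f \<longleftrightarrow> (\<forall>k. Ck_on k S f)"

definition Cc_inf :: "'a::euclidean_space set \<Rightarrow> ('a \<Rightarrow> real) set" where
  "Cc_inf \<Omega> = {\<phi>. smooth_on UNIV \<phi> \<and>
     compact (closure {x. \<phi> x \<noteq> 0}) \<and> closure {x. \<phi> x \<noteq> 0} \<subseteq> \<Omega>}"

text \<open>Near each boundary point the domain is the sublevel set of a smooth function without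
  critical points; in particular it lies on one side of its boundary.\<close>

definition smooth_boundary :: "'a::euclidean_space set \<Rightarrow> bool" where
  "smooth_boundary \<Omega> \<longleftrightarrow>
     (\<forall>x\<in>frontier \<Omega>. \<exists>U \<rho>. open U \<and> x \<in> U \<and> smooth_on U (\<rho> :: 'a \<Rightarrow> real) \<and>
        (\<forall>y\<in>U. frechet_derivative \<rho> (at y) \<noteq> (\<lambda>_. 0)) \<and>
        \<Omega> \<inter> U = {y \<in> U. \<rho> y < 0})"


section \<open>Stratified Lie groups\<close>

definition lie_group :: "(real^'n \<Rightarrow> real^'n \<Rightarrow> real^'n) \<Rightarrow> bool" where
  "lie_group mul \<longleftrightarrow>
     (\<exists>e i. Groups.group mul e i \<and> smooth_on UNIV (\<lambda>(x, y). mul x y) \<and> smooth_on UNIV i)"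

definition left_invariant ::
  "(real^'n \<Rightarrow> real^'n \<Rightarrow> real^'n) \<Rightarrow> (real^'n \<Rightarrow> real^'n) \<Rightarrow> bool" where
  "left_invariant mul Y \<longleftrightarrow>
     (\<forall>a x. frechet_derivative (mul a) (at x) (Y x) = Y (mul a x))"

definition lie_algebra ::
  "(real^'n \<Rightarrow> real^'n \<Rightarrow> real^'n) \<Rightarrow> (real^'n \<Rightarrow> real^'n) set" where
  "lie_algebra mul = {Y. smooth_on UNIV Y \<and> left_invariant mul Y}"

definition lie_bracket ::
  "(real^'n \<Rightarrow> real^'n) \<Rightarrow> (real^'n \<Rightarrow> real^'n) \<Rightarrow> real^'n \<Rightarrow> real^'n" where
  "lie_bracket Y Z x = frechet_derivative Z (at x) (Y x) - frechet_derivative Y (at x) (Z x)"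

inductive_set iterated_commutators ::
  "(real^'n \<Rightarrow> real^'n) set \<Rightarrow> (real^'n \<Rightarrow> real^'n) set" for \<X> where
  base: "Y \<in> \<X> \<Longrightarrow> Y \<in> iterated_commutators \<X>"
| bracket: "Y \<in> iterated_commutators \<X> \<Longrightarrow> Z \<in> iterated_commutators \<X> \<Longrightarrow>
    lie_bracket Y Z \<in> iterated_commutators \<X>"

text \<open>The left-invariant field \<open>X\<^sub>j\<close> with \<open>X\<^sub>j(0) = \<partial>/\<partial>x\<^sub>j\<close> at \<open>0\<close>, obtained by transporting the
  \<open>j\<close>-th unit vector from the identity \<open>0\<close> to \<open>x\<close> by the left translation \<open>mul x\<close>; see
  \<open>left_invariant_field_iff\<close> below.\<close>

definition left_invariant_field ::
  "(real^'n \<Rightarrow> real^'n \<Rightarrow> real^'n) \<Rightarrow> 'n \<Rightarrow> real^'n \<Rightarrow> real^'n" where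
  "left_invariant_field mul j x = frechet_derivative (mul x) (at 0) (axis j 1)"

text \<open>The splitting of \<open>\<real>\<^sup>N\<close> into \<open>\<rho>\<close> layers is given by the map \<open>w\<close> that sends a coordinate to
  the number of its layer, so that \<open>N\<^sub>k = card {i. w i = k}\<close>.\<close>

definition dilation :: "('n \<Rightarrow> nat) \<Rightarrow> real \<Rightarrow> real^'n \<Rightarrow> real^'n" where
  "dilation w l x = (\<chi> i. l ^ w i * x $ i)"

definition hoermander_condition ::
  "(real^'n \<Rightarrow> real^'n \<Rightarrow> real^'n) \<Rightarrow> ('n \<Rightarrow> nat) \<Rightarrow> bool" where
  "hoermander_condition mul w \<longleftrightarrow>
     (\<forall>Y\<in>lie_algebra mul. \<exists>F c. finite F \<and>
        F \<subseteq> iterated_commutators (left_invariant_field mul ` {j. w j = 1}) \<and>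
        Y = (\<lambda>x. \<Sum>Z\<in>F. c Z *\<^sub>R Z x))"

definition stratified_group ::
  "(real^'n \<Rightarrow> real^'n \<Rightarrow> real^'n) \<Rightarrow> ('n \<Rightarrow> nat) \<Rightarrow> bool" where
  "stratified_group mul w \<longleftrightarrow>
     lie_group mul \<and>
     (\<exists>\<rho>. range w = {1..\<rho>}) \<and>
     (\<forall>l>0. bij (dilation w l) \<and>
        (\<forall>x y. dilation w l (mul x y) = mul (dilation w l x) (dilation w l y))) \<and>
     hoermander_condition mul w"

lemma lie_group_differentiable:
  assumes "lie_group mul"
  shows "(mul a) differentiable (at x)"
proof -
  have "smooth_on UNIV (\<lambda>(x, y). mul x y)"
    using assms by (auto simp: lie_group_def)
  then have "Ck_on (Suc 0) UNIV (\<lambda>(x, y). mul x y)"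
    unfolding smooth_on_def by blast
  then have d: "(\<lambda>(x, y). mul x y) differentiable (at (a, x))"
    by simp
  have "(\<lambda>y. (a, y)) differentiable (at x)"
    by (intro differentiableI[OF has_derivative_Pair] derivative_intros)
  then have "((\<lambda>(x, y). mul x y) \<circ> (\<lambda>y. (a, y))) differentiable (at x)"
    using d by (rule differentiable_chain_at)
  then show ?thesis by (simp add: o_def)
qed

lemma stratified_group_identity:
  assumes "stratified_group mul w"
  obtains i where "Groups.group mul 0 i"
proof -
  obtain e i where g: "Groups.group mul e i"
    using assms by (auto simp: stratified_group_def lie_group_def)
  interpret group mul e i by (rule g)
  have "dilation w 2 (mul x y) = mul (dilation w 2 x) (dilation w 2 y)" for x y
    using assms by (simp add: stratified_group_def)
  from this[of e e] have "mul (dilation w 2 e) e = mul (dilation w 2 e) (dilation w 2 e)"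
    by simp
  then have d: "dilation w 2 e = e"
    by (metis left_cancel)
  have "e $ j = 0" for j
  proof -
    have "w j \<in> range w" by blast
    then have "w j \<ge> 1" using assms by (auto simp: stratified_group_def)
    then have "(2::real) ^ w j > 1" by simp
    moreover have "2 ^ w j * e $ j = e $ j"
      using d by (simp add: dilation_def vec_eq_iff)
    ultimately show ?thesis by simp
  qed
  then have "e = 0" by (simp add: vec_eq_iff)
  with g that show ?thesis by blast
qed

lemma left_invariant_field_iff:
  assumes "stratified_group mul w"
  shows "left_invariant mul Y \<and> Y 0 = axis j 1 \<longleftrightarrow> Y = left_invariant_field mul j"
proof -
  obtain i where g: "Groups.group mul 0 i"
    using stratified_group_identity[OF assms] .
  interpret group mul 0 i by (rule g)
  have dm: "(mul a) differentiable (at x)" for a x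
    using assms lie_group_differentiable by (auto simp: stratified_group_def)
  have "mul 0 = (\<lambda>x. x)" by auto
  then have id: "frechet_derivative (mul 0) (at 0) = (\<lambda>x. x)" by simp
  have chain: "frechet_derivative (mul (mul a x)) (at 0) v
      = frechet_derivative (mul a) (at x) (frechet_derivative (mul x) (at 0) v)" for a x v
  proof -
    have "mul (mul a x) = mul a \<circ> mul x" by (auto simp: assoc)
    moreover have "frechet_derivative (mul a \<circ> mul x) (at 0)
        = frechet_derivative (mul a) (at (mul x 0)) \<circ> frechet_derivative (mul x) (at 0)"
      by (intro frechet_derivative_compose dm)
    ultimately show ?thesis by simp
  qed
  show ?thesis
  proof
    assume *: "left_invariant mul Y \<and> Y 0 = axis j 1"
    have "Y x = left_invariant_field mul j x" for x
      using * unfolding left_invariant_def left_invariant_field_def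
      by (metis right_neutral)
    then show "Y = left_invariant_field mul j" by blast
  next
    assume "Y = left_invariant_field mul j"
    then show "left_invariant mul Y \<and> Y 0 = axis j 1"
      by (simp add: left_invariant_def left_invariant_field_def chain id)
  qed
qed


section \<open>Horizontal gradient and Sobolev spaces\<close>

text \<open>The horizontal gradient \<open>(X\<^sub>1 f, \<dots>, X\<^sub>N\<^sub>1 f)\<close>, padded with zeros in the coordinates outside
  the first layer.\<close>

definition hgrad ::
  "(real^'n \<Rightarrow> real^'n \<Rightarrow> real^'n) \<Rightarrow> ('n \<Rightarrow> nat) \<Rightarrow> (real^'n \<Rightarrow> real) \<Rightarrow> real^'n \<Rightarrow> real^'n" where
  "hgrad mul w f x =
     (\<chi> j. if w j = 1 then frechet_derivative f (at x) (left_invariant_field mul j x) else 0)"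

text \<open>The norm of \<open>S\<^bsup>1,s\<^esup>(\<Omega>)\<close> for a function \<open>u\<close> with horizontal gradient \<open>g\<close>.\<close>

definition S_norm ::
  "real \<Rightarrow> (real^'n) set \<Rightarrow> (real^'n \<Rightarrow> real) \<Rightarrow> (real^'n \<Rightarrow> real^'n) \<Rightarrow> real" where
  "S_norm s \<Omega> u g = (LINT x|lebesgue_on \<Omega>. norm (g x) powr s + \<bar>u x\<bar> powr s) powr (1 / s)"

text \<open>\<open>has_hgrad_S0 mul w s \<Omega> u g\<close>: the function \<open>u\<close> represents an element of the completion
  \<open>S\<^sub>0\<^bsup>1,s\<^esup>(\<Omega>)\<close> of \<open>C\<^sub>0\<^sup>\<infinity>(\<Omega>)\<close>, for \<open>1 < s < \<infinity>\<close>, and \<open>g\<close> represents its horizontal gradient, that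
  is, \<open>(u, g)\<close> is the limit of some sequence \<open>(\<phi>\<^sub>k, \<nabla>\<^sub>H \<phi>\<^sub>k)\<close>. The gradient is a relation because it
  is determined only almost everywhere.\<close>

definition has_hgrad_S0 ::
  "(real^'n \<Rightarrow> real^'n \<Rightarrow> real^'n) \<Rightarrow> ('n \<Rightarrow> nat) \<Rightarrow> real \<Rightarrow> (real^'n) set
     \<Rightarrow> (real^'n \<Rightarrow> real) \<Rightarrow> (real^'n \<Rightarrow> real^'n) \<Rightarrow> bool" where
  "has_hgrad_S0 mul w s \<Omega> u g \<longleftrightarrow>
     u \<in> borel_measurable (lebesgue_on \<Omega>) \<and>
     g \<in> borel_measurable (lebesgue_on \<Omega>) \<and>
     (\<exists>\<phi>. (\<forall>k::nat. \<phi> k \<in> Cc_inf \<Omega>) \<and>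
        (\<forall>k. integrable (lebesgue_on \<Omega>)
           (\<lambda>x. norm (hgrad mul w (\<phi> k) x - g x) powr s + \<bar>\<phi> k x - u x\<bar> powr s)) \<and>
        (\<lambda>k. S_norm s \<Omega> (\<lambda>x. \<phi> k x - u x) (\<lambda>x. hgrad mul w (\<phi> k) x - g x)) \<longlonglongrightarrow> 0)"

text \<open>The space \<open>S\<^sub>0\<^bsup>1,\<infinity>\<^esup>(\<Omega>)\<close>: completion of \<open>C\<^sub>0\<^sup>\<infinity>(\<Omega>)\<close> in the supremum norm of \<open>u\<close> and \<open>\<nabla>\<^sub>H u\<close>;
  its elements are functions on \<open>\<Omega>\<close>, not classes.\<close>

definition S0_inf ::
  "(real^'n \<Rightarrow> real^'n \<Rightarrow> real^'n) \<Rightarrow> ('n \<Rightarrow> nat) \<Rightarrow> (real^'n) set \<Rightarrow> (real^'n \<Rightarrow> real) set" where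
  "S0_inf mul w \<Omega> =
     {u. \<exists>\<phi> g. (\<forall>k::nat. \<phi> k \<in> Cc_inf \<Omega>) \<and>
        uniform_limit \<Omega> \<phi> u sequentially \<and>
        uniform_limit \<Omega> (\<lambda>k. hgrad mul w (\<phi> k)) g sequentially}"


section \<open>Functions of time and space\<close>

abbreviation cylinder :: "real \<Rightarrow> 'a set \<Rightarrow> (real \<times> 'a) set" where
  "cylinder T \<Omega> \<equiv> {0<..<T} \<times> \<Omega>"

text \<open>\<open>has_hgrad_LS0 mul w s T \<Omega> u g\<close>: the function \<open>u\<close> belongs to \<open>L\<^sup>s((0,T); S\<^sub>0\<^bsup>1,s\<^esup>(\<Omega>))\<close> and \<open>g\<close>
  is its horizontal gradient. As \<open>u \<mapsto> (u, \<nabla>\<^sub>H u)\<close> embeds \<open>S\<^sub>0\<^bsup>1,s\<^esup>(\<Omega>)\<close> as a closed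
  subspace into the separable space \<open>L\<^sup>s(\<Omega>; \<real>\<^bsup>1+N\<^esup>)\<close>, strongly measurable maps on
  \<open>(0,T)\<close> are identified as usual with jointly measurable functions of \<open>(t, x)\<close>. The last conjunct says that \<open>\<parallel>u(t)\<parallel>\<^sup>s\<close> is integrable over \<open>(0,T)\<close>.\<close>

definition has_hgrad_LS0 ::
  "(real^'n \<Rightarrow> real^'n \<Rightarrow> real^'n) \<Rightarrow> ('n \<Rightarrow> nat) \<Rightarrow> real \<Rightarrow> real \<Rightarrow> (real^'n) set
     \<Rightarrow> (real \<times> (real^'n) \<Rightarrow> real) \<Rightarrow> (real \<times> (real^'n) \<Rightarrow> real^'n) \<Rightarrow> bool" where
  "has_hgrad_LS0 mul w s T \<Omega> u g \<longleftrightarrow>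
     u \<in> borel_measurable (lebesgue_on (cylinder T \<Omega>)) \<and>
     g \<in> borel_measurable (lebesgue_on (cylinder T \<Omega>)) \<and>
     (AE t in lebesgue_on {0<..<T}. has_hgrad_S0 mul w s \<Omega> (\<lambda>x. u (t, x)) (\<lambda>x. g (t, x))) \<and>
     integrable (lebesgue_on (cylinder T \<Omega>)) (\<lambda>z. norm (g z) powr s + \<bar>u z\<bar> powr s)"

text \<open>The weak time derivative \<open>v\<close> of \<open>u\<close> exists on the cylinder and lies in
  \<open>L\<^sup>2((0,T); L\<^sup>2(\<Omega>)) = L\<^sup>2((0,T) \<times> \<Omega>)\<close>.\<close>

definition has_time_deriv_L2 ::
  "real \<Rightarrow> (real^'n) set \<Rightarrow> (real \<times> (real^'n) \<Rightarrow> real) \<Rightarrow> (real \<times> (real^'n) \<Rightarrow> real) \<Rightarrow> bool" where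
  "has_time_deriv_L2 T \<Omega> u v \<longleftrightarrow>
     v \<in> borel_measurable (lebesgue_on (cylinder T \<Omega>)) \<and>
     integrable (lebesgue_on (cylinder T \<Omega>)) (\<lambda>z. (v z)\<^sup>2) \<and>
     (\<forall>\<eta>\<in>Cc_inf (cylinder T \<Omega>).
        (LINT z|lebesgue_on (cylinder T \<Omega>). u z * frechet_derivative \<eta> (at z) (1, 0))
          = - (LINT z|lebesgue_on (cylinder T \<Omega>). v z * \<eta> z))"


section \<open>Weak solutions\<close>

text \<open>The membership \<open>u \<in> C([0,T) \<times> closure \<Omega>) \<inter> L\<^bsup>max(p,q,r)\<^esup>((0,T); S\<^sub>0)\<close> with
  \<open>\<partial>\<^sub>t u \<in> L\<^sup>2\<close> and \<open>u \<ge> 0\<close>; here \<open>g = \<nabla>\<^sub>H u\<close> and \<open>v = \<partial>\<^sub>t u\<close>.\<close>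

definition solution_class ::
  "(real^'n \<Rightarrow> real^'n \<Rightarrow> real^'n) \<Rightarrow> ('n \<Rightarrow> nat) \<Rightarrow> (real^'n) set \<Rightarrow> real \<Rightarrow> real \<Rightarrow> real \<Rightarrow> real
     \<Rightarrow> (real \<times> (real^'n) \<Rightarrow> real) \<Rightarrow> (real \<times> (real^'n) \<Rightarrow> real^'n) \<Rightarrow> (real \<times> (real^'n) \<Rightarrow> real)
     \<Rightarrow> bool" where
  "solution_class mul w \<Omega> p q r T u g v \<longleftrightarrow>
     continuous_on ({0..<T} \<times> closure \<Omega>) u \<and>
     (\<forall>z\<in>{0..<T} \<times> closure \<Omega>. 0 \<le> u z) \<and>
     has_hgrad_LS0 mul w (Max {p, q, r}) T \<Omega> u g \<and>
     has_time_deriv_L2 T \<Omega> u v"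

definition test_function ::
  "(real^'n \<Rightarrow> real^'n \<Rightarrow> real^'n) \<Rightarrow> ('n \<Rightarrow> nat) \<Rightarrow> (real^'n) set \<Rightarrow> real \<Rightarrow> real
     \<Rightarrow> (real \<times> (real^'n) \<Rightarrow> real) \<Rightarrow> (real \<times> (real^'n) \<Rightarrow> real^'n) \<Rightarrow> bool" where
  "test_function mul w \<Omega> p T \<phi> h \<longleftrightarrow>
     continuous_on (closure (cylinder T \<Omega>)) \<phi> \<and>
     (\<forall>z\<in>closure (cylinder T \<Omega>). 0 \<le> \<phi> z) \<and>
     (\<forall>z\<in>cylinder T (frontier \<Omega>). \<phi> z = 0) \<and>
     has_hgrad_LS0 mul w p T \<Omega> \<phi> h"

text \<open>The two sides of the weak formulation, with \<open>h = \<nabla>\<^sub>H \<phi>\<close>. For zero base \<open>powr\<close> is zero, so the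
  factors \<open>|\<nabla>\<^sub>H u|\<^bsup>p-2\<^esup> \<nabla>\<^sub>H u\<close> and \<open>|u|\<^bsup>q-1\<^esup> u\<close> vanish where \<open>\<nabla>\<^sub>H u\<close> resp. \<open>u\<close> does.\<close>

definition weak_lhs ::
  "(real^'n) set \<Rightarrow> real \<Rightarrow> real \<Rightarrow> (real \<times> (real^'n) \<Rightarrow> real^'n) \<Rightarrow> (real \<times> (real^'n) \<Rightarrow> real)
     \<Rightarrow> (real \<times> (real^'n) \<Rightarrow> real) \<Rightarrow> (real \<times> (real^'n) \<Rightarrow> real^'n) \<Rightarrow> real" where
  "weak_lhs \<Omega> p T g v \<phi> h =
     (LINT z|lebesgue_on (cylinder T \<Omega>).
        v z * \<phi> z + (norm (g z) powr (p - 2) *\<^sub>R g z) \<bullet> h z)"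

definition weak_rhs ::
  "(real^'n) set \<Rightarrow> real \<Rightarrow> real \<Rightarrow> real \<Rightarrow> real \<Rightarrow> real \<Rightarrow> (real \<times> (real^'n) \<Rightarrow> real)
     \<Rightarrow> (real \<times> (real^'n) \<Rightarrow> real^'n) \<Rightarrow> (real \<times> (real^'n) \<Rightarrow> real) \<Rightarrow> real" where
  "weak_rhs \<Omega> q r \<alpha> \<beta> T u g \<phi> =
     (LINT z|lebesgue_on (cylinder T \<Omega>).
        (\<alpha> * \<bar>u z\<bar> powr (q - 1) * u z + \<beta> * norm (g z) powr r) * \<phi> z)"

definition weak_super_solution ::
  "(real^'n \<Rightarrow> real^'n \<Rightarrow> real^'n) \<Rightarrow> ('n \<Rightarrow> nat) \<Rightarrow> (real^'n) set
     \<Rightarrow> real \<Rightarrow> real \<Rightarrow> real \<Rightarrow> real \<Rightarrow> real \<Rightarrow> (real^'n \<Rightarrow> real) \<Rightarrow> real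
     \<Rightarrow> (real \<times> (real^'n) \<Rightarrow> real) \<Rightarrow> bool" where
  "weak_super_solution mul w \<Omega> p q r \<alpha> \<beta> u0 T u \<longleftrightarrow>
     (\<exists>g v. solution_class mul w \<Omega> p q r T u g v \<and>
        (\<forall>x\<in>\<Omega>. u (0, x) \<ge> u0 x) \<and>
        (\<forall>z\<in>cylinder T (frontier \<Omega>). u z \<ge> 0) \<and>
        (\<forall>\<phi> h. test_function mul w \<Omega> p T \<phi> h \<longrightarrow>
           weak_lhs \<Omega> p T g v \<phi> h \<ge> weak_rhs \<Omega> q r \<alpha> \<beta> T u g \<phi>))"

definition weak_sub_solution ::
  "(real^'n \<Rightarrow> real^'n \<Rightarrow> real^'n) \<Rightarrow> ('n \<Rightarrow> nat) \<Rightarrow> (real^'n) set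
     \<Rightarrow> real \<Rightarrow> real \<Rightarrow> real \<Rightarrow> real \<Rightarrow> real \<Rightarrow> (real^'n \<Rightarrow> real) \<Rightarrow> real
     \<Rightarrow> (real \<times> (real^'n) \<Rightarrow> real) \<Rightarrow> bool" where
  "weak_sub_solution mul w \<Omega> p q r \<alpha> \<beta> u0 T u \<longleftrightarrow>
     (\<exists>g v. solution_class mul w \<Omega> p q r T u g v \<and>
        (\<forall>x\<in>\<Omega>. u (0, x) \<le> u0 x) \<and>
        (\<forall>z\<in>cylinder T (frontier \<Omega>). u z \<le> 0) \<and>
        (\<forall>\<phi> h. test_function mul w \<Omega> p T \<phi> h \<longrightarrow>
           weak_lhs \<Omega> p T g v \<phi> h \<le> weak_rhs \<Omega> q r \<alpha> \<beta> T u g \<phi>))"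

definition weak_solution ::
  "(real^'n \<Rightarrow> real^'n \<Rightarrow> real^'n) \<Rightarrow> ('n \<Rightarrow> nat) \<Rightarrow> (real^'n) set
     \<Rightarrow> real \<Rightarrow> real \<Rightarrow> real \<Rightarrow> real \<Rightarrow> real \<Rightarrow> (real^'n \<Rightarrow> real) \<Rightarrow> real
     \<Rightarrow> (real \<times> (real^'n) \<Rightarrow> real) \<Rightarrow> bool" where
  "weak_solution mul w \<Omega> p q r \<alpha> \<beta> u0 T u \<longleftrightarrow>
     weak_super_solution mul w \<Omega> p q r \<alpha> \<beta> u0 T u \<and>
     weak_sub_solution mul w \<Omega> p q r \<alpha> \<beta> u0 T u"

text \<open>The supremum of all \<open>T\<close> for which a weak solution exists on \<open>(0,T) \<times> \<Omega>\<close>; it is \<open>0\<close> if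
  there is none.\<close>

definition T_max ::
  "(real^'n \<Rightarrow> real^'n \<Rightarrow> real^'n) \<Rightarrow> ('n \<Rightarrow> nat) \<Rightarrow> (real^'n) set
     \<Rightarrow> real \<Rightarrow> real \<Rightarrow> real \<Rightarrow> real \<Rightarrow> real \<Rightarrow> (real^'n \<Rightarrow> real) \<Rightarrow> ennreal" where
  "T_max mul w \<Omega> p q r \<alpha> \<beta> u0 =
     Sup (ennreal ` {T. 0 < T \<and> (\<exists>u. weak_solution mul w \<Omega> p q r \<alpha> \<beta> u0 T u)})"

end

(* Let k = r / (r - p) and s = k + 1 = (2 r - p) / (r - p), and test the equation with u^k, localised in
   time. For Y(t) = \<integral> u(t)^s this gives
     Y' / s >= \<integral> (\<beta> u^k |\<nabla>u|^r - k u^(k-1) |\<nabla>u|^p + \<alpha> u^(q+k)).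
   With a = u^(1/(r-p)) |\<nabla>u| the first two terms are \<beta> a^r and k a^p, so the second is absorbed by
   the first up to a constant. The last term is controlled by \<integral> u^(k+r), and a Poincare inequality
   bounds \<integral> u^(k+r) by \<integral> u^k |\<nabla>u|^r: a horizontal field X_j has divergence zero and satisfies
   X_j x_j = 1, because its coefficients are smooth and homogeneous for the dilations; hence
   \<integral> f = - \<integral> x_j X_j f for f = u^(k+r). By convexity of powers Y' >= c Y^((k+r)/s) - C with
   (k+r)/s > 1, and Y blows up in finite time if Y(0) is large. *)

theory Submission
  imports Defs
begin

subsection \<open>Calculus of smooth functions\<close>

text \<open>The formal computation meets several obstacles. In space, elements of the Sobolev space
  are only limits of test functions, which may be negative and are not uniformly bounded although
  \<open>u\<close> lies in \<open>{0..L}\<close>; so the chain rule for \<open>u powr k\<close> goes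
  through smooth approximations of the power that are bounded on the whole line. In time,
  \<open>u\<close> has only a weak derivative \<open>v\<close>, tested against smooth compactly
  supported functions, so \<open>Y\<close> is not differentiated. Instead the tangent inequality of
  the convex power \<open>s\<close>, with \<open>u powr k\<close> frozen at the left end of short
  intervals, bounds the increment of \<open>Y\<close> from below by \<open>s\<close> times the
  integral of \<open>v * u powr k\<close>; this one-sided bound has the direction that the
  super-solution inequality needs. Near the end time \<open>u\<close> may be unbounded, so every
  cutoff vanishes before \<open>T\<close>. What results is an integral inequality for a continuous
  function, and blow-up is read off from a primitive. If \<open>q = r\<close>, the
  \<open>\<alpha>\<close>-term has the order of the Poincare term and must be beaten by the size of
  \<open>\<beta>\<close>: \<open>\<Lambda>\<close> is essentially four times the Poincare
  constant.\<close>

lemma Ck_on_SucI: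
  assumes "\<And>x. (f has_derivative f' x) (at x)" and "\<And>v. Ck_on k UNIV (\<lambda>x. f' x v)"
  shows "Ck_on (Suc k) UNIV f"
proof -
  have "frechet_derivative f (at x) = f' x" for x
    using frechet_derivative_at[OF assms(1)] by simp
  then show ?thesis
    using assms by (auto simp: differentiable_def)
qed

lemma Ck_on_SucD:
  assumes "Ck_on (Suc k) UNIV f"
  shows "(f has_derivative frechet_derivative f (at x)) (at x)"
    and "Ck_on k UNIV (\<lambda>x. frechet_derivative f (at x) v)"
  using assms by (auto simp: frechet_derivative_works[symmetric])

lemma Ck_on_Suc_imp:
  assumes "Ck_on (Suc k) UNIV f"
  shows "Ck_on k UNIV f"
  using assms
proof (induction k arbitrary: f)
  case 0
  then have "continuous_on UNIV f"
    by (auto intro!: continuous_at_imp_continuous_on differentiable_imp_continuous_within)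
  then show ?case by simp
next
  case (Suc k)
  show ?case
    by (rule Ck_on_SucI[OF Ck_on_SucD(1)[OF Suc.prems]])
       (rule Suc.IH[OF Ck_on_SucD(2)[OF Suc.prems]])
qed

lemma smooth_on_imp_continuous_on: "smooth_on UNIV f \<Longrightarrow> continuous_on UNIV f"
  unfolding smooth_on_def using Ck_on.simps(1) by blast

lemma smooth_on_has_derivative:
  "smooth_on UNIV f \<Longrightarrow> (f has_derivative frechet_derivative f (at x)) (at x)"
  unfolding smooth_on_def using Ck_on_SucD(1) by blast

lemma smooth_on_continuous_derivative:
  assumes "smooth_on UNIV f"
  shows "continuous_on UNIV (\<lambda>x. frechet_derivative f (at x) v)"
proof -
  have "Ck_on (Suc 0) UNIV f"
    using assms unfolding smooth_on_def by blast
  from Ck_on_SucD(2)[OF this] show ?thesis by simp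
qed

lemma Ck_on_const: "Ck_on k UNIV (\<lambda>x. c)"
  by (induction k arbitrary: c) auto

lemma Ck_on_add:
  assumes "Ck_on k UNIV f" "Ck_on k UNIV g"
  shows "Ck_on k UNIV (\<lambda>x. f x + g x)"
  using assms
proof (induction k arbitrary: f g)
  case 0
  then show ?case by (auto intro: continuous_intros)
next
  case (Suc k)
  show ?case
    by (rule Ck_on_SucI[OF has_derivative_add[OF Ck_on_SucD(1)[OF Suc.prems(1)] Ck_on_SucD(1)[OF Suc.prems(2)]]])
       (rule Suc.IH[OF Ck_on_SucD(2)[OF Suc.prems(1)] Ck_on_SucD(2)[OF Suc.prems(2)]])
qed

lemma Ck_on_mult:
  fixes f g :: "'a::euclidean_space \<Rightarrow> real"
  assumes "Ck_on k UNIV f" "Ck_on k UNIV g"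
  shows "Ck_on k UNIV (\<lambda>x. f x * g x)"
  using assms
proof (induction k arbitrary: f g)
  case 0
  then show ?case by (auto intro: continuous_intros)
next
  case (Suc k)
  show ?case
    by (rule Ck_on_SucI[OF has_derivative_mult[OF Ck_on_SucD(1)[OF Suc.prems(1)] Ck_on_SucD(1)[OF Suc.prems(2)]]])
       (intro Ck_on_add Suc.IH Ck_on_SucD(2)[OF Suc.prems(1)] Ck_on_SucD(2)[OF Suc.prems(2)]
          Ck_on_Suc_imp[OF Suc.prems(1)] Ck_on_Suc_imp[OF Suc.prems(2)])
qed

lemma Ck_on_power:
  fixes f :: "'a::euclidean_space \<Rightarrow> real"
  assumes "Ck_on k UNIV f"
  shows "Ck_on k UNIV (\<lambda>x. f x ^ n)"
  by (induction n) (auto intro: Ck_on_const Ck_on_mult[OF assms])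

lemma Ck_on_sum:
  assumes "finite I" and "\<And>i. i \<in> I \<Longrightarrow> Ck_on k UNIV (f i)"
  shows "Ck_on k UNIV (\<lambda>x. \<Sum>i\<in>I. f i x)"
  using assms by (induction I rule: finite_induct) (auto intro: Ck_on_const Ck_on_add)

text \<open>The derivative along \<open>v\<close> is again of the same form, with the derivative of
  \<open>f\<close> along \<open>L v\<close>, so the induction closes. This covers rescalings in
  time, the projections \<open>fst\<close> and \<open>snd\<close>, and the embedding of
  \<open>x\<close> as \<open>(x, 0)\<close>.\<close>

lemma Ck_on_compose_affine:
  assumes "Ck_on k UNIV f" and "bounded_linear L"
  shows "Ck_on k UNIV (\<lambda>x. f (c + L x))"
  using assms(1)
proof (induction k arbitrary: f)
  case 0
  have "continuous_on UNIV (\<lambda>x. c + L x)"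
    by (intro continuous_intros linear_continuous_on assms(2))
  then show ?case
    using 0 continuous_on_compose2[of UNIV f UNIV] by auto
next
  case (Suc k)
  have "((\<lambda>x. c + L x) has_derivative L) (at x)" for x
    using has_derivative_add[OF has_derivative_const bounded_linear_imp_has_derivative[OF assms(2)]]
    by simp
  then have "((\<lambda>x. f (c + L x)) has_derivative (\<lambda>v. frechet_derivative f (at (c + L x)) (L v))) (at x)"
    for x
    using Ck_on_SucD(1)[OF Suc.prems] by (rule has_derivative_compose)
  then show ?case
    by (rule Ck_on_SucI) (rule Suc.IH[OF Ck_on_SucD(2)[OF Suc.prems]])
qed

lemma Ck_on_bounded_linear_compose:
  assumes "Ck_on k UNIV f" and "bounded_linear L"
  shows "Ck_on k UNIV (\<lambda>x. L (f x))"
  using assms(1)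
proof (induction k arbitrary: f)
  case 0
  then show ?case
    using bounded_linear.continuous_on[OF assms(2)] by auto
next
  case (Suc k)
  show ?case
    by (rule Ck_on_SucI[OF bounded_linear.has_derivative[OF assms(2) Ck_on_SucD(1)[OF Suc.prems]]])
       (rule Suc.IH[OF Ck_on_SucD(2)[OF Suc.prems]])
qed

text \<open>The derivative of \<open>tanh\<close> is a polynomial in \<open>tanh\<close> itself, so
  each order follows from the preceding one. It is written with
  \<open>1 + (- 1) * tanh (f x) ^ 2\<close> to fit the closure rules for sums and products.\<close>

lemma Ck_on_tanh:
  fixes f :: "'a::euclidean_space \<Rightarrow> real"
  assumes "Ck_on k UNIV f"
  shows "Ck_on k UNIV (\<lambda>x. tanh (f x))"
  using assms
proof (induction k)
  case 0
  then show ?case by (auto intro!: continuous_intros)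
next
  case (Suc k)
  have "((\<lambda>x. tanh (f x)) has_derivative
      (\<lambda>v. frechet_derivative f (at x) v * (1 + (- 1) * tanh (f x) ^ 2))) (at x)" for x
  proof -
    have "(tanh has_field_derivative 1 - tanh (f x) ^ 2) (at (f x))"
      by (auto intro!: derivative_eq_intros)
    from has_derivative_compose[OF Ck_on_SucD(1)[OF Suc.prems] this[unfolded has_field_derivative_def]]
    show ?thesis by (simp add: mult.commute)
  qed
  then show ?case
    by (rule Ck_on_SucI)
       (intro Ck_on_add Ck_on_mult Ck_on_power Ck_on_const Ck_on_SucD(2)[OF Suc.prems]
         Suc.IH Ck_on_Suc_imp[OF Suc.prems])
qed

text \<open>The functions \<open>P(1/x) exp(-1/x)\<close>, extended by zero to \<open>x \<le> 0\<close>, form a family closed under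
  differentiation.\<close>

definition flat :: "real poly \<Rightarrow> real \<Rightarrow> real" where
  "flat P x = (if x > 0 then poly P (1 / x) * exp (- 1 / x) else 0)"

text \<open>This is the difference quotient at \<open>0\<close>, where \<open>flat P\<close>
  vanishes. With \<open>y = 1 / x\<close> it becomes \<open>y * poly P y / exp y\<close>, the
  numerator being the polynomial \<open>pCons 0 P\<close>, and the exponential wins. On the left
  everything is zero.\<close>

lemma flat_over_id_tendsto_0: "((\<lambda>x. flat P x / x) \<longlongrightarrow> 0) (at 0)"
proof -
  have *: "((\<lambda>y. poly (pCons 0 P) y / exp y) \<longlongrightarrow> 0) at_top"
  proof -
    have "((\<lambda>y. \<Sum>i\<le>degree (pCons 0 P). coeff (pCons 0 P) i * (y ^ i / exp y)) \<longlongrightarrow> 0) at_top"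
      by (intro tendsto_null_sum tendsto_mult_right_zero tendsto_power_div_exp_0)
    then show ?thesis by (simp only: poly_altdef sum_divide_distrib times_divide_eq_right)
  qed
  have "((\<lambda>x. flat P x / x) \<longlongrightarrow> 0) (at_right 0)"
  proof (rule Lim_transform_eventually)
    show "((\<lambda>x. poly (pCons 0 P) (inverse x) / exp (inverse x)) \<longlongrightarrow> 0) (at_right (0::real))"
      using filterlim_compose[OF * filterlim_inverse_at_top_right] .
    show "\<forall>\<^sub>F x in at_right 0. poly (pCons 0 P) (inverse x) / exp (inverse x) = flat P x / x"
      using eventually_at_right_less[of 0]
      by eventually_elim (simp add: flat_def exp_minus field_simps)
  qed
  moreover have "((\<lambda>x. flat P x / x) \<longlongrightarrow> 0) (at_left 0)"
    by (rule Lim_transform_eventually[OF tendsto_const], rule eventually_at_leftI[of "-1"])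
       (auto simp: flat_def)
  ultimately show ?thesis
    using filterlim_split_at by blast
qed

text \<open>With \<open>y = 1 / x\<close> one has dy/dx = - y^2, so the derivative of
  \<open>P(y) * exp (- y)\<close> is \<open>y^2 * (P - P')(y) * exp (- y)\<close>; the factor
  \<open>[:0, 0, 1:]\<close> is \<open>y^2\<close>.\<close>

lemma has_field_derivative_flat:
  "(flat P has_field_derivative flat ([:0, 0, 1:] * (P - pderiv P)) x) (at x)"
proof -
  consider "x > 0" | "x = 0" | "x < 0" by linarith
  then show ?thesis
  proof cases
    case 1
    have "((\<lambda>x. poly P (1 / x) * exp (- 1 / x)) has_field_derivative
        flat ([:0, 0, 1:] * (P - pderiv P)) x) (at x)"
      using 1 by (auto intro!: derivative_eq_intros simp: flat_def field_simps power2_eq_square)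
    moreover have "\<forall>\<^sub>F y in nhds x. flat P y = poly P (1 / y) * exp (- 1 / y)"
      using 1 eventually_nhds_in_open[of "{0<..}" x] by (auto simp: flat_def elim: eventually_mono)
    ultimately show ?thesis
      by (subst DERIV_cong_ev[OF refl _ refl])
  next
    case 2
    then show ?thesis
      using flat_over_id_tendsto_0[of P] by (simp add: has_field_derivative_iff flat_def)
  next
    case 3
    have "((\<lambda>x. 0) has_field_derivative flat ([:0, 0, 1:] * (P - pderiv P)) x) (at x)"
      using 3 by (simp add: flat_def)
    moreover have "\<forall>\<^sub>F y in nhds x. flat P y = 0"
      using 3 eventually_nhds_in_open[of "{..<0}" x] by (auto simp: flat_def elim: eventually_mono)
    ultimately show ?thesis
      by (subst DERIV_cong_ev[OF refl _ refl])
  qed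
qed

lemma Ck_on_flat: "Ck_on k UNIV (flat P)"
proof (induction k arbitrary: P)
  case 0
  have "continuous_on UNIV (flat P)"
    using has_field_derivative_flat by (meson DERIV_isCont continuous_at_imp_continuous_on)
  then show ?case by simp
next
  case (Suc k)
  show ?case
    by (rule Ck_on_SucI[OF has_field_derivative_flat[unfolded has_field_derivative_def]])
       (intro Ck_on_mult Ck_on_const Suc.IH)
qed

text \<open>The step is the normalised primitive of a smooth bump supported in
  \<open>{0..1}\<close>. After rescaling, \<open>S (c * (t - \<tau>))\<close> is a smooth version of
  the indicator of \<open>t > \<tau>\<close>, and its derivative is a mollifier; this turns the weak
  time derivative into increments of integrals.\<close>

lemma smooth_step_exists:
  obtains S S' :: "real \<Rightarrow> real"
  where "smooth_on UNIV S" and "\<And>x. (S has_field_derivative S' x) (at x)"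
    and "continuous_on UNIV S'" and "\<And>x. 0 \<le> S' x"
    and "\<And>x. x \<le> 0 \<Longrightarrow> S x = 0" and "\<And>x. x \<ge> 1 \<Longrightarrow> S x = 1"
    and "\<And>x. x \<notin> {0..1} \<Longrightarrow> S' x = 0"
proof -
  define B where "B x = flat 1 x * flat 1 (1 + (- 1) * x)" for x
  have Bnn: "B x \<ge> 0" for x by (simp add: B_def flat_def)
  have B0: "B x = 0" if "x \<notin> {0<..<1}" for x
    using that by (auto simp: B_def flat_def)
  have CB: "Ck_on k UNIV B" for k
    unfolding B_def
    by (intro Ck_on_mult Ck_on_flat Ck_on_compose_affine bounded_linear_mult_right)
  then have contB: "continuous_on A B" for A
    using Ck_on.simps(1) continuous_on_subset by blast
  define c where "c = integral {0..1} B"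
  \<comment> \<open>For negative \<open>x\<close> the interval \<open>{0..x}\<close> is empty, so
    \<open>I\<close> vanishes there, in agreement with \<open>B\<close> being zero outside
    \<open>{0<..<1}\<close>. Differentiability at \<open>0\<close> is then put together from the two
    sides.\<close>
  define I where "I x = integral {0..x} B" for x
  have I_der: "(I has_field_derivative B x) (at x)" for x
  proof (cases "x > 0")
    case True
    have "(I has_field_derivative B x) (at x within {0..x+1})"
      unfolding I_def using True by (intro integral_has_real_derivative contB) auto
    then show ?thesis
      using True by (simp add: at_within_Icc_at)
  next
    case False
    have I0: "I y = 0" if "y \<le> 0" for y
      using that unfolding I_def by (cases "y = 0") auto
    show ?thesis
    proof (cases "x < 0")
      case True
      have "\<forall>\<^sub>F y in nhds x. I y = 0"
        using True eventually_nhds_in_open[of "{..<0}" x] by (auto simp: I0 elim: eventually_mono)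
      moreover have "((\<lambda>x. 0) has_field_derivative B x) (at x)"
        using True by (simp add: B0)
      ultimately show ?thesis
        by (subst DERIV_cong_ev[OF refl _ refl])
    next
      case False
      with \<open>\<not> x > 0\<close> have x: "x = 0" by simp
      have "(I has_field_derivative B 0) (at 0 within {0..1})"
        unfolding I_def by (intro integral_has_real_derivative contB) auto
      then have r: "(I has_field_derivative B 0) (at_right 0)"
        by (simp add: at_within_Icc_at_right)
      have "((\<lambda>x. 0) has_field_derivative B 0) (at 0 within {..0})"
        by (simp add: B0)
      then have "(I has_field_derivative B 0) (at 0 within {..0})"
        by (rule has_field_derivative_transform_within[OF _ zero_less_one]) (auto simp: I0)
      then have l: "(I has_field_derivative B 0) (at_left 0)"
        by (rule DERIV_subset) auto
      show ?thesis
        using l r unfolding x has_field_derivative_iff using filterlim_split_at by blast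
    qed
  qed
  have c: "c > 0"
  proof -
    have "c \<noteq> 0"
    proof
      assume "c = 0"
      moreover have "(B has_integral c) {0..1}"
        unfolding c_def by (intro integrable_integral integrable_continuous_interval contB)
      ultimately have "(B has_integral 0) {0..1}" by simp
      then have "B (1/2) = 0"
        using has_integral_0_cbox_imp_0[of 0 1 B "1/2"] contB Bnn by auto
      then show False by (simp add: B_def flat_def)
    qed
    moreover have "c \<ge> 0"
      unfolding c_def by (intro integral_nonneg integrable_continuous_interval contB) (simp add: Bnn)
    ultimately show ?thesis by simp
  qed
  show ?thesis
  proof
    let ?S = "\<lambda>x. I x * (1 / c)" and ?S' = "\<lambda>x. B x * (1 / c)"
    show der: "(?S has_field_derivative ?S' x) (at x)" for x
      using I_der by (rule DERIV_cmult_right)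
    show "smooth_on UNIV ?S"
      unfolding smooth_on_def
    proof
      fix k
      have "Ck_on (Suc k) UNIV ?S"
        by (rule Ck_on_SucI[OF der[unfolded has_field_derivative_def]])
           (intro Ck_on_mult Ck_on_const CB)
      then show "Ck_on k UNIV ?S" by (rule Ck_on_Suc_imp)
    qed
    show "continuous_on UNIV ?S'" by (intro continuous_intros contB)
    show "0 \<le> ?S' x" for x using c Bnn by simp
    show "?S x = 0" if "x \<le> 0" for x
      using that unfolding I_def by (cases "x = 0") auto
    show "?S x = 1" if "x \<ge> 1" for x
    proof -
      have "integral {0..1} B + integral {1..x} B = integral {0..x} B"
        by (intro Henstock_Kurzweil_Integration.integral_combine integrable_continuous_interval contB)
           (use that in auto)
      moreover have "integral {1..x} B = integral {1..x} (\<lambda>_. 0)"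
        by (intro Henstock_Kurzweil_Integration.integral_cong) (simp add: B0)
      ultimately show ?thesis using c by (simp add: I_def c_def)
    qed
    show "?S' x = 0" if "x \<notin> {0..1}" for x
      using that B0[of x] by auto
  qed
qed

subsection \<open>Integration on products and the divergence theorem\<close>

lemma compact_continuous_abs_bound:
  fixes f :: "'a::topological_space \<Rightarrow> real"
  assumes "compact S" "continuous_on S f"
  obtains K where "0 \<le> K" "\<forall>x\<in>S. \<bar>f x\<bar> \<le> K"
proof -
  have "bounded (f ` S)"
    by (rule compact_imp_bounded[OF compact_continuous_image[OF assms(2,1)]])
  then obtain K where "\<forall>y\<in>f ` S. \<bar>y\<bar> \<le> K"
    unfolding bounded_iff real_norm_def by (rule exE)
  then have "\<forall>x\<in>S. \<bar>f x\<bar> \<le> max 0 K" by auto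
  then show ?thesis using that[of "max 0 K"] by simp
qed

lemma compact_closure_subset:
  fixes K :: "'a::t2_space set"
  assumes "compact K" "closure S \<subseteq> K"
  shows "compact (closure S)"
  using compact_Int_closed[OF assms(1) closed_closure[of S]] Int_absorb1[OF assms(2)] by simp

lemma continuous_imp_measurable_lebesgue_on_open:
  fixes f :: "'a::euclidean_space \<Rightarrow> 'b::euclidean_space"
  assumes "continuous_on S f" "A \<subseteq> S" "open A"
  shows "f \<in> borel_measurable (lebesgue_on A)"
  using continuous_imp_measurable_on_sets_lebesgue[OF continuous_on_subset[OF assms(1,2)]] assms(3)
  by simp

lemma finite_measure_lebesgue_on:
  fixes A :: "'a::euclidean_space set"
  assumes "open A" "bounded A"
  shows "finite_measure (lebesgue_on A)"
proof
  have "emeasure lebesgue A < \<infinity>"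
    using assms emeasure_bounded_finite by (auto simp: emeasure_completion)
  then show "emeasure (lebesgue_on A) (space (lebesgue_on A)) \<noteq> \<infinity>"
    using assms by (simp add: emeasure_restrict_space)
qed

text \<open>A Lebesgue measurable function on the product is in general not measurable for the
  product of the completed factors. So \<open>f\<close> is replaced by a Borel function
  \<open>f'\<close> equal to it almost everywhere; for almost every \<open>x\<close> the slices then
  agree almost everywhere as well, and Fubini is applied to \<open>f'\<close>.\<close>

lemma Fubini_lebesgue:
  fixes f :: "'a::euclidean_space \<times> 'b::euclidean_space \<Rightarrow> real"
  assumes "integrable lebesgue f"
  shows "AE x in lebesgue. integrable lebesgue (\<lambda>y. f (x, y))"
    and "integrable lebesgue (\<lambda>x. \<integral>y. f (x, y) \<partial>lebesgue)"
    and "(\<integral>x. (\<integral>y. f (x, y) \<partial>lebesgue) \<partial>lebesgue) = (\<integral>z. f z \<partial>lebesgue)"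
proof -
  obtain f' where f'[measurable]: "f' \<in> borel_measurable lborel"
    and ff': "AE z in lborel. f z = f' z"
    using completion_ex_borel_measurable_real[OF borel_measurable_integrable[OF assms]] by blast
  have ff'2: "AE z in lebesgue. f z = f' z"
    using ff' by (rule AE_completion)
  have f'm: "f' \<in> borel_measurable lebesgue"
    using f' by (rule measurable_completion)
  have int_f'0: "integrable lebesgue f'"
    using integrable_cong_AE_imp[OF assms f'm ff'2] .
  then have int_f': "integrable (lborel \<Otimes>\<^sub>M lborel) f'"
    using f' by (simp add: integrable_completion lborel_prod)
  have ae1: "AE x in lborel. AE y in lborel. f (x, y) = f' (x, y)"
    by (rule lborel_pair.AE_pair) (unfold lborel_prod, rule ff')
  have ae2: "AE x in lborel. integrable lborel (\<lambda>y. f' (x, y))"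
    using int_f' by (rule lborel_pair.AE_integrable_fst')
  have key: "AE x in lborel. integrable lebesgue (\<lambda>y. f (x, y)) \<and>
      (\<integral>y. f (x, y) \<partial>lebesgue) = (\<integral>y. f' (x, y) \<partial>lborel)"
    using ae1 ae2
  proof eventually_elim
    case (elim x)
    have m: "(\<lambda>y. f' (x, y)) \<in> borel_measurable lborel"
      using elim(2) by simp
    then have m': "(\<lambda>y. f' (x, y)) \<in> borel_measurable lebesgue"
      by (rule measurable_completion)
    have ae: "AE y in lebesgue. f' (x, y) = f (x, y)"
      using elim(1) by (intro AE_completion) (auto elim: eventually_mono)
    have m2: "(\<lambda>y. f (x, y)) \<in> borel_measurable lebesgue"
      using borel_measurable_AE[OF m' ae] .
    have i: "integrable lebesgue (\<lambda>y. f' (x, y))"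
      using elim(2) m by (simp add: integrable_completion)
    show ?case
      using integrable_cong_AE_imp[OF i m2 ae] integral_cong_AE[OF m' m2 ae] integral_completion[OF m]
      by simp
  qed
  have key2: "AE x in lebesgue. (\<integral>y. f' (x, y) \<partial>lborel) = (\<integral>y. f (x, y) \<partial>lebesgue)"
    using key by (intro AE_completion) (auto elim: eventually_mono)
  show "AE x in lebesgue. integrable lebesgue (\<lambda>y. f (x, y))"
    using key by (intro AE_completion) (auto elim: eventually_mono)
  have i1: "integrable lborel (\<lambda>x. \<integral>y. f' (x, y) \<partial>lborel)"
    using int_f' by (rule lborel_pair.integrable_fst')
  then have m1: "(\<lambda>x. \<integral>y. f' (x, y) \<partial>lborel) \<in> borel_measurable lborel" by simp
  have i2: "integrable lebesgue (\<lambda>x. \<integral>y. f' (x, y) \<partial>lborel)"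
    using i1 m1 by (simp add: integrable_completion)
  have m2: "(\<lambda>x. \<integral>y. f (x, y) \<partial>lebesgue) \<in> borel_measurable lebesgue"
    using borel_measurable_AE[OF borel_measurable_integrable[OF i2] key2] .
  show "integrable lebesgue (\<lambda>x. \<integral>y. f (x, y) \<partial>lebesgue)"
    using integrable_cong_AE_imp[OF i2 m2 key2] .
  have "(\<integral>x. (\<integral>y. f (x, y) \<partial>lebesgue) \<partial>lebesgue) = (\<integral>x. (\<integral>y. f' (x, y) \<partial>lborel) \<partial>lebesgue)"
    using integral_cong_AE[OF borel_measurable_integrable[OF i2] m2 key2] by simp
  also have "\<dots> = (\<integral>x. (\<integral>y. f' (x, y) \<partial>lborel) \<partial>lborel)"
    using m1 by (rule integral_completion)
  also have "\<dots> = (\<integral>z. f' z \<partial>lborel)"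
    using lborel_pair.integral_fst'[OF int_f'] by (simp add: lborel_prod)
  also have "\<dots> = (\<integral>z. f' z \<partial>lebesgue)"
    using f' by (simp add: integral_completion)
  also have "\<dots> = (\<integral>z. f z \<partial>lebesgue)"
    using integral_cong_AE[OF borel_measurable_integrable[OF assms] f'm ff'2] by simp
  finally show "(\<integral>x. (\<integral>y. f (x, y) \<partial>lebesgue) \<partial>lebesgue) = (\<integral>z. f z \<partial>lebesgue)" .
qed

lemma Fubini_lebesgue_on:
  fixes f :: "'a::euclidean_space \<times> 'b::euclidean_space \<Rightarrow> real"
  assumes A: "open A" and B: "open B" and f: "integrable (lebesgue_on (A \<times> B)) f"
  shows "AE x in lebesgue_on A. integrable (lebesgue_on B) (\<lambda>y. f (x, y))"
    and "integrable (lebesgue_on A) (\<lambda>x. \<integral>y. f (x, y) \<partial>lebesgue_on B)"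
    and "(\<integral>x. (\<integral>y. f (x, y) \<partial>lebesgue_on B) \<partial>lebesgue_on A) = (\<integral>z. f z \<partial>lebesgue_on (A \<times> B))"
proof -
  have [simp]: "A \<in> sets lebesgue" "B \<in> sets lebesgue" "A \<times> B \<in> sets lebesgue"
    using A B open_Times[OF A B] by auto
  define F where "F z = (if z \<in> A \<times> B then f z else 0)" for z
  have F: "integrable lebesgue F"
    unfolding F_def using f Lebesgue_Measure.integrable_restrict_UNIV[of "A \<times> B" f] by simp
  have Fy: "(\<lambda>y. F (x, y)) = (\<lambda>y. if y \<in> B then f (x, y) else 0)" if "x \<in> A" for x
    using that by (auto simp: F_def)
  have Fx: "(\<integral>y. F (x, y) \<partial>lebesgue) = (if x \<in> A then (\<integral>y. f (x, y) \<partial>lebesgue_on B) else 0)" for x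
  proof (cases "x \<in> A")
    case True
    then show ?thesis
      using Fy[OF True] Lebesgue_Measure.integral_restrict_UNIV[of B "\<lambda>y. f (x, y)"] by simp
  qed (simp add: F_def)
  note * = Fubini_lebesgue[OF F]
  have "AE x in lebesgue. x \<in> A \<longrightarrow> integrable (lebesgue_on B) (\<lambda>y. f (x, y))"
    using *(1)
  proof eventually_elim
    case (elim x)
    then show ?case
      using Fy[of x] Lebesgue_Measure.integrable_restrict_UNIV[of B "\<lambda>y. f (x, y)"] by auto
  qed
  then show "AE x in lebesgue_on A. integrable (lebesgue_on B) (\<lambda>y. f (x, y))"
    by (simp add: AE_restrict_space_iff)
  show "integrable (lebesgue_on A) (\<lambda>x. \<integral>y. f (x, y) \<partial>lebesgue_on B)"
    using *(2) unfolding Fx by (simp add: Lebesgue_Measure.integrable_restrict_UNIV)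
  show "(\<integral>x. (\<integral>y. f (x, y) \<partial>lebesgue_on B) \<partial>lebesgue_on A) = (\<integral>z. f z \<partial>lebesgue_on (A \<times> B))"
    using *(3) Lebesgue_Measure.integral_restrict_UNIV[of A "\<lambda>x. \<integral>y. f (x, y) \<partial>lebesgue_on B"]
      Lebesgue_Measure.integral_restrict_UNIV[of "A \<times> B" f]
    unfolding Fx by (simp add: F_def)
qed

text \<open>A Borel null set \<open>N\<close> covers the exceptional set. Its preimage under
  \<open>snd\<close> is measurable in the product, and it is null because every slice is
  \<open>N\<close>.\<close>

lemma AE_lebesgue_on_Times:
  fixes A :: "'a::euclidean_space set" and B :: "'b::euclidean_space set"
  assumes A: "open A" and B: "open B" and P: "AE y in lebesgue_on B. P y"
  shows "AE z in lebesgue_on (A \<times> B). P (snd z)"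
proof -
  have [simp]: "B \<in> sets lebesgue" "A \<times> B \<in> sets lebesgue"
    using A B open_Times[OF A B] by auto
  have "AE y in lborel. y \<in> B \<longrightarrow> P y"
    using P by (simp add: AE_restrict_space_iff AE_completion_iff)
  then obtain N where N: "{y. \<not> (y \<in> B \<longrightarrow> P y)} \<subseteq> N" "N \<in> sets lborel" "emeasure lborel N = 0"
    by (auto elim!: AE_E)
  then have "AE y in lborel. y \<notin> N"
    by (intro AE_not_in) auto
  then have "AE z in lborel \<Otimes>\<^sub>M lborel. snd (z :: 'a \<times> 'b) \<notin> N"
  proof (intro lborel_pair.AE_pair_measure)
    have "{z \<in> space (lborel \<Otimes>\<^sub>M lborel). snd (z :: 'a \<times> 'b) \<notin> N}
        = snd -` (space lborel - N) \<inter> space (lborel \<Otimes>\<^sub>M lborel)"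
      by (auto simp: space_pair_measure)
    also have "\<dots> \<in> sets (lborel \<Otimes>\<^sub>M lborel)"
      using N(2) by (intro measurable_sets[OF measurable_snd]) auto
    finally show "{z \<in> space (lborel \<Otimes>\<^sub>M lborel). snd (z :: 'a \<times> 'b) \<notin> N}
        \<in> sets (lborel \<Otimes>\<^sub>M lborel)" .
  qed simp
  then have "AE z in lebesgue. snd (z :: 'a \<times> 'b) \<notin> N"
    unfolding lborel_prod by (rule AE_completion)
  then have "AE z in lebesgue. z \<in> A \<times> B \<longrightarrow> P (snd z)"
    by eventually_elim (use N(1) in auto)
  then show ?thesis by (simp add: AE_restrict_space_iff)
qed

text \<open>By translation invariance the difference quotients of \<open>F\<close> in direction
  \<open>v\<close> integrate to zero; they converge to the derivative and are dominated by a
  constant on a ball. This is the divergence theorem one direction at a time, without boundary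
  terms.\<close>

lemma integral_directional_derivative_eq_0:
  fixes F :: "'a::euclidean_space \<Rightarrow> real"
  assumes F: "\<And>x. (F has_derivative F' x) (at x)"
    and cont: "continuous_on UNIV (\<lambda>x. F' x v)"
    and supp: "\<And>x. norm x > R \<Longrightarrow> F x = 0"
  shows "integrable lebesgue (\<lambda>x. F' x v)" and "(\<integral>x. F' x v \<partial>lebesgue) = 0"
proof -
  define G where "G n x = real (Suc n) * (F (x + v /\<^sub>R real (Suc n)) - F x)" for n x
  have contF: "continuous_on UNIV F"
    using F by (meson continuous_at_imp_continuous_on has_derivative_continuous)
  have contG: "continuous_on UNIV (G n)" for n
    unfolding G_def by (intro continuous_intros continuous_on_compose2[OF contF]) auto
  \<comment> \<open>The difference quotients, with steps of length at most \<open>norm v\<close>,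
    vanish outside radius \<open>R + norm v\<close>; the mean value point may lie another
    \<open>norm v\<close> further out.\<close>
  define R' where "R' = R + 2 * norm v"
  obtain M where "0 \<le> M" and M: "\<forall>x\<in>cball 0 R'. \<bar>F' x v\<bar> \<le> M"
    by (rule compact_continuous_abs_bound[OF compact_cball continuous_on_subset[OF cont subset_UNIV]])
  have bound: "\<bar>G n x\<bar> \<le> \<bar>M\<bar> * indicator (cball 0 R') x" for n x
  proof -
    let ?t = "inverse (real (Suc n))"
    have t: "0 < ?t" "?t \<le> 1" by (auto simp: field_simps)
    have nt: "norm (?t *\<^sub>R v) \<le> norm v"
      using t mult_right_mono[of ?t 1 "norm v"] by simp
    show ?thesis
    proof (cases "norm x \<le> R + norm v")
      case False
      have "norm x \<le> norm (x + ?t *\<^sub>R v) + norm (?t *\<^sub>R v)"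
        using norm_triangle_ineq4[of "x + ?t *\<^sub>R v" "?t *\<^sub>R v"] by simp
      then have "norm (x + ?t *\<^sub>R v) > R"
        using nt False by linarith
      moreover have "norm x > R" using False norm_ge_zero[of v] by linarith
      ultimately show ?thesis by (simp add: G_def supp)
    next
      case True
      have "((\<lambda>s. F (x + s *\<^sub>R v)) has_field_derivative F' (x + s *\<^sub>R v) v) (at s)" for s
      proof -
        have "((\<lambda>s. x + s *\<^sub>R v) has_derivative (\<lambda>h. h *\<^sub>R v)) (at s)"
          by (auto intro!: derivative_eq_intros)
        from has_derivative_compose[OF this F]
        have "((\<lambda>s. F (x + s *\<^sub>R v)) has_derivative (\<lambda>h. F' (x + s *\<^sub>R v) (h *\<^sub>R v))) (at s)" .
        moreover have "F' (x + s *\<^sub>R v) (h *\<^sub>R v) = F' (x + s *\<^sub>R v) v * h" for h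
          using linear_scale[OF has_derivative_linear[OF F]] by simp
        ultimately show ?thesis by (simp add: has_field_derivative_def)
      qed
      then obtain s where s: "0 < s" "s < ?t"
        and eq: "F (x + ?t *\<^sub>R v) - F (x + 0 *\<^sub>R v) = (?t - 0) * F' (x + s *\<^sub>R v) v"
        using MVT2[of 0 ?t "\<lambda>s. F (x + s *\<^sub>R v)" "\<lambda>s. F' (x + s *\<^sub>R v) v"] t(1) by blast
      have "G n x = F' (x + s *\<^sub>R v) v"
        using eq unfolding G_def by (simp add: field_simps)
      moreover have "norm (x + s *\<^sub>R v) \<le> norm x + norm v"
        using norm_triangle_ineq[of x "s *\<^sub>R v"] mult_right_mono[of s 1 "norm v"] s t by simp
      then have "x + s *\<^sub>R v \<in> cball 0 R'"
        using True by (simp add: R'_def)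
      moreover have "x \<in> cball 0 R'"
        using True norm_ge_zero[of v] by (simp add: R'_def del: norm_ge_zero)
      ultimately show ?thesis using M[rule_format, of "x + s *\<^sub>R v"] by simp
    qed
  qed
  have lim: "(\<lambda>n. G n x) \<longlonglongrightarrow> F' x v" for x
  proof -
    have "((\<lambda>s. x + s *\<^sub>R v) has_derivative (\<lambda>h. h *\<^sub>R v)) (at 0)"
      by (auto intro!: derivative_eq_intros)
    from has_derivative_compose[OF this F]
    have "((\<lambda>s. F (x + s *\<^sub>R v)) has_derivative (\<lambda>h. F' x (h *\<^sub>R v))) (at 0)" by simp
    moreover have "F' x (h *\<^sub>R v) = F' x v * h" for h
      using linear_scale[OF has_derivative_linear[OF F]] by simp
    ultimately have "((\<lambda>s. F (x + s *\<^sub>R v)) has_field_derivative F' x v) (at 0)"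
      by (simp add: has_field_derivative_def)
    then have "((\<lambda>s. (F (x + s *\<^sub>R v) - F x) / s) \<longlongrightarrow> F' x v) (at 0)"
      by (simp add: has_field_derivative_iff)
    moreover have "filterlim (\<lambda>n. inverse (real (Suc n))) (at 0) sequentially"
      using LIMSEQ_inverse_real_of_nat by (simp add: filterlim_at)
    ultimately have "(\<lambda>n. (F (x + inverse (real (Suc n)) *\<^sub>R v) - F x) / inverse (real (Suc n)))
        \<longlonglongrightarrow> F' x v"
      by (rule filterlim_compose)
    then show ?thesis by (simp add: G_def field_simps)
  qed
  have meas: "f \<in> borel_measurable lborel" if "continuous_on UNIV f" for f :: "'a \<Rightarrow> real"
    using that by (simp add: borel_measurable_continuous_onI)
  have intb: "integrable lborel (\<lambda>x. \<bar>M\<bar> * indicator (cball 0 R') (x::'a))"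
    by (intro integrable_mult_right integrable_real_indicator)
       (auto simp: emeasure_bounded_finite[of "cball _ _", simplified])
  have "(\<lambda>n. \<integral>x. G n x \<partial>lborel) \<longlonglongrightarrow> (\<integral>x. F' x v \<partial>lborel)"
    by (rule integral_dominated_convergence[OF _ _ intb])
       (use bound lim meas[OF cont] meas[OF contG] in auto)
  moreover have "(\<integral>x. G n x \<partial>lborel) = 0" for n
  proof -
    have intF: "integrable lborel F"
    proof -
      obtain K where "0 \<le> K" and K: "\<forall>x\<in>cball 0 R. \<bar>F x\<bar> \<le> K"
        by (rule compact_continuous_abs_bound[OF compact_cball continuous_on_subset[OF contF subset_UNIV]])
      have b: "\<bar>F x\<bar> \<le> \<bar>K\<bar> * indicator (cball 0 R) x" for x
        using K[rule_format, of x] supp[of x] by (cases "x \<in> cball 0 R") auto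
      have "integrable lborel (\<lambda>x. \<bar>K\<bar> * indicator (cball 0 R) (x::'a))"
        by (intro integrable_mult_right integrable_real_indicator)
           (auto simp: emeasure_bounded_finite[of "cball _ _", simplified])
      then show ?thesis
        by (rule Bochner_Integration.integrable_bound) (use b meas[OF contF] in auto)
    qed
    let ?c = "v /\<^sub>R real (Suc n)"
    have mF: "F \<in> borel_measurable borel" using meas[OF contF] by simp
    have "integrable (distr lborel borel ((+) ?c)) F"
      using intF by (simp add: lborel_distr_plus)
    then have i: "integrable lborel (\<lambda>x. F (?c + x))"
      by (subst (asm) integrable_distr_eq) (auto simp: mF)
    have "(\<integral>x. F (?c + x) \<partial>lborel) = (\<integral>x. F x \<partial>distr lborel borel ((+) ?c))"
      by (subst integral_distr) (auto simp: mF)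
    also have "\<dots> = (\<integral>x. F x \<partial>lborel)" by (simp add: lborel_distr_plus)
    finally show ?thesis
      using i intF unfolding G_def by (simp add: add.commute)
  qed
  ultimately have "(\<integral>x. F' x v \<partial>lborel) = 0"
    by (simp add: LIMSEQ_const_iff)
  then show "(\<integral>x. F' x v \<partial>lebesgue) = 0"
    using integral_completion[OF meas[OF cont]] by simp
  have "\<bar>F' x v\<bar> \<le> \<bar>M\<bar> * indicator (cball 0 R') x" for x
    using tendsto_rabs[OF lim] by (rule LIMSEQ_le_const2) (use bound in blast)
  then have "integrable lborel (\<lambda>x. F' x v)"
    by (intro Bochner_Integration.integrable_bound[OF intb]) (use meas[OF cont] in auto)
  then show "integrable lebesgue (\<lambda>x. F' x v)"
    using integrable_completion[OF meas[OF cont]] by simp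
qed

subsection \<open>Horizontal fields of a stratified group\<close>

lemma linear_vec_expand:
  fixes f :: "real^'n \<Rightarrow> real"
  assumes "linear f"
  shows "f v = (\<Sum>i\<in>UNIV. v $ i * f (axis i 1))"
proof -
  have "f v = f (\<Sum>i\<in>UNIV. v $ i *\<^sub>R axis i 1)"
    using basis_expansion[of v] by (simp add: scalar_mult_eq_scaleR)
  then show ?thesis
    using assms by (simp add: linear_sum linear_scale)
qed

lemma Cc_inf_smooth: "\<psi> \<in> Cc_inf \<Omega> \<Longrightarrow> smooth_on UNIV \<psi>"
  by (simp add: Cc_inf_def)

text \<open>The support is a closed subset of \<open>\<Omega>\<close>, so near a point outside
  \<open>\<Omega>\<close>, even on the frontier, the function is identically zero. Hence integrals
  over \<open>\<Omega>\<close> may be taken over the whole space.\<close>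

lemma Cc_inf_eq_0:
  assumes "\<psi> \<in> Cc_inf \<Omega>" and "x \<notin> \<Omega>"
  shows "\<psi> x = 0" and "frechet_derivative \<psi> (at x) = (\<lambda>_. 0)"
proof -
  define K where "K = closure {x. \<psi> x \<noteq> 0}"
  have xK: "x \<in> - K" and "open (- K)"
    using assms unfolding Cc_inf_def K_def by blast+
  have \<psi>0: "0 = \<psi> y" if y: "y \<in> - K" for y
  proof (rule ccontr)
    assume "0 \<noteq> \<psi> y"
    then have "y \<in> {x. \<psi> x \<noteq> 0}" by simp
    then have "y \<in> K" unfolding K_def by (rule subsetD[OF closure_subset])
    then show False using y by simp
  qed
  show "\<psi> x = 0"
    using \<psi>0[OF xK] by simp
  have "((\<lambda>_. 0) has_derivative (\<lambda>_. 0)) (at x)" by simp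
  then have "(\<psi> has_derivative (\<lambda>_. 0)) (at x)"
    using \<open>open (- K)\<close> xK \<psi>0 by (rule has_derivative_transform_within_open)
  then show "frechet_derivative \<psi> (at x) = (\<lambda>_. 0)"
    by (rule frechet_derivative_at[symmetric])
qed

lemma Cc_inf_support_bounded:
  assumes "\<psi> \<in> Cc_inf \<Omega>"
  obtains R where "\<And>x. norm x > R \<Longrightarrow> \<psi> x = 0"
proof -
  define K where "K = closure {x. \<psi> x \<noteq> 0}"
  have "bounded K"
    using assms unfolding Cc_inf_def K_def by (blast intro: compact_imp_bounded)
  then obtain R where R: "\<And>x. x \<in> K \<Longrightarrow> norm x \<le> R"
    unfolding bounded_iff by blast
  have "\<psi> x = 0" if x: "norm x > R" for x
  proof (rule ccontr)
    assume "\<psi> x \<noteq> 0"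
    then have "x \<in> K"
      using closure_subset[of "{x. \<psi> x \<noteq> 0}"] unfolding K_def by blast
    then show False using R[of x] x by linarith
  qed
  then show ?thesis by (rule that)
qed

lemma has_derivative_Cc_inf:
  "\<psi> \<in> Cc_inf \<Omega> \<Longrightarrow> (\<psi> has_derivative frechet_derivative \<psi> (at x)) (at x)"
  by (rule smooth_on_has_derivative[OF Cc_inf_smooth])

text \<open>The field is the partial derivative of \<open>mul x y\<close> with respect to
  \<open>y\<close> at \<open>y = 0\<close>, that is, a directional derivative of the jointly smooth
  multiplication, restricted to the points \<open>(x, 0)\<close>.\<close>

lemma left_invariant_field_smooth:
  assumes "stratified_group mul w"
  shows "smooth_on UNIV (left_invariant_field mul j)"
  unfolding smooth_on_def
proof
  fix k
  let ?m = "\<lambda>(x, y). mul x y"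
  have m: "smooth_on UNIV ?m"
    using assms by (auto simp: stratified_group_def lie_group_def)
  have "left_invariant_field mul j x = frechet_derivative ?m (at (x, 0)) (0, axis j 1)" for x
  proof -
    have "((\<lambda>y. (x, y)) has_derivative (\<lambda>v. (0, v))) (at 0)"
      by (auto intro!: derivative_eq_intros)
    from has_derivative_compose[OF this smooth_on_has_derivative[OF m]]
    have "(mul x has_derivative (\<lambda>v. frechet_derivative ?m (at (x, 0)) (0, v))) (at 0)"
      by simp
    from fun_cong[OF frechet_derivative_at[OF this], of "axis j 1"] show ?thesis
      unfolding left_invariant_field_def by simp
  qed
  then have eq: "left_invariant_field mul j
      = (\<lambda>x. (\<lambda>z. frechet_derivative ?m (at z) (0, axis j 1)) (0 + (x, 0)))"
    by (intro ext) (simp only: add_0)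
  have "Ck_on (Suc k) UNIV ?m"
    using m unfolding smooth_on_def by blast
  from Ck_on_SucD(2)[OF this]
  show "Ck_on k UNIV (left_invariant_field mul j)"
    unfolding eq by (rule Ck_on_compose_affine) (intro bounded_linear_Pair bounded_linear_ident bounded_linear_zero)
qed

lemma bounded_linear_dilation: "bounded_linear (dilation w l)"
  by (rule linear_conv_bounded_linear[THEN iffD1], rule linearI)
     (auto simp: dilation_def vec_eq_iff algebra_simps)

text \<open>Differentiate the automorphism identity for \<open>dilation w l (mul x y)\<close> at
  \<open>y = 0\<close> in the direction \<open>axis j 1\<close>, which the dilation scales by
  \<open>l\<close> because \<open>j\<close> lies in the first layer.\<close>

lemma left_invariant_field_homogeneous:
  assumes "stratified_group mul w" and "w j = 1" and "l > 0"
  shows "l * left_invariant_field mul j (dilation w l x) $ i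
    = l ^ w i * left_invariant_field mul j x $ i"
proof -
  have hom: "dilation w l (mul x y) = mul (dilation w l x) (dilation w l y)" for y
    using assms by (simp add: stratified_group_def)
  have lie: "lie_group mul" using assms by (simp add: stratified_group_def)
  have d: "(mul a has_derivative frechet_derivative (mul a) (at y)) (at y)" for a y
    using lie_group_differentiable[OF lie] frechet_derivative_works by blast
  have dl: "(dilation w l has_derivative dilation w l) (at y)" for y
    using bounded_linear_dilation by (rule bounded_linear_imp_has_derivative)
  have 1: "((\<lambda>y. dilation w l (mul x y)) has_derivative
      (\<lambda>v. dilation w l (frechet_derivative (mul x) (at 0) v))) (at 0)"
    using bounded_linear.has_derivative[OF bounded_linear_dilation d] .
  have d0: "dilation w l 0 = 0" by (simp add: dilation_def vec_eq_iff)
  have "(mul (dilation w l x) has_derivative frechet_derivative (mul (dilation w l x)) (at 0))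
      (at (dilation w l 0))"
    unfolding d0 by (rule d)
  then have 2: "((\<lambda>y. mul (dilation w l x) (dilation w l y)) has_derivative
      (\<lambda>v. frechet_derivative (mul (dilation w l x)) (at 0) (dilation w l v))) (at 0)"
    by (rule has_derivative_compose[OF dl])
  have "(\<lambda>v. dilation w l (frechet_derivative (mul x) (at 0) v))
      = (\<lambda>v. frechet_derivative (mul (dilation w l x)) (at 0) (dilation w l v))"
    using 1 2 unfolding hom by (rule has_derivative_unique)
  from fun_cong[OF this, of "axis j 1"]
  have "dilation w l (left_invariant_field mul j x)
      = frechet_derivative (mul (dilation w l x)) (at 0) (dilation w l (axis j 1))"
    unfolding left_invariant_field_def .
  also have "dilation w l (axis j 1) = l *\<^sub>R axis j 1"
    using assms(2) by (auto simp: dilation_def vec_eq_iff axis_def)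
  also have "frechet_derivative (mul (dilation w l x)) (at 0) (l *\<^sub>R axis j 1)
      = l *\<^sub>R left_invariant_field mul j (dilation w l x)"
    unfolding left_invariant_field_def
    using linear_scale[OF has_derivative_linear[OF d]] .
  finally show ?thesis by (simp add: dilation_def vec_eq_iff)
qed

text \<open>All weights are at least \<open>1\<close>. This is what lets a homogeneous continuous
  function be compared, at any point, with its value at the identity.\<close>

lemma dilation_tendsto_0:
  assumes "stratified_group mul w"
  shows "((\<lambda>l. dilation w l x) \<longlongrightarrow> 0) (at_right 0)"
proof (rule vec_tendstoI)
  fix i
  obtain \<rho> where "range w = {1..\<rho>}"
    using assms by (auto simp: stratified_group_def)
  then have "w i \<in> {1..\<rho>}" by blast
  then have "w i \<noteq> 0" by simp
  then have "((\<lambda>l. l ^ w i * x $ i) \<longlongrightarrow> 0 ^ w i * x $ i) (at_right 0)"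
    by (intro tendsto_intros)
  then show "((\<lambda>l. dilation w l x $ i) \<longlongrightarrow> 0 $ i) (at_right 0)"
    using \<open>w i \<noteq> 0\<close> by (simp add: dilation_def power_0_left)
qed

text \<open>For \<open>i = j\<close> the two factors in the homogeneity relation cancel, so the
  component is constant along the curve \<open>dilation w l x\<close>. This curve tends to
  \<open>0\<close> with \<open>l\<close>, and continuity gives the value at the identity.\<close>

lemma left_invariant_field_component:
  assumes "stratified_group mul w" and "w j = 1"
  shows "left_invariant_field mul j x $ j = 1"
proof -
  have cont: "isCont (left_invariant_field mul j) y" for y
    using smooth_on_imp_continuous_on[OF left_invariant_field_smooth[OF assms(1)]]
    by (simp add: continuous_on_eq_continuous_at)
  have "((\<lambda>l. left_invariant_field mul j (dilation w l x) $ j)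
      \<longlongrightarrow> left_invariant_field mul j 0 $ j) (at_right 0)"
    by (intro tendsto_vec_nth isCont_tendsto_compose[OF cont] dilation_tendsto_0[OF assms(1)])
  moreover have "\<forall>\<^sub>F l in at_right 0. left_invariant_field mul j (dilation w l x) $ j
      = left_invariant_field mul j x $ j"
    using eventually_at_right_less[of 0]
    by eventually_elim
       (use left_invariant_field_homogeneous[OF assms, where i = j] assms(2) in auto)
  ultimately have "((\<lambda>l::real. left_invariant_field mul j x $ j)
      \<longlongrightarrow> left_invariant_field mul j 0 $ j) (at_right 0)"
    by (rule Lim_transform_eventually)
  then have "left_invariant_field mul j x $ j = left_invariant_field mul j 0 $ j"
    by (simp add: tendsto_const_iff)
  also have "left_invariant_field mul j 0 = axis j 1"
    using left_invariant_field_iff[OF assms(1)] by blast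
  finally show ?thesis by simp
qed

text \<open>Differentiating the homogeneity relation along \<open>axis i 1\<close> produces the
  factor \<open>l ^ w i\<close> on both sides. After cancellation the derivative at \<open>x\<close>
  equals \<open>l\<close> times the derivative at \<open>dilation w l x\<close>, which stays bounded
  as \<open>l\<close> tends to \<open>0\<close>. So each summand of the divergence vanishes by
  itself.\<close>

lemma left_invariant_field_divergence_free:
  assumes "stratified_group mul w" and "w j = 1"
  shows "frechet_derivative (\<lambda>x. left_invariant_field mul j x $ i) (at x) (axis i 1) = 0"
proof -
  let ?a = "\<lambda>x. left_invariant_field mul j x $ i"
  let ?D = "\<lambda>x. frechet_derivative ?a (at x)"
  have sm: "smooth_on UNIV ?a"
    using Ck_on_bounded_linear_compose[OF _ bounded_linear_vec_nth]
      left_invariant_field_smooth[OF assms(1)] unfolding smooth_on_def by blast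
  note d = smooth_on_has_derivative[OF sm]
  have hom: "?D x (axis i 1) = l * ?D (dilation w l x) (axis i 1)" if l: "l > 0" for l
  proof -
    have "((\<lambda>x. l * ?a (dilation w l x)) has_derivative
        (\<lambda>v. l * ?D (dilation w l x) (dilation w l v))) (at x)"
      using has_derivative_mult_right[OF has_derivative_compose[OF
          bounded_linear_imp_has_derivative[OF bounded_linear_dilation] d]] .
    moreover have "((\<lambda>x. l ^ w i * ?a x) has_derivative (\<lambda>v. l ^ w i * ?D x v)) (at x)"
      using has_derivative_mult_right[OF d] .
    ultimately have "(\<lambda>v. l * ?D (dilation w l x) (dilation w l v)) = (\<lambda>v. l ^ w i * ?D x v)"
      unfolding left_invariant_field_homogeneous[OF assms l] by (rule has_derivative_unique)
    from fun_cong[OF this, of "axis i 1"]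
    have "l * ?D (dilation w l x) (dilation w l (axis i 1)) = l ^ w i * ?D x (axis i 1)" .
    moreover have "dilation w l (axis i 1) = l ^ w i *\<^sub>R axis i 1"
      by (auto simp: dilation_def vec_eq_iff axis_def)
    moreover have "?D (dilation w l x) (l ^ w i *\<^sub>R axis i 1)
        = l ^ w i * ?D (dilation w l x) (axis i 1)"
      using linear_scale[OF has_derivative_linear[OF d]] by simp
    ultimately show ?thesis using l by simp
  qed
  have cont: "isCont (\<lambda>x. ?D x (axis i 1)) y" for y
    using smooth_on_continuous_derivative[OF sm] by (simp add: continuous_on_eq_continuous_at)
  have "((\<lambda>l. l * ?D (dilation w l x) (axis i 1)) \<longlongrightarrow> 0 * ?D 0 (axis i 1)) (at_right 0)"
    by (intro tendsto_mult tendsto_ident_at isCont_tendsto_compose[OF cont] dilation_tendsto_0[OF assms(1)])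
  moreover have "\<forall>\<^sub>F l in at_right 0. l * ?D (dilation w l x) (axis i 1) = ?D x (axis i 1)"
    using eventually_at_right_less[of 0] by eventually_elim (use hom in simp)
  ultimately have "((\<lambda>l::real. ?D x (axis i 1)) \<longlongrightarrow> 0 * ?D 0 (axis i 1)) (at_right 0)"
    by (rule Lim_transform_eventually)
  then show ?thesis by (simp add: tendsto_const_iff)
qed

lemma hgrad_component:
  "w j = 1 \<Longrightarrow> hgrad mul w \<psi> x $ j = frechet_derivative \<psi> (at x) (left_invariant_field mul j x)"
  by (simp add: hgrad_def)

lemma continuous_on_hgrad:
  assumes "stratified_group mul w" and "smooth_on UNIV \<psi>"
  shows "continuous_on UNIV (hgrad mul w \<psi>)"
proof -
  have "continuous_on UNIV (\<lambda>x. hgrad mul w \<psi> x $ j)" for j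
  proof (cases "w j = 1")
    case True
    have "hgrad mul w \<psi> x $ j
        = (\<Sum>i\<in>UNIV. left_invariant_field mul j x $ i * frechet_derivative \<psi> (at x) (axis i 1))" for x
      unfolding hgrad_component[of w j, OF True]
      by (rule linear_vec_expand) (rule has_derivative_linear[OF smooth_on_has_derivative[OF assms(2)]])
    then show ?thesis
      by (simp only:)
         (intro continuous_intros smooth_on_continuous_derivative assms(2)
           smooth_on_imp_continuous_on[OF left_invariant_field_smooth[OF assms(1)]])
  qed (simp add: hgrad_def)
  then have "continuous_on UNIV (\<lambda>x. \<chi> j. hgrad mul w \<psi> x $ j)"
    by (intro continuous_on_vec_lambda)
  then show ?thesis by simp
qed

text \<open>Since the field has divergence zero and \<open>X\<^sub>j x\<^sub>j = 1\<close>, this is the divergence theorem for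
  \<open>x\<^sub>j \<psi> X\<^sub>j\<close>.\<close>

lemma integral_hgrad_identity:
  fixes \<Omega> :: "(real^'n) set"
  assumes G: "stratified_group mul w" and j: "w j = 1" and "open \<Omega>" and \<psi>: "\<psi> \<in> Cc_inf \<Omega>"
  shows "(LINT x|lebesgue_on \<Omega>. \<psi> x + x $ j * hgrad mul w \<psi> x $ j) = 0"
proof -
  let ?a = "left_invariant_field mul j"
  let ?D = "\<lambda>x. frechet_derivative \<psi> (at x)"
  let ?Da = "\<lambda>i x. frechet_derivative (\<lambda>x. ?a x $ i) (at x)"
  define f' where "f' x v = x $ j * ?D x v + v $ j * \<psi> x" for x v
  have f: "((\<lambda>x. x $ j * \<psi> x) has_derivative f' x) (at x)" for x
    unfolding f'_def
    by (intro has_derivative_mult has_derivative_Cc_inf[OF \<psi>]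
        bounded_linear_imp_has_derivative bounded_linear_vec_nth)
  have sma: "smooth_on UNIV (\<lambda>x. ?a x $ i)" for i
    using Ck_on_bounded_linear_compose[OF _ bounded_linear_vec_nth]
      left_invariant_field_smooth[OF G] unfolding smooth_on_def by blast
  \<comment> \<open>This is the derivative of the \<open>i\<close>-th component of
    \<open>x $ j * \<psi> x\<close> times the field. The terms of the divergence are integrated one
    by one, and their sum is the integrand of the claim.\<close>
  define F' where "F' i x v = ?a x $ i * f' x v + ?Da i x v * (x $ j * \<psi> x)" for i x v
  have F: "((\<lambda>x. ?a x $ i * (x $ j * \<psi> x)) has_derivative F' i x) (at x)" for i x
    unfolding F'_def by (intro has_derivative_mult f smooth_on_has_derivative sma)
  have F'_axis: "F' i x (axis i 1) = ?a x $ i * f' x (axis i 1)" for i x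
    by (simp add: F'_def left_invariant_field_divergence_free[OF G j])
  have cont: "continuous_on UNIV (\<lambda>x. F' i x (axis i 1))" for i
    unfolding F'_axis f'_def
    by (intro continuous_intros smooth_on_continuous_derivative Cc_inf_smooth[OF \<psi>]
        smooth_on_imp_continuous_on left_invariant_field_smooth[OF G])
  obtain R where R: "\<And>x. norm x > R \<Longrightarrow> \<psi> x = 0"
    using Cc_inf_support_bounded[OF \<psi>] by blast
  have R0: "?a x $ i * (x $ j * \<psi> x) = 0" if "norm x > R" for x i
    using R[OF that] by simp
  note * = integral_directional_derivative_eq_0[OF F cont R0]
  have eq: "(\<Sum>i\<in>UNIV. F' i x (axis i 1)) = \<psi> x + x $ j * ?D x (?a x)" for x
  proof -
    have "(\<Sum>i\<in>UNIV. F' i x (axis i 1)) = f' x (?a x)"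
      unfolding F'_axis by (rule linear_vec_expand[symmetric]) (rule has_derivative_linear[OF f])
    then show ?thesis
      by (simp add: f'_def left_invariant_field_component[OF G j])
  qed
  have "(\<integral>x. \<psi> x + x $ j * ?D x (?a x) \<partial>lebesgue) = (\<Sum>i\<in>UNIV. \<integral>x. F' i x (axis i 1) \<partial>lebesgue)"
    unfolding eq[symmetric] by (rule Bochner_Integration.integral_sum) (rule *(1))
  also have "\<dots> = 0" by (simp add: *(2))
  finally have "(\<integral>x. \<psi> x + x $ j * ?D x (?a x) \<partial>lebesgue) = 0" .
  moreover have "(\<lambda>x. if x \<in> \<Omega> then \<psi> x + x $ j * ?D x (?a x) else 0)
      = (\<lambda>x. \<psi> x + x $ j * ?D x (?a x))"
    using Cc_inf_eq_0[OF \<psi>] by auto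
  ultimately show ?thesis
    using Lebesgue_Measure.integral_restrict_UNIV[of \<Omega> "\<lambda>x. \<psi> x + x $ j * ?D x (?a x)"]
      \<open>open \<Omega>\<close> by (simp add: hgrad_component[of w j, OF j])
qed

subsection \<open>Chain rule in the horizontal Sobolev space\<close>

text \<open>The approximants are polynomials in \<open>tanh\<close>: composed with a test function, which need not take
  values in \<open>{0..L}\<close>, they remain smooth and are bounded together with their derivatives.\<close>

lemma smooth_truncation:
  fixes f f' :: "real \<Rightarrow> real"
  assumes L: "L > 0" and f0: "f 0 = 0"
    and f: "\<And>y. y \<in> {0..L} \<Longrightarrow> (f has_real_derivative f' y) (at y within {0..L})"
    and f': "continuous_on {0..L} f'"
  obtains F F' :: "nat \<Rightarrow> real \<Rightarrow> real" and K :: real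
  where "\<And>n y. (F n has_real_derivative F' n y) (at y)"
    and "\<And>n (\<phi> :: 'a::euclidean_space \<Rightarrow> real). smooth_on UNIV \<phi> \<Longrightarrow> smooth_on UNIV (\<lambda>x. F n (\<phi> x))"
    and "\<And>n. F n 0 = 0" and "\<And>n. continuous_on UNIV (F' n)"
    and "\<And>n y. \<bar>F n y\<bar> \<le> K" and "\<And>n y. \<bar>F' n y\<bar> \<le> K"
    and "\<And>y Y. y \<in> {0..L} \<Longrightarrow> Y \<longlonglongrightarrow> y \<Longrightarrow> (\<lambda>n. F n (Y n)) \<longlonglongrightarrow> f y"
    and "\<And>y Y. y \<in> {0..L} \<Longrightarrow> Y \<longlonglongrightarrow> y \<Longrightarrow> (\<lambda>n. F' n (Y n)) \<longlonglongrightarrow> f' y"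
proof -
  \<comment> \<open>In the variable \<open>tanh y\<close> the function \<open>f\<close> has
    derivative \<open>h\<close> on \<open>{0..tanh L}\<close>, since
    \<open>h (tanh y) * (1 - (tanh y)^2) = f' y\<close>. Clipping extends \<open>h\<close>
    continuously to the whole line and keeps the argument of \<open>artanh\<close> below
    \<open>1\<close>.\<close>
  define clip where "clip y = max 0 (min (tanh L) y)" for y
  define h where "h y = f' (artanh (clip y)) / (1 - (clip y)\<^sup>2)" for y
  have clip: "clip y \<in> {0..tanh L}" "0 \<le> clip y" "clip y < 1" for y
    using L tanh_real_lt_1[of L] by (auto simp: clip_def)
  have clip2: "1 - (clip y)\<^sup>2 > 0" for y
    using clip(2,3)[of y] abs_square_less_1[of "clip y"] by simp
  have art: "artanh (clip y) \<in> {0..L}" for y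
  proof -
    have "clip y \<in> tanh ` {0..L}"
    proof -
      have "\<exists>x\<ge>0. x \<le> L \<and> tanh x = clip y"
        using clip[of y] L by (intro IVT') (auto intro!: continuous_intros)
      then show ?thesis by (metis atLeastAtMost_iff image_eqI)
    qed
    then show ?thesis by (auto simp: artanh_tanh_real)
  qed
  have conth: "continuous_on UNIV h"
  proof -
    have c1: "continuous_on UNIV clip"
      unfolding clip_def by (intro continuous_intros)
    have c2: "continuous_on UNIV (\<lambda>y. artanh (clip y))"
      by (rule continuous_on_artanh'[OF c1]) (use clip(2,3) in \<open>simp add: less_le_trans[of "-1" 0]\<close>)
    have "continuous_on UNIV (\<lambda>y. f' (artanh (clip y)))"
      by (rule continuous_on_compose2[OF f' c2]) (use art in auto)
    then show ?thesis
      unfolding h_def using clip2 by (intro continuous_intros c1) (auto simp: less_le)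
  qed
  have h_tanh: "h (tanh y) * (1 - (tanh y)\<^sup>2) = f' y" if "y \<in> {0..L}" for y
  proof -
    have "clip (tanh y) = tanh y"
      using that by (auto simp: clip_def)
    then show ?thesis
      using clip2[of "tanh y"] by (simp add: h_def artanh_tanh_real)
  qed
  have "\<exists>q. real_polynomial_function q \<and> (\<forall>y\<in>{-1..1}. \<bar>h y - q y\<bar> < inverse (real (Suc n)))" for n
    by (rule Stone_Weierstrass_real_polynomial_function[of "{-1..1}" h "inverse (real (Suc n))"])
       (auto intro: continuous_on_subset[OF conth])
  then obtain q where q: "\<And>n. real_polynomial_function (q n)"
    and hq: "\<And>n y. y \<in> {-1..1} \<Longrightarrow> \<bar>h y - q n y\<bar> < inverse (real (Suc n))"
    by metis
  have "\<exists>a N. q n = (\<lambda>x. \<Sum>i\<le>N. a i * x ^ i)" for n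
    using q[of n] by (simp add: real_polynomial_function_iff_sum)
  then obtain a N where qa: "\<And>n. q n = (\<lambda>x. \<Sum>i\<le>(N n :: nat). a n i * x ^ i)"
    by metis
  \<comment> \<open>The primitive of the Weierstrass polynomial \<open>q n\<close> that vanishes at
    \<open>0\<close>, so that composition with \<open>Q n (tanh y)\<close> does not enlarge the
    support of a test function.\<close>
  define Q where "Q n x = (\<Sum>i\<le>N n. a n i / real (Suc i) * x ^ Suc i)" for n x
  have Q_der: "(Q n has_real_derivative q n x) (at x)" for n x
    unfolding Q_def qa
  proof (rule DERIV_sum)
    fix i
    have "((\<lambda>x. a n i / real (Suc i) * x ^ Suc i) has_real_derivative
        a n i / real (Suc i) * (real (Suc i) * x ^ (Suc i - Suc 0))) (at x)"
      by (rule DERIV_cmult[OF DERIV_pow])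
    then show "((\<lambda>x. a n i / real (Suc i) * x ^ Suc i) has_real_derivative a n i * x ^ i) (at x)"
      by simp
  qed
  define F where "F n y = Q n (tanh y)" for n y
  define F' where "F' n y = q n (tanh y) * (1 - (tanh y)\<^sup>2)" for n y
  have tanh_sq: "0 \<le> 1 - (tanh y)\<^sup>2" "1 - (tanh y)\<^sup>2 \<le> 1" for y :: real
    using tanh_real_bounds[of y] by (auto simp: abs_square_le_1)
  have tanh_in: "tanh y \<in> {-1..1}" for y :: real
    using tanh_real_bounds[of y] by auto
  have F_der: "(F n has_real_derivative F' n y) (at y)" for n y
  proof -
    have "(tanh has_real_derivative 1 - (tanh y)\<^sup>2) (at y)"
      by (auto intro!: derivative_eq_intros)
    from DERIV_chain2[OF Q_der this] show ?thesis
      unfolding F_def F'_def .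
  qed
  obtain H where "0 \<le> H" and H: "\<forall>y\<in>{-1..1}. \<bar>h y\<bar> \<le> H"
    by (rule compact_continuous_abs_bound[OF compact_Icc continuous_on_subset[OF conth subset_UNIV]])
  define K where "K = H + 1"
  have qK: "\<bar>q n y\<bar> \<le> K" if "y \<in> {-1..1}" for n y
  proof -
    have "inverse (real (Suc n)) \<le> 1" by (simp add: field_simps)
    then show ?thesis
      using hq[OF that, of n] bspec[OF H that] unfolding K_def by linarith
  qed
  have K0: "K \<ge> 0" using qK[of 0 0] by auto
  have F'K: "\<bar>F' n y\<bar> \<le> K" for n y
  proof -
    have "\<bar>F' n y\<bar> = \<bar>q n (tanh y)\<bar> * (1 - (tanh y)\<^sup>2)"
      unfolding F'_def abs_mult using tanh_sq(1)[of y] by simp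
    also have "\<dots> \<le> K * 1"
      using qK[OF tanh_in] tanh_sq K0 by (intro mult_mono) auto
    finally show ?thesis by simp
  qed
  have Q0: "Q n 0 = 0" for n by (simp add: Q_def)
  have FK: "\<bar>F n y\<bar> \<le> K" for n y
  proof -
    have "norm (Q n (tanh y) - Q n 0) \<le> K * norm (tanh y - 0)"
      by (rule field_differentiable_bound[of "{-1..1}" "Q n" "q n"])
         (use qK tanh_in in \<open>auto intro: has_field_derivative_at_within Q_der\<close>)
    also have "\<dots> \<le> K * 1"
      using tanh_in[of y] K0 by (intro mult_left_mono) auto
    finally show ?thesis by (simp add: F_def Q0)
  qed
  have F_Lip: "\<bar>F n y - F n z\<bar> \<le> K * \<bar>y - z\<bar>" for n y z
    using field_differentiable_bound[of UNIV "F n" "F' n" K y z] F_der F'K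
    by simp
  have F'_lim: "(\<lambda>n. F' n (Y n)) \<longlonglongrightarrow> f' y" if y: "y \<in> {0..L}" and Y: "Y \<longlonglongrightarrow> y" for y Y
  proof -
    have t: "(\<lambda>n. tanh (Y n)) \<longlonglongrightarrow> tanh y"
      by (intro tendsto_intros Y) simp
    have "isCont h (tanh y)"
      using conth by (simp add: continuous_on_eq_continuous_at)
    then have h1: "(\<lambda>n. h (tanh (Y n))) \<longlonglongrightarrow> h (tanh y)"
      using t by (rule isCont_tendsto_compose)
    have "(\<lambda>n. h (tanh (Y n)) - q n (tanh (Y n))) \<longlonglongrightarrow> 0"
      by (rule Lim_null_comparison[OF _ LIMSEQ_inverse_real_of_nat])
         (use hq[OF tanh_in] in \<open>auto intro!: always_eventually less_imp_le\<close>)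
    from tendsto_diff[OF h1 this] have "(\<lambda>n. q n (tanh (Y n))) \<longlonglongrightarrow> h (tanh y)" by simp
    then have "(\<lambda>n. F' n (Y n)) \<longlonglongrightarrow> h (tanh y) * (1 - (tanh y)\<^sup>2)"
      unfolding F'_def by (intro tendsto_intros t)
    then show ?thesis using h_tanh[OF y] by simp
  qed
  \<comment> \<open>On \<open>{0..L}\<close> the difference \<open>F n - f\<close> vanishes at
    \<open>0\<close> and has derivative at most \<open>inverse (real (Suc n))\<close>, hence is at
    most \<open>L\<close> times that. The common Lipschitz constant \<open>K\<close> then moves the
    argument from \<open>y\<close> to \<open>Y n\<close>.\<close>
  have F_lim: "(\<lambda>n. F n (Y n)) \<longlonglongrightarrow> f y" if y: "y \<in> {0..L}" and Y: "Y \<longlonglongrightarrow> y" for y Y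
  proof -
    have 1: "\<bar>F n y - f y\<bar> \<le> L * inverse (real (Suc n))" for n
    proof -
      let ?d = "\<lambda>y. F n y - f y"
      have "norm (?d y - ?d 0) \<le> inverse (real (Suc n)) * norm (y - 0)"
      proof (rule field_differentiable_bound[of "{0..L}" ?d "\<lambda>y. F' n y - f' y"])
        fix z assume z: "z \<in> {0..L}"
        show "(?d has_field_derivative F' n z - f' z) (at z within {0..L})"
          by (intro DERIV_diff has_field_derivative_at_within[OF F_der] f z)
        have "F' n z - f' z = (q n (tanh z) - h (tanh z)) * (1 - (tanh z)\<^sup>2)"
          unfolding h_tanh[OF z, symmetric] F'_def by (simp add: algebra_simps)
        then have "\<bar>F' n z - f' z\<bar> = \<bar>h (tanh z) - q n (tanh z)\<bar> * (1 - (tanh z)\<^sup>2)"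
          using tanh_sq(1)[of z] by (simp add: abs_mult abs_minus_commute)
        also have "\<dots> \<le> inverse (real (Suc n)) * 1"
          using hq[OF tanh_in] tanh_sq by (intro mult_mono) (auto intro: less_imp_le)
        finally show "norm (F' n z - f' z) \<le> inverse (real (Suc n))" by simp
      qed (use y L in auto)
      moreover have "F n 0 = 0" by (simp add: F_def Q0)
      ultimately have "\<bar>F n y - f y\<bar> \<le> inverse (real (Suc n)) * \<bar>y\<bar>"
        using f0 by simp
      also have "\<dots> \<le> inverse (real (Suc n)) * L"
        using y by (intro mult_left_mono) auto
      finally show ?thesis by (simp add: mult.commute)
    qed
    have "(\<lambda>n. F n (Y n) - f y) \<longlonglongrightarrow> 0"
    proof (rule Lim_null_comparison)
      have "\<bar>F n (Y n) - f y\<bar> \<le> K * \<bar>Y n - y\<bar> + L * inverse (real (Suc n))" for n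
        using F_Lip[of n "Y n" y] 1[of n] by linarith
      then show "\<forall>\<^sub>F n in sequentially. norm (F n (Y n) - f y) \<le> K * \<bar>Y n - y\<bar> + L * inverse (real (Suc n))"
        by (auto intro!: always_eventually)
      have "(\<lambda>n. K * \<bar>Y n - y\<bar> + L * inverse (real (Suc n))) \<longlonglongrightarrow> K * \<bar>y - y\<bar> + L * 0"
        by (intro tendsto_intros Y LIMSEQ_inverse_real_of_nat)
      then show "(\<lambda>n. K * \<bar>Y n - y\<bar> + L * inverse (real (Suc n))) \<longlonglongrightarrow> 0" by simp
    qed
    then show ?thesis by (simp add: LIM_zero_iff)
  qed
  show ?thesis
  proof (rule that[of F F' K])
    show "smooth_on UNIV (\<lambda>x. F n (\<phi> x))" if "smooth_on UNIV \<phi>" for n and \<phi> :: "'a \<Rightarrow> real"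
      using that unfolding F_def Q_def smooth_on_def
      by (intro allI Ck_on_sum Ck_on_mult Ck_on_const Ck_on_power Ck_on_tanh) auto
    show "F n 0 = 0" for n by (simp add: F_def Q0)
    show "continuous_on UNIV (F' n)" for n
      unfolding F'_def qa by (intro continuous_intros) auto
  qed (fact F_der FK F'K F_lim F'_lim)+
qed

lemma Cc_inf_compose:
  assumes "\<phi> \<in> Cc_inf \<Omega>" and "smooth_on UNIV (\<lambda>x. F (\<phi> x))" and "F 0 = 0"
  shows "(\<lambda>x. F (\<phi> x)) \<in> Cc_inf \<Omega>"
proof -
  have sub: "closure {x. F (\<phi> x) \<noteq> 0} \<subseteq> closure {x. \<phi> x \<noteq> 0}"
    using assms(3) by (intro closure_mono) auto
  have K: "compact (closure {x. \<phi> x \<noteq> 0})" "closure {x. \<phi> x \<noteq> 0} \<subseteq> \<Omega>"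
    using assms(1) by (simp_all add: Cc_inf_def)
  have "compact (closure {x. F (\<phi> x) \<noteq> 0})"
    by (rule compact_closure_subset[OF K(1) sub])
  then show ?thesis
    using sub K(2) assms(2) by (simp add: Cc_inf_def)
qed

lemma hgrad_compose:
  assumes "smooth_on UNIV \<phi>" and "\<And>y. (F has_real_derivative F' y) (at y)"
  shows "hgrad mul w (\<lambda>x. F (\<phi> x)) x = F' (\<phi> x) *\<^sub>R hgrad mul w \<phi> x"
proof -
  have "((\<lambda>x. F (\<phi> x)) has_derivative (\<lambda>v. F' (\<phi> x) * frechet_derivative \<phi> (at x) v)) (at x)"
    using has_derivative_compose[OF smooth_on_has_derivative[OF assms(1)]
        assms(2)[unfolded has_field_derivative_def]] .
  from frechet_derivative_at[OF this, symmetric] show ?thesis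
    by (simp add: hgrad_def vec_eq_iff)
qed

lemma powr_sum_le:
  fixes a b p :: real
  assumes "0 \<le> a" "0 \<le> b" "0 < p"
  shows "(a + b) powr p \<le> 2 powr p * (a powr p + b powr p)"
proof -
  have "(a + b) powr p \<le> (2 * max a b) powr p"
    using assms by (intro powr_mono2) auto
  also have "\<dots> = 2 powr p * max a b powr p"
    using assms by (simp add: powr_mult)
  also have "max a b powr p \<le> a powr p + b powr p"
    by (simp add: max_def)
  finally show ?thesis by simp
qed

text \<open>For \<open>a > \<epsilon>\<close> the factor \<open>a powr (p - m)\<close> is at most
  \<open>\<epsilon> powr (p - m)\<close>, the exponent being nonpositive. The free parameter serves
  twice: to pass from convergence in L^m to convergence in L^p on a set of finite measure, and to
  absorb a lower power by a higher one.\<close>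

lemma powr_le_epsilon:
  fixes a \<epsilon> p m :: real
  assumes "0 \<le> a" "0 < \<epsilon>" "0 < p" "p \<le> m"
  shows "a powr p \<le> \<epsilon> powr p + \<epsilon> powr (p - m) * a powr m"
proof (cases "a \<le> \<epsilon>")
  case True
  then have "a powr p \<le> \<epsilon> powr p"
    using assms by (intro powr_mono2) auto
  then show ?thesis by (simp add: add_increasing2)
next
  case False
  have "a powr p = a powr (p - m) * a powr m"
    by (simp flip: powr_add)
  also have "a powr (p - m) \<le> \<epsilon> powr (p - m)"
    using assms False by (intro powr_mono2') auto
  finally show ?thesis by (simp add: mult_right_mono add_increasing)
qed

lemma powr_le_one_plus:
  fixes a p m :: real
  assumes "0 \<le> a" "0 < p" "p \<le> m"
  shows "a powr p \<le> 1 + a powr m"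
  using powr_le_epsilon[of a 1 p m] assms by simp

lemma (in finite_measure) integrable_norm_powr_mono:
  fixes g :: "'a \<Rightarrow> 'b::euclidean_space"
  assumes "integrable M (\<lambda>x. norm (g x) powr m)" and [measurable]: "g \<in> borel_measurable M"
    and "0 < p" "p \<le> m"
  shows "integrable M (\<lambda>x. norm (g x) powr p)"
proof (rule Bochner_Integration.integrable_bound)
  show "integrable M (\<lambda>x. 1 + norm (g x) powr m)"
    by (rule Bochner_Integration.integrable_add[OF integrable_const assms(1)])
  show "AE x in M. norm (norm (g x) powr p) \<le> norm (1 + norm (g x) powr m)"
  proof (rule AE_I2)
    fix x
    show "norm (norm (g x) powr p) \<le> norm (1 + norm (g x) powr m)"
      using powr_le_one_plus[OF norm_ge_zero assms(3,4), of "g x"] powr_ge_zero[of "norm (g x)" p]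
      unfolding real_norm_def by linarith
  qed
  show "(\<lambda>x. norm (g x) powr p) \<in> borel_measurable M"
    by measurable
qed

text \<open>Along a subsequence the approximants \<open>\<phi>\<close> of \<open>u\<close> converge
  almost everywhere; composed with the truncations \<open>F n\<close> they give
  \<open>\<psi>\<close>. The gradient error splits into \<open>F' n\<close> times the error of
  \<open>hgrad mul w \<phi>\<close>, small because \<open>F' n\<close> is bounded by
  \<open>K\<close>, and \<open>F' n - f'\<close> (at the respective arguments) times
  \<open>g\<close>, small by dominated convergence. The sequence itself is handed on, because its
  uniform bound and pointwise limit are needed for the time derivative.\<close>

lemma S0_chain:
  fixes \<Omega> :: "(real^'n) set"
  assumes G: "stratified_group mul w" and \<Omega>: "open \<Omega>" "bounded \<Omega>"
    and u: "has_hgrad_S0 mul w m \<Omega> u g" and p: "0 < p" "p \<le> m"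
    and g: "integrable (lebesgue_on \<Omega>) (\<lambda>x. norm (g x) powr m)"
    and L: "L > 0" and uL: "\<And>x. x \<in> \<Omega> \<Longrightarrow> u x \<in> {0..L}"
    and f0: "f 0 = 0"
    and f: "\<And>y. y \<in> {0..L} \<Longrightarrow> (f has_real_derivative f' y) (at y within {0..L})"
    and f': "continuous_on {0..L} f'"
  obtains \<psi> and K :: real
  where "\<And>n. \<psi> n \<in> Cc_inf \<Omega>" and "\<And>n x. \<bar>\<psi> n x\<bar> \<le> K"
    and "AE x in lebesgue_on \<Omega>. (\<lambda>n. \<psi> n x) \<longlonglongrightarrow> f (u x)"
    and "(\<lambda>x. f (u x)) \<in> borel_measurable (lebesgue_on \<Omega>)"
    and "(\<lambda>x. f' (u x) *\<^sub>R g x) \<in> borel_measurable (lebesgue_on \<Omega>)"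
    and "\<And>n. integrable (lebesgue_on \<Omega>) (\<lambda>x. norm (hgrad mul w (\<psi> n) x - f' (u x) *\<^sub>R g x) powr p
        + \<bar>\<psi> n x - f (u x)\<bar> powr p)"
    and "(\<lambda>n. LINT x|lebesgue_on \<Omega>. norm (hgrad mul w (\<psi> n) x - f' (u x) *\<^sub>R g x) powr p
        + \<bar>\<psi> n x - f (u x)\<bar> powr p) \<longlonglongrightarrow> 0"
proof -
  let ?M = "lebesgue_on \<Omega>"
  interpret finite_measure ?M
    by (rule finite_measure_lebesgue_on[OF \<Omega>])
  have m: "0 < m" using p by simp
  have um[measurable]: "u \<in> borel_measurable ?M" and gm[measurable]: "g \<in> borel_measurable ?M"
    using u by (simp_all add: has_hgrad_S0_def)
  obtain \<phi> where \<phi>: "\<And>k. \<phi> k \<in> Cc_inf \<Omega>"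
    and d_int: "\<And>k. integrable ?M (\<lambda>x. norm (hgrad mul w (\<phi> k) x - g x) powr m + \<bar>\<phi> k x - u x\<bar> powr m)"
    and d_lim: "(\<lambda>k. S_norm m \<Omega> (\<lambda>x. \<phi> k x - u x) (\<lambda>x. hgrad mul w (\<phi> k) x - g x)) \<longlonglongrightarrow> 0"
    using u unfolding has_hgrad_S0_def by blast
  define d where "d k x = norm (hgrad mul w (\<phi> k) x - g x) powr m + \<bar>\<phi> k x - u x\<bar> powr m" for k x
  have d_int: "integrable ?M (d k)" for k
    using d_int[of k] unfolding d_def .
  have d0: "0 \<le> d k x" for k x by (simp add: d_def)
  have d_lim: "(\<lambda>k. LINT x|?M. d k x) \<longlonglongrightarrow> 0"
  proof -
    have "(\<lambda>k. S_norm m \<Omega> (\<lambda>x. \<phi> k x - u x) (\<lambda>x. hgrad mul w (\<phi> k) x - g x) powr m) \<longlonglongrightarrow> 0"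
      using d_lim m by (intro tendsto_zero_powrI[OF _ tendsto_const]) (auto simp: S_norm_def)
    moreover have "S_norm m \<Omega> (\<lambda>x. \<phi> k x - u x) (\<lambda>x. hgrad mul w (\<phi> k) x - g x) powr m
        = (LINT x|?M. d k x)" for k
    proof -
      have "0 \<le> (LINT x|?M. d k x)"
        by (intro Bochner_Integration.integral_nonneg d0)
      then show ?thesis
        using m by (simp add: S_norm_def d_def powr_powr)
    qed
    ultimately show ?thesis by simp
  qed
  have "(\<lambda>k. LINT x|?M. norm (d k x)) \<longlonglongrightarrow> 0"
    using d_lim by (simp add: d0)
  then obtain \<sigma> where \<sigma>: "strict_mono \<sigma>" and \<sigma>_lim: "AE x in ?M. (\<lambda>n. d (\<sigma> n) x) \<longlonglongrightarrow> 0"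
    using tendsto_L1_AE_subseq[of ?M d] d_int by blast
  have \<phi>_lim: "AE x in ?M. (\<lambda>n. \<phi> (\<sigma> n) x) \<longlonglongrightarrow> u x"
    using \<sigma>_lim
  proof eventually_elim
    case (elim x)
    have "(\<lambda>n. (\<bar>\<phi> (\<sigma> n) x - u x\<bar> powr m)) \<longlonglongrightarrow> 0"
      by (rule Lim_null_comparison[OF _ elim]) (auto simp: d_def intro!: always_eventually)
    then have "(\<lambda>n. (\<bar>\<phi> (\<sigma> n) x - u x\<bar> powr m) powr (1 / m)) \<longlonglongrightarrow> 0"
      by (rule tendsto_zero_powrI[OF _ tendsto_const]) (use m in auto)
    moreover have "(\<bar>y\<bar> powr m) powr (1 / m) = \<bar>y\<bar>" for y :: real
      using m by (simp add: powr_powr)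
    ultimately have "(\<lambda>n. \<bar>\<phi> (\<sigma> n) x - u x\<bar>) \<longlonglongrightarrow> 0"
      by (simp only:)
    then show ?case
      by (simp add: tendsto_rabs_zero_iff LIM_zero_iff)
  qed
  show thesis
  proof (rule smooth_truncation[OF L f0 f f', where 'a = "real^'n"])
  fix F F' :: "nat \<Rightarrow> real \<Rightarrow> real" and K :: real
  assume F: "\<And>n y. (F n has_real_derivative F' n y) (at y)"
      and Fsm: "\<And>n (\<phi> :: real^'n \<Rightarrow> real). smooth_on UNIV \<phi> \<Longrightarrow> smooth_on UNIV (\<lambda>x. F n (\<phi> x))"
      and F0: "\<And>n. F n 0 = 0" and F'cont: "\<And>n. continuous_on UNIV (F' n)"
      and FK: "\<And>n y. \<bar>F n y\<bar> \<le> K" and F'K: "\<And>n y. \<bar>F' n y\<bar> \<le> K"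
      and F_lim: "\<And>y Y. y \<in> {0..L} \<Longrightarrow> Y \<longlonglongrightarrow> y \<Longrightarrow> (\<lambda>n. F n (Y n)) \<longlonglongrightarrow> f y"
      and F'_lim: "\<And>y Y. y \<in> {0..L} \<Longrightarrow> Y \<longlonglongrightarrow> y \<Longrightarrow> (\<lambda>n. F' n (Y n)) \<longlonglongrightarrow> f' y"
  have K0: "K \<ge> 0" using FK[of 0 0] by simp
  have fK: "\<bar>f y\<bar> \<le> K" "\<bar>f' y\<bar> \<le> K" if y: "y \<in> {0..L}" for y
  proof -
    show "\<bar>f y\<bar> \<le> K"
      by (rule LIMSEQ_le_const2[OF tendsto_rabs[OF F_lim[OF y tendsto_const]]]) (intro exI allI impI FK)
    show "\<bar>f' y\<bar> \<le> K"
      by (rule LIMSEQ_le_const2[OF tendsto_rabs[OF F'_lim[OF y tendsto_const]]]) (intro exI allI impI F'K)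
  qed
  define \<psi> where "\<psi> n x = F n (\<phi> (\<sigma> n) x)" for n x
  have \<psi>: "\<psi> n \<in> Cc_inf \<Omega>" for n
    unfolding \<psi>_def by (rule Cc_inf_compose[OF \<phi> Fsm[OF Cc_inf_smooth[OF \<phi>]] F0])
  have h\<psi>: "hgrad mul w (\<psi> n) x = F' n (\<phi> (\<sigma> n) x) *\<^sub>R hgrad mul w (\<phi> (\<sigma> n)) x" for n x
    unfolding \<psi>_def by (rule hgrad_compose[OF Cc_inf_smooth[OF \<phi>] F])
  have contm: "h \<in> borel_measurable ?M" if "continuous_on UNIV h" for h :: "real^'n \<Rightarrow> 'b::euclidean_space"
    by (rule continuous_imp_measurable_lebesgue_on_open[OF that subset_UNIV \<Omega>(1)])
  have [measurable]: "\<phi> k \<in> borel_measurable ?M" "\<psi> k \<in> borel_measurable ?M" for k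
    by (rule contm[OF smooth_on_imp_continuous_on[OF Cc_inf_smooth[OF \<phi>]]]
        contm[OF smooth_on_imp_continuous_on[OF Cc_inf_smooth[OF \<psi>]]])+
  have [measurable]: "hgrad mul w (\<phi> k) \<in> borel_measurable ?M" "hgrad mul w (\<psi> k) \<in> borel_measurable ?M" for k
    by (rule contm[OF continuous_on_hgrad[OF G Cc_inf_smooth[OF \<phi>]]]
        contm[OF continuous_on_hgrad[OF G Cc_inf_smooth[OF \<psi>]]])+
  have comp_m: "(\<lambda>x. c (u x)) \<in> borel_measurable ?M" if "continuous_on {0..L} c" for c :: "real \<Rightarrow> real"
  proof -
    \<comment> \<open>Clamping the argument to \<open>{0..L}\<close> extends \<open>c\<close> to a
      continuous, hence Borel, function on the line without changing \<open>c (u x)\<close>.\<close>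
    have "continuous_on UNIV (\<lambda>y. c (max 0 (min L y)))"
      by (rule continuous_on_compose2[OF that]) (use L in \<open>auto intro!: continuous_intros\<close>)
    then have "(\<lambda>y. c (max 0 (min L y))) \<in> borel_measurable borel"
      by (rule borel_measurable_continuous_onI)
    then have "(\<lambda>x. c (max 0 (min L (u x)))) \<in> borel_measurable ?M"
      by measurable
    then show ?thesis
    proof (rule measurable_lebesgue_cong[THEN iffD1, rotated])
      show "c (max 0 (min L (u x))) = c (u x)" if "x \<in> \<Omega>" for x
        using uL[OF that] by simp
    qed
  qed
  have "continuous_on {0..L} f"
    using f by (rule DERIV_continuous_on)
  then have fm[measurable]: "(\<lambda>x. f (u x)) \<in> borel_measurable ?M" by (rule comp_m)
  have f'm[measurable]: "(\<lambda>x. f' (u x)) \<in> borel_measurable ?M" using f' by (rule comp_m)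
  have \<psi>_lim: "AE x in ?M. (\<lambda>n. \<psi> n x) \<longlonglongrightarrow> f (u x)"
    using \<phi>_lim AE_space[of ?M]
  proof eventually_elim
    case (elim x)
    then have "u x \<in> {0..L}" using uL by simp
    then show ?case
      unfolding \<psi>_def using elim(1) by (rule F_lim)
  qed
  \<comment> \<open>The part of the error with a fixed integrable majorant, to which dominated
    convergence applies. The other part, \<open>e\<close> below, is known to tend to zero only in
    the mean.\<close>
  define r where "r n x = 2 powr p * (\<bar>F' n (\<phi> (\<sigma> n) x) - f' (u x)\<bar> * norm (g x)) powr p
      + \<bar>\<psi> n x - f (u x)\<bar> powr p" for n x
  have [measurable]: "(\<lambda>x. F' n (\<phi> (\<sigma> n) x)) \<in> borel_measurable ?M" for n
    using borel_measurable_continuous_onI[OF F'cont] by measurable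
  have g_p: "integrable ?M (\<lambda>x. norm (g x) powr p)"
    by (rule integrable_norm_powr_mono[OF g gm p])
  have r_bound: "norm (r n x) \<le> 2 powr p * (2 * K) powr p * norm (g x) powr p + (2 * K) powr p"
    if x: "x \<in> \<Omega>" for n x
  proof -
    have "\<bar>F' n (\<phi> (\<sigma> n) x) - f' (u x)\<bar> \<le> 2 * K"
      using F'K[of n "\<phi> (\<sigma> n) x"] fK(2)[OF uL[OF x]] by linarith
    then have "(\<bar>F' n (\<phi> (\<sigma> n) x) - f' (u x)\<bar> * norm (g x)) powr p \<le> (2 * K * norm (g x)) powr p"
      using p by (intro powr_mono2 mult_right_mono) auto
    also have "\<dots> = (2 * K) powr p * norm (g x) powr p"
      using K0 by (simp add: powr_mult)
    finally have 1: "2 powr p * (\<bar>F' n (\<phi> (\<sigma> n) x) - f' (u x)\<bar> * norm (g x)) powr p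
        \<le> 2 powr p * ((2 * K) powr p * norm (g x) powr p)"
      by (intro mult_left_mono) auto
    have "\<bar>\<psi> n x - f (u x)\<bar> \<le> 2 * K"
      using FK[of n "\<phi> (\<sigma> n) x"] fK(1)[OF uL[OF x]] unfolding \<psi>_def by linarith
    then have "\<bar>\<psi> n x - f (u x)\<bar> powr p \<le> (2 * K) powr p"
      using p by (intro powr_mono2) auto
    with 1 have "r n x \<le> 2 powr p * (2 * K) powr p * norm (g x) powr p + (2 * K) powr p"
      unfolding r_def mult.assoc by linarith
    moreover have "0 \<le> r n x" by (simp add: r_def)
    ultimately show ?thesis by simp
  qed
  have r_dom: "integrable ?M (\<lambda>x. 2 powr p * (2 * K) powr p * norm (g x) powr p + (2 * K) powr p)"
    by (intro Bochner_Integration.integrable_add integrable_mult_right g_p) simp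
  have rm[measurable]: "r n \<in> borel_measurable ?M" for n
    unfolding r_def by measurable
  have r_int: "integrable ?M (r n)" for n
  proof (rule Bochner_Integration.integrable_bound[OF r_dom rm], rule AE_I2)
    fix x assume "x \<in> space ?M"
    then have "norm (r n x) \<le> 2 powr p * (2 * K) powr p * norm (g x) powr p + (2 * K) powr p"
      using r_bound[of x n] by simp
    then show "norm (r n x) \<le> norm (2 powr p * (2 * K) powr p * norm (g x) powr p + (2 * K) powr p)"
      unfolding real_norm_def by linarith
  qed
  have r_lim: "(\<lambda>n. LINT x|?M. r n x) \<longlonglongrightarrow> (LINT x|?M. 0)"
  proof (rule integral_dominated_convergence[OF _ rm r_dom])
    show "AE x in ?M. (\<lambda>n. r n x) \<longlonglongrightarrow> 0"
      using \<phi>_lim \<psi>_lim AE_space[of ?M]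
    proof eventually_elim
      case (elim x)
      have x: "u x \<in> {0..L}" using elim(3) uL by simp
      have "(\<lambda>n. \<bar>F' n (\<phi> (\<sigma> n) x) - f' (u x)\<bar> * norm (g x)) \<longlonglongrightarrow> \<bar>f' (u x) - f' (u x)\<bar> * norm (g x)"
        by (intro tendsto_intros F'_lim[OF x elim(1)])
      then have 1: "(\<lambda>n. (\<bar>F' n (\<phi> (\<sigma> n) x) - f' (u x)\<bar> * norm (g x)) powr p) \<longlonglongrightarrow> 0"
        using p by (intro tendsto_zero_powrI[OF _ tendsto_const]) auto
      have "(\<lambda>n. \<bar>\<psi> n x - f (u x)\<bar>) \<longlonglongrightarrow> \<bar>f (u x) - f (u x)\<bar>"
        by (intro tendsto_intros elim(2))
      then have 2: "(\<lambda>n. \<bar>\<psi> n x - f (u x)\<bar> powr p) \<longlonglongrightarrow> 0"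
        using p by (intro tendsto_zero_powrI[OF _ tendsto_const]) auto
      show ?case
        using tendsto_add[OF tendsto_mult_right_zero[OF 1, of "2 powr p"] 2] by (simp add: r_def)
    qed
  qed (use r_bound in auto)
  define e where "e n x = norm (hgrad mul w (\<phi> (\<sigma> n)) x - g x) powr p" for n x
  have em[measurable]: "e n \<in> borel_measurable ?M" for n
    unfolding e_def by measurable
  have e_bound: "e n x \<le> \<epsilon> powr p + \<epsilon> powr (p - m) * d (\<sigma> n) x" if "\<epsilon> > 0" for \<epsilon> n x
  proof -
    have "\<epsilon> powr (p - m) * norm (hgrad mul w (\<phi> (\<sigma> n)) x - g x) powr m \<le> \<epsilon> powr (p - m) * d (\<sigma> n) x"
      by (intro mult_left_mono) (auto simp: d_def)
    then show ?thesis
      using powr_le_epsilon[OF norm_ge_zero that p, of "hgrad mul w (\<phi> (\<sigma> n)) x - g x"]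
      unfolding e_def by linarith
  qed
  have e0: "0 \<le> e n x" for n x by (simp add: e_def)
  have e_int: "integrable ?M (e n)" for n
  proof (rule Bochner_Integration.integrable_bound[of _ "\<lambda>x. 1 + d (\<sigma> n) x"])
    show "AE x in ?M. norm (e n x) \<le> norm (1 + d (\<sigma> n) x)"
      using e_bound[of 1 n] e0 d0 by (auto simp: abs_of_nonneg)
  qed (use d_int in auto)
  have e_lim: "(\<lambda>n. LINT x|?M. e n x) \<longlonglongrightarrow> 0"
  proof (rule LIMSEQ_I)
    fix \<eta> :: real assume \<eta>: "\<eta> > 0"
    define V where "V = measure ?M \<Omega> + 1"
    have V: "V > 0" "measure ?M \<Omega> \<le> V" by (auto simp: V_def add_nonneg_pos)
    \<comment> \<open>Chosen with \<open>\<epsilon> powr p * V = \<eta> / 2\<close>. For this fixed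
      \<open>\<epsilon>\<close> what remains is a constant times the integral of
      \<open>d (\<sigma> n)\<close>, which tends to zero.\<close>
    define \<epsilon> where "\<epsilon> = (\<eta> / (2 * V)) powr (1 / p)"
    have \<epsilon>: "\<epsilon> > 0" "\<epsilon> powr p = \<eta> / (2 * V)"
      using \<eta> V p by (auto simp: \<epsilon>_def powr_powr)
    have le: "(LINT x|?M. e n x) \<le> \<eta> / 2 + \<epsilon> powr (p - m) * (LINT x|?M. d (\<sigma> n) x)" for n
    proof -
      have "(LINT x|?M. e n x) \<le> (LINT x|?M. \<epsilon> powr p + \<epsilon> powr (p - m) * d (\<sigma> n) x)"
        by (intro integral_mono e_int Bochner_Integration.integrable_add integrable_mult_right d_int e_bound \<epsilon>) simp
      also have "\<dots> = \<epsilon> powr p * measure ?M \<Omega> + \<epsilon> powr (p - m) * (LINT x|?M. d (\<sigma> n) x)"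
        using d_int by (simp add: mult.commute)
      also have "\<epsilon> powr p * measure ?M \<Omega> \<le> \<epsilon> powr p * V"
        using V by (intro mult_left_mono) auto
      also have "\<epsilon> powr p * V = \<eta> / 2"
        using V \<epsilon> by simp
      finally show ?thesis by simp
    qed
    have "(\<lambda>n. \<epsilon> powr (p - m) * (LINT x|?M. d (\<sigma> n) x)) \<longlonglongrightarrow> \<epsilon> powr (p - m) * 0"
      using LIMSEQ_subseq_LIMSEQ[OF d_lim \<sigma>] by (intro tendsto_intros) (simp add: o_def)
    then have "\<forall>\<^sub>F n in sequentially. \<epsilon> powr (p - m) * (LINT x|?M. d (\<sigma> n) x) < \<eta> / 2"
      using \<eta> by (intro order_tendstoD(2)) auto
    then obtain N where N: "\<And>n. n \<ge> N \<Longrightarrow> \<epsilon> powr (p - m) * (LINT x|?M. d (\<sigma> n) x) < \<eta> / 2"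
      unfolding eventually_sequentially by blast
    have "norm ((LINT x|?M. e n x) - 0) < \<eta>" if "n \<ge> N" for n
    proof -
      have "0 \<le> (LINT x|?M. e n x)" by (intro Bochner_Integration.integral_nonneg e0)
      then show ?thesis using le[of n] N[OF that] by simp
    qed
    then show "\<exists>N. \<forall>n\<ge>N. norm ((LINT x|?M. e n x) - 0) < \<eta>" by blast
  qed
  define D where "D n x = norm (hgrad mul w (\<psi> n) x - f' (u x) *\<^sub>R g x) powr p
      + \<bar>\<psi> n x - f (u x)\<bar> powr p" for n x
  have Dm[measurable]: "D n \<in> borel_measurable ?M" for n
    unfolding D_def by measurable
  have D0: "0 \<le> D n x" for n x by (simp add: D_def)
  have D_bound: "D n x \<le> 2 powr p * K powr p * e n x + r n x" for n x
  proof -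
    let ?y = "\<phi> (\<sigma> n) x"
    have "hgrad mul w (\<psi> n) x - f' (u x) *\<^sub>R g x
        = F' n ?y *\<^sub>R (hgrad mul w (\<phi> (\<sigma> n)) x - g x) + (F' n ?y - f' (u x)) *\<^sub>R g x"
      by (simp add: h\<psi> algebra_simps)
    then have "norm (hgrad mul w (\<psi> n) x - f' (u x) *\<^sub>R g x)
        \<le> \<bar>F' n ?y\<bar> * norm (hgrad mul w (\<phi> (\<sigma> n)) x - g x) + \<bar>F' n ?y - f' (u x)\<bar> * norm (g x)"
      using norm_triangle_ineq[of "F' n ?y *\<^sub>R (hgrad mul w (\<phi> (\<sigma> n)) x - g x)" "(F' n ?y - f' (u x)) *\<^sub>R g x"]
      by simp
    also have "\<dots> \<le> K * norm (hgrad mul w (\<phi> (\<sigma> n)) x - g x) + \<bar>F' n ?y - f' (u x)\<bar> * norm (g x)"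
      using F'K by (intro add_right_mono mult_right_mono) auto
    finally have "norm (hgrad mul w (\<psi> n) x - f' (u x) *\<^sub>R g x) powr p
        \<le> (K * norm (hgrad mul w (\<phi> (\<sigma> n)) x - g x) + \<bar>F' n ?y - f' (u x)\<bar> * norm (g x)) powr p"
      using p by (intro powr_mono2) auto
    also have "\<dots> \<le> 2 powr p * ((K * norm (hgrad mul w (\<phi> (\<sigma> n)) x - g x)) powr p
        + (\<bar>F' n ?y - f' (u x)\<bar> * norm (g x)) powr p)"
      using p K0 by (intro powr_sum_le) auto
    also have "(K * norm (hgrad mul w (\<phi> (\<sigma> n)) x - g x)) powr p = K powr p * e n x"
      using K0 by (simp add: e_def powr_mult)
    finally show ?thesis
      by (simp add: D_def r_def algebra_simps)
  qed
  have DR_int: "integrable ?M (\<lambda>x. 2 powr p * K powr p * e n x + r n x)" for n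
    by (intro Bochner_Integration.integrable_add integrable_mult_right e_int r_int)
  have D_int: "integrable ?M (D n)" for n
  proof (rule Bochner_Integration.integrable_bound[OF DR_int[of n] Dm], rule AE_I2)
    fix x
    show "norm (D n x) \<le> norm (2 powr p * K powr p * e n x + r n x)"
      using D_bound[of n x] D0[of n x] unfolding real_norm_def by linarith
  qed
  have D_lim: "(\<lambda>n. LINT x|?M. D n x) \<longlonglongrightarrow> 0"
  proof (rule Lim_null_comparison)
    show "\<forall>\<^sub>F n in sequentially. norm (LINT x|?M. D n x)
        \<le> 2 powr p * K powr p * (LINT x|?M. e n x) + (LINT x|?M. r n x)"
    proof (rule always_eventually, rule allI)
      fix n
      have "0 \<le> (LINT x|?M. D n x)" by (intro Bochner_Integration.integral_nonneg D0)
      moreover have "(LINT x|?M. D n x) \<le> (LINT x|?M. 2 powr p * K powr p * e n x + r n x)"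
        by (intro integral_mono D_int DR_int D_bound)
      ultimately show "norm (LINT x|?M. D n x)
          \<le> 2 powr p * K powr p * (LINT x|?M. e n x) + (LINT x|?M. r n x)"
        using e_int r_int by simp
    qed
    show "(\<lambda>n. 2 powr p * K powr p * (LINT x|?M. e n x) + (LINT x|?M. r n x)) \<longlonglongrightarrow> 0"
      using tendsto_add[OF tendsto_mult_right_zero[OF e_lim, of "2 powr p * K powr p"] r_lim] by simp
  qed
  show thesis
  proof (rule that[of \<psi> K])
    show "\<bar>\<psi> n x\<bar> \<le> K" for n x unfolding \<psi>_def by (rule FK)
    show "(\<lambda>x. f' (u x) *\<^sub>R g x) \<in> borel_measurable ?M" by measurable
  qed (fact \<psi> \<psi>_lim fm D_int[unfolded D_def] D_lim[unfolded D_def])+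
  qed
qed

lemma has_hgrad_S0_chain:
  fixes \<Omega> :: "(real^'n) set"
  assumes G: "stratified_group mul w" and \<Omega>: "open \<Omega>" "bounded \<Omega>"
    and u: "has_hgrad_S0 mul w m \<Omega> u g" and p: "0 < p" "p \<le> m"
    and g: "integrable (lebesgue_on \<Omega>) (\<lambda>x. norm (g x) powr m)"
    and L: "L > 0" and uL: "\<And>x. x \<in> \<Omega> \<Longrightarrow> u x \<in> {0..L}"
    and f0: "f 0 = 0"
    and f: "\<And>y. y \<in> {0..L} \<Longrightarrow> (f has_real_derivative f' y) (at y within {0..L})"
    and f': "continuous_on {0..L} f'"
  shows "has_hgrad_S0 mul w p \<Omega> (\<lambda>x. f (u x)) (\<lambda>x. f' (u x) *\<^sub>R g x)"
proof (rule S0_chain[where f = f and f' = f', OF G \<Omega> u p g L uL f0 f f'])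
  fix \<psi> and K :: real
  assume \<psi>: "\<And>n. \<psi> n \<in> Cc_inf \<Omega>"
    and m: "(\<lambda>x. f (u x)) \<in> borel_measurable (lebesgue_on \<Omega>)"
      "(\<lambda>x. f' (u x) *\<^sub>R g x) \<in> borel_measurable (lebesgue_on \<Omega>)"
    and i: "\<And>n. integrable (lebesgue_on \<Omega>) (\<lambda>x. norm (hgrad mul w (\<psi> n) x - f' (u x) *\<^sub>R g x) powr p
        + \<bar>\<psi> n x - f (u x)\<bar> powr p)"
    and l: "(\<lambda>n. LINT x|lebesgue_on \<Omega>. norm (hgrad mul w (\<psi> n) x - f' (u x) *\<^sub>R g x) powr p
        + \<bar>\<psi> n x - f (u x)\<bar> powr p) \<longlonglongrightarrow> 0"
  have "(\<lambda>n. S_norm p \<Omega> (\<lambda>x. \<psi> n x - f (u x)) (\<lambda>x. hgrad mul w (\<psi> n) x - f' (u x) *\<^sub>R g x)) \<longlonglongrightarrow> 0"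
    unfolding S_norm_def
    by (rule tendsto_zero_powrI[OF l tendsto_const])
       (use p in \<open>auto intro!: always_eventually Bochner_Integration.integral_nonneg\<close>)
  then show ?thesis
    unfolding has_hgrad_S0_def using m \<psi> i by (intro conjI exI[of _ \<psi>] allI)
qed

section \<open>A weighted Poincare inequality along one horizontal field\<close>

lemma has_real_derivative_powr_Icc:
  assumes "\<kappa> > 1" and y: "y \<in> {0..L}"
  shows "((\<lambda>y. y powr \<kappa>) has_real_derivative \<kappa> * y powr (\<kappa> - 1)) (at y within {0..L})"
proof (cases "y = 0")
  case False
  then show ?thesis
    using y by (intro has_field_derivative_at_within[OF has_real_derivative_powr]) auto
next
  case True
  \<comment> \<open>At the left end point the difference quotient of the power is
    \<open>y powr (\<kappa> - 1)\<close>, which tends to zero because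
    \<open>\<kappa> > 1\<close>.\<close>
  have "((\<lambda>y. y powr (\<kappa> - 1)) \<longlongrightarrow> 0) (at 0 within {0..L})"
  proof (rule tendsto_zero_powrI[OF tendsto_ident_at tendsto_const])
    show "\<forall>\<^sub>F y in at 0 within {0..L}. 0 \<le> y"
      unfolding eventually_at_filter by (rule always_eventually) simp
  qed (use assms(1) in simp)
  then have "((\<lambda>y. (y powr \<kappa> - 0 powr \<kappa>) / (y - 0)) \<longlongrightarrow> 0) (at 0 within {0..L})"
  proof (rule Lim_transform_eventually)
    show "\<forall>\<^sub>F y in at 0 within {0..L}. y powr (\<kappa> - 1) = (y powr \<kappa> - 0 powr \<kappa>) / (y - 0)"
      unfolding eventually_at_filter using assms(1) by (intro always_eventually) (simp add: powr_diff)
  qed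
  then show ?thesis
    using assms(1) unfolding True has_field_derivative_iff by simp
qed

lemma continuous_on_powr_Icc: "\<kappa> > 0 \<Longrightarrow> continuous_on {0..L} (\<lambda>y::real. c * y powr \<kappa>)"
  by (intro continuous_on_mult_left continuous_on_powr' continuous_on_id continuous_on_const) auto

text \<open>If \<open>B * b \<le> a / 2\<close>, the left side is at most half of
  \<open>a powr r\<close>; otherwise \<open>a < 2 * (B * b)\<close>, and it is at most half of
  \<open>(2 * (B * b)) powr r\<close>. The coefficient \<open>1 / 2\<close> allows the first term to
  be absorbed afterwards.\<close>

lemma young_powr:
  fixes a b B r :: real
  assumes "0 \<le> a" "0 \<le> b" "0 \<le> B" "1 < r"
  shows "B * a powr (r - 1) * b \<le> a powr r / 2 + (2 * B) powr r / 2 * b powr r"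
proof (cases "B * b \<le> a / 2")
  case True
  have "B * a powr (r - 1) * b = a powr (r - 1) * (B * b)" by simp
  also have "\<dots> \<le> a powr (r - 1) * (a / 2)"
    using True by (intro mult_left_mono) auto
  also have "\<dots> = a powr r / 2"
    using assms by (cases "a = 0") (auto simp: powr_diff)
  finally show ?thesis by (simp add: add_increasing2)
next
  case False
  then have pos: "B * b > 0" using assms by linarith
  have "B * a powr (r - 1) * b = a powr (r - 1) * (B * b)" by simp
  also have "\<dots> \<le> (2 * (B * b)) powr (r - 1) * (B * b)"
    using assms False by (intro mult_right_mono powr_mono2) auto
  also have "\<dots> = (2 * (B * b)) powr r / 2"
    using pos by (simp add: powr_diff)
  also have "\<dots> = (2 * B) powr r / 2 * b powr r"
    using assms by (simp add: powr_mult)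
  finally show ?thesis by (simp add: add_increasing)
qed

text \<open>The divergence identity passes to the limit \<open>u powr (k + r)\<close> with exponent
  \<open>1\<close> in the chain rule: it is linear in the function and its gradient, and
  \<open>x $ j\<close> is bounded, so L^1 convergence suffices. Splitting
  \<open>u powr (k + r - 1)\<close> into \<open>u powr k * u powr (r - 1)\<close>, Young's
  inequality with the weight \<open>u powr k\<close> returns half of the left side.\<close>

lemma horizontal_poincare:
  fixes \<Omega> :: "(real^'n) set"
  assumes G: "stratified_group mul w" and j: "w j = 1" and \<Omega>: "open \<Omega>" "bounded \<Omega>"
    and u: "has_hgrad_S0 mul w m \<Omega> u g" and r: "1 < r" "r \<le> m" and k: "0 < k"
    and g: "integrable (lebesgue_on \<Omega>) (\<lambda>x. norm (g x) powr m)"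
    and L: "L > 0" and uL: "\<And>x. x \<in> \<Omega> \<Longrightarrow> u x \<in> {0..L}"
    and B: "\<And>x. x \<in> \<Omega> \<Longrightarrow> \<bar>x $ j\<bar> \<le> B"
  shows "integrable (lebesgue_on \<Omega>) (\<lambda>x. u x powr (k + r))"
    and "integrable (lebesgue_on \<Omega>) (\<lambda>x. u x powr k * norm (g x) powr r)"
    and "(LINT x|lebesgue_on \<Omega>. u x powr (k + r))
      \<le> (2 * ((k + r) * B)) powr r * (LINT x|lebesgue_on \<Omega>. u x powr k * norm (g x) powr r)"
proof -
  let ?M = "lebesgue_on \<Omega>"
  let ?f = "\<lambda>y. y powr (k + r)" and ?f' = "\<lambda>y. (k + r) * y powr (k + r - 1)"
  interpret finite_measure ?M
    by (rule finite_measure_lebesgue_on[OF \<Omega>])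
  have um[measurable]: "u \<in> borel_measurable ?M" and gm[measurable]: "g \<in> borel_measurable ?M"
    using u by (simp_all add: has_hgrad_S0_def)
  have j_m[measurable]: "(\<lambda>x. x $ j) \<in> borel_measurable ?M"
  proof (rule continuous_imp_measurable_on_sets_lebesgue)
    show "continuous_on \<Omega> (\<lambda>x. x $ j)"
      by (rule linear_continuous_on) (rule bounded_linear_vec_nth)
  qed (use \<Omega>(1) in simp)
  have gr: "integrable ?M (\<lambda>x. norm (g x) powr r)"
    by (rule integrable_norm_powr_mono[OF g gm]) (use r in auto)
  have u_le: "\<bar>u x powr a\<bar> \<le> L powr a" if "x \<in> \<Omega>" "a > 0" for x a
    using powr_mono2[of a "u x" L] uL[OF that(1)] that(2) by simp
  show iu: "integrable ?M (\<lambda>x. u x powr (k + r))"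
  proof (rule integrable_const_bound[of _ "L powr (k + r)"], rule AE_I2)
    show "norm (u x powr (k + r)) \<le> L powr (k + r)" if "x \<in> space ?M" for x
      using u_le[of x "k + r"] that k r by simp
  qed measurable
  show ig: "integrable ?M (\<lambda>x. u x powr k * norm (g x) powr r)"
  proof (rule Bochner_Integration.integrable_bound[OF integrable_mult_right[OF gr, of "L powr k"]], measurable, rule AE_I2)
    fix x assume "x \<in> space ?M"
    then have "u x powr k \<le> L powr k" using u_le[of x k] k by simp
    then have "u x powr k * norm (g x) powr r \<le> L powr k * norm (g x) powr r"
      by (intro mult_right_mono) auto
    then show "norm (u x powr k * norm (g x) powr r) \<le> norm (L powr k * norm (g x) powr r)"
      by simp
  qed
  have ident: "integrable ?M (\<lambda>x. ?f (u x) + x $ j * (?f' (u x) *\<^sub>R g x) $ j) \<and>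
      (LINT x|?M. ?f (u x) + x $ j * (?f' (u x) *\<^sub>R g x) $ j) = 0"
  proof (rule S0_chain[OF G \<Omega> u zero_less_one _ g L uL, where f = ?f and f' = ?f'])
    show "1 \<le> m" using r by simp
    show "(?f has_real_derivative ?f' y) (at y within {0..L})" if "y \<in> {0..L}" for y
      using has_real_derivative_powr_Icc[of "k + r" y L] that r k by simp
    show "continuous_on {0..L} ?f'"
      using continuous_on_powr_Icc[of "k + r - 1"] r k by simp
  next
    fix \<psi> and K :: real
    assume \<psi>: "\<And>n. \<psi> n \<in> Cc_inf \<Omega>"
      and hm: "(\<lambda>x. ?f' (u x) *\<^sub>R g x) \<in> borel_measurable ?M"
      and i: "\<And>n. integrable ?M (\<lambda>x. norm (hgrad mul w (\<psi> n) x - ?f' (u x) *\<^sub>R g x) powr 1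
        + \<bar>\<psi> n x - ?f (u x)\<bar> powr 1)"
      and l: "(\<lambda>n. LINT x|?M. norm (hgrad mul w (\<psi> n) x - ?f' (u x) *\<^sub>R g x) powr 1
        + \<bar>\<psi> n x - ?f (u x)\<bar> powr 1) \<longlonglongrightarrow> 0"
    define h where "h x = ?f' (u x) *\<^sub>R g x" for x
    have [measurable]: "h \<in> borel_measurable ?M" using hm by (simp add: h_def[abs_def])
    define D where "D n x = norm (hgrad mul w (\<psi> n) x - h x) + \<bar>\<psi> n x - ?f (u x)\<bar>" for n x
    have i: "integrable ?M (D n)" and l: "(\<lambda>n. LINT x|?M. D n x) \<longlonglongrightarrow> 0" for n
      using i[of n] l by (simp_all add: D_def[abs_def] h_def)
    \<comment> \<open>\<open>A\<close> is the integrand of the identity for the limit,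
      \<open>C n\<close> the one for the test function \<open>\<psi> n\<close>. The latter
      integrates to zero, and \<open>C n - A\<close> is controlled by \<open>D n\<close>.\<close>
    define A where "A x = ?f (u x) + x $ j * h x $ j" for x
    define C where "C n x = \<psi> n x + x $ j * hgrad mul w (\<psi> n) x $ j" for n x
    have C0: "(LINT x|?M. C n x) = 0" for n
      unfolding C_def by (rule integral_hgrad_identity[OF G j \<Omega>(1) \<psi>])
    have [measurable]: "\<psi> n \<in> borel_measurable ?M" for n
      by (rule continuous_imp_measurable_lebesgue_on_open[OF
            smooth_on_imp_continuous_on[OF Cc_inf_smooth[OF \<psi>]] subset_UNIV \<Omega>(1)])
    have [measurable]: "hgrad mul w (\<psi> n) \<in> borel_measurable ?M" for n
      by (rule continuous_imp_measurable_lebesgue_on_open[OF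
            continuous_on_hgrad[OF G Cc_inf_smooth[OF \<psi>]] subset_UNIV \<Omega>(1)])
    have vec_m: "(\<lambda>x. v x $ j) \<in> borel_measurable ?M" if "v \<in> borel_measurable ?M" for v :: "real^'n \<Rightarrow> real^'n"
      by (rule measurable_compose[OF that borel_measurable_continuous_onI])
         (rule linear_continuous_on, rule bounded_linear_vec_nth)
    have [measurable]: "A \<in> borel_measurable ?M" "C n \<in> borel_measurable ?M" for n
      unfolding A_def[abs_def] C_def[abs_def]
      by (intro borel_measurable_add borel_measurable_times j_m vec_m; measurable)+
    have CA: "\<bar>C n x - A x\<bar> \<le> (1 + B) * D n x" if x: "x \<in> \<Omega>" for n x
    proof -
      let ?v = "hgrad mul w (\<psi> n) x - h x"
      have "C n x - A x = (\<psi> n x - ?f (u x)) + x $ j * ?v $ j"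
        by (simp add: C_def A_def algebra_simps)
      then have "\<bar>C n x - A x\<bar> \<le> \<bar>\<psi> n x - ?f (u x)\<bar> + \<bar>x $ j\<bar> * \<bar>?v $ j\<bar>"
        by (metis abs_mult abs_triangle_ineq)
      also have "\<bar>x $ j\<bar> * \<bar>?v $ j\<bar> \<le> B * norm ?v"
        using B[OF x] component_le_norm_cart[of ?v j] by (intro mult_mono) auto
      finally have "\<bar>C n x - A x\<bar> \<le> \<bar>\<psi> n x - ?f (u x)\<bar> + B * norm ?v" by simp
      moreover have "0 \<le> B * \<bar>\<psi> n x - ?f (u x)\<bar>"
        using B[OF x] by (intro mult_nonneg_nonneg) auto
      moreover have "(1 + B) * D n x = norm ?v + B * norm ?v + \<bar>\<psi> n x - ?f (u x)\<bar>
          + B * \<bar>\<psi> n x - ?f (u x)\<bar>"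
        by (simp add: D_def algebra_simps)
      ultimately show ?thesis
        using norm_ge_zero[of ?v] by linarith
    qed
    have iCA: "integrable ?M (\<lambda>x. C n x - A x)" for n
    proof (rule Bochner_Integration.integrable_bound[OF integrable_mult_right[OF i, of "1 + B"]], measurable, rule AE_I2)
      fix x assume "x \<in> space ?M"
      then show "norm (C n x - A x) \<le> norm ((1 + B) * D n x)"
        using CA[of x n] unfolding real_norm_def by simp
    qed
    have iA: "integrable ?M A"
    proof -
      have ih: "integrable ?M (\<lambda>x. norm (g x) powr 1)"
        by (rule integrable_norm_powr_mono[OF g gm]) (use r in auto)
      show ?thesis
        unfolding A_def[abs_def]
      proof (rule Bochner_Integration.integrable_add[OF iu],
          rule Bochner_Integration.integrable_bound[OF integrable_mult_right[OF ih, of "B * ((k + r) * L powr (k + r - 1))"]])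
        show "(\<lambda>x. x $ j * h x $ j) \<in> borel_measurable ?M"
          by (intro borel_measurable_times j_m vec_m) measurable
        show "AE x in ?M. norm (x $ j * h x $ j) \<le> norm (B * ((k + r) * L powr (k + r - 1)) * norm (g x) powr 1)"
        proof (rule AE_I2)
          fix x assume "x \<in> space ?M"
          then have x: "x \<in> \<Omega>" by simp
          have "\<bar>h x $ j\<bar> \<le> norm (h x)" by (rule component_le_norm_cart)
          also have "\<dots> = ((k + r) * u x powr (k + r - 1)) * norm (g x)"
            using k r by (simp add: h_def)
          also have "\<dots> \<le> ((k + r) * L powr (k + r - 1)) * norm (g x)"
            using u_le[OF x, of "k + r - 1"] k r by (intro mult_right_mono mult_left_mono) auto
          finally have "\<bar>x $ j\<bar> * \<bar>h x $ j\<bar> \<le> B * (((k + r) * L powr (k + r - 1)) * norm (g x))"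
            using B[OF x] by (intro mult_mono) auto
          moreover have "\<bar>B\<bar> = B" "\<bar>k + r\<bar> = k + r" using B[OF x] k r by auto
          ultimately show "norm (x $ j * h x $ j) \<le> norm (B * ((k + r) * L powr (k + r - 1)) * norm (g x) powr 1)"
            by (simp add: abs_mult mult.assoc)
        qed
      qed
    qed
    have "\<bar>LINT x|?M. A x\<bar> \<le> (1 + B) * (LINT x|?M. D n x)" for n
    proof -
      have iC: "integrable ?M (C n)"
        using Bochner_Integration.integrable_add[OF iCA[of n] iA] by simp
      have "\<bar>LINT x|?M. A x\<bar> = \<bar>LINT x|?M. C n x - A x\<bar>"
        using iC iA C0[of n] by simp
      also have "\<dots> \<le> (LINT x|?M. \<bar>C n x - A x\<bar>)"
        by (rule integral_abs_bound)
      also have "\<dots> \<le> (LINT x|?M. (1 + B) * D n x)"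
        using iCA i CA by (intro integral_mono) auto
      also have "\<dots> = (1 + B) * (LINT x|?M. D n x)" by simp
      finally show ?thesis .
    qed
    moreover have "(\<lambda>n. (1 + B) * (LINT x|?M. D n x)) \<longlonglongrightarrow> 0"
      using tendsto_mult_right_zero[OF l] .
    ultimately have "\<bar>LINT x|?M. A x\<bar> \<le> 0"
      by (intro LIMSEQ_le_const[where X = "\<lambda>n. (1 + B) * (LINT x|?M. D n x)"]) auto
    then show ?thesis
      using iA unfolding A_def[abs_def] h_def by simp
  qed (use r k in auto)
  \<comment> \<open>The constant of Young's inequality for the coefficient
    \<open>(k + r) * B\<close>, where \<open>k + r\<close> comes from the derivative of the power
    and \<open>B\<close> bounds the coordinate.\<close>
  define c where "c = (2 * ((k + r) * B)) powr r"
  have pw: "- (x $ j * (?f' (u x) *\<^sub>R g x) $ j) \<le> u x powr (k + r) / 2 + c / 2 * (u x powr k * norm (g x) powr r)"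
    if x: "x \<in> \<Omega>" for x
  proof -
    have B0: "0 \<le> B" using B[OF x] by simp
    have u0: "0 \<le> u x" using uL[OF x] by simp
    have "- (x $ j * (?f' (u x) *\<^sub>R g x) $ j) \<le> \<bar>x $ j\<bar> * \<bar>(?f' (u x) *\<^sub>R g x) $ j\<bar>"
      by (simp only: abs_mult[symmetric] abs_ge_minus_self)
    also have "\<dots> \<le> B * norm (?f' (u x) *\<^sub>R g x)"
      by (intro mult_mono B[OF x] component_le_norm_cart B0 abs_ge_zero)
    also have "\<dots> = B * ((k + r) * u x powr (k + r - 1) * norm (g x))"
      using k r by simp
    also have "\<dots> = u x powr k * (((k + r) * B) * u x powr (r - 1) * norm (g x))"
    proof -
      have e: "u x powr (k + r - 1) = u x powr k * u x powr (r - 1)"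
        by (simp flip: powr_add add: algebra_simps)
      show ?thesis unfolding e by (simp add: algebra_simps)
    qed
    also have "\<dots> \<le> u x powr k * (u x powr r / 2 + c / 2 * norm (g x) powr r)"
      unfolding c_def using u0 B0 k r by (intro mult_left_mono young_powr) auto
    also have "\<dots> = u x powr (k + r) / 2 + c / 2 * (u x powr k * norm (g x) powr r)"
      by (simp add: algebra_simps powr_add)
    finally show ?thesis .
  qed
  have "(LINT x|?M. u x powr (k + r)) = (LINT x|?M. - (x $ j * (?f' (u x) *\<^sub>R g x) $ j))"
  proof -
    have "integrable ?M (\<lambda>x. x $ j * (?f' (u x) *\<^sub>R g x) $ j)"
      using Bochner_Integration.integrable_diff[OF ident[THEN conjunct1] iu] by simp
    then show ?thesis
      using ident iu by simp
  qed
  also have "\<dots> \<le> (LINT x|?M. u x powr (k + r) / 2 + c / 2 * (u x powr k * norm (g x) powr r))"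
  proof (rule integral_mono)
    have "integrable ?M (\<lambda>x. (?f (u x) + x $ j * (?f' (u x) *\<^sub>R g x) $ j) - ?f (u x))"
      by (rule Bochner_Integration.integrable_diff[OF ident[THEN conjunct1] iu])
    then show "integrable ?M (\<lambda>x. - (x $ j * (?f' (u x) *\<^sub>R g x) $ j))"
      by simp
    show "integrable ?M (\<lambda>x. u x powr (k + r) / 2 + c / 2 * (u x powr k * norm (g x) powr r))"
      using iu ig by simp
  qed (use pw in auto)
  also have "\<dots> = (LINT x|?M. u x powr (k + r)) / 2 + c / 2 * (LINT x|?M. u x powr k * norm (g x) powr r)"
    using iu ig by simp
  finally show "(LINT x|?M. u x powr (k + r))
      \<le> (2 * ((k + r) * B)) powr r * (LINT x|?M. u x powr k * norm (g x) powr r)"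
    by (simp add: c_def)
qed

subsection \<open>Weak time derivatives\<close>

lemma continuous_on_slice:
  assumes "continuous_on ({0..<T} \<times> closure \<Omega>) (u :: real \<times> 'a::euclidean_space \<Rightarrow> real)" and "t \<in> {0..<T}"
  shows "continuous_on (closure \<Omega>) (\<lambda>x. u (t, x))"
  by (rule continuous_on_compose2[OF assms(1)]) (use assms(2) in \<open>auto intro!: continuous_intros\<close>)

text \<open>The function may become unbounded as time approaches \<open>T\<close>, so bounds are
  always taken on compact parts of the half-open time interval.\<close>

lemma cylinder_bound:
  fixes u :: "real \<times> 'a::euclidean_space \<Rightarrow> real"
  assumes "continuous_on ({0..<T} \<times> closure \<Omega>) u" "bounded \<Omega>" "T' < T"
  obtains L where "L > 0" and "\<forall>t\<in>{0..T'}. \<forall>x\<in>closure \<Omega>. \<bar>u (t, x)\<bar> \<le> L"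
proof -
  have "compact ({0..T'} \<times> closure \<Omega>)"
    using assms(2) by (intro compact_Times) auto
  moreover have "continuous_on ({0..T'} \<times> closure \<Omega>) u"
    using assms(3) by (intro continuous_on_subset[OF assms(1)]) auto
  ultimately have "bounded (u ` ({0..T'} \<times> closure \<Omega>))"
    by (intro compact_imp_bounded compact_continuous_image)
  then obtain L where L: "\<And>z. z \<in> {0..T'} \<times> closure \<Omega> \<Longrightarrow> \<bar>u z\<bar> \<le> L"
    unfolding bounded_iff by auto
  show ?thesis
  proof (rule that[of "max L 1"])
    show "\<forall>t\<in>{0..T'}. \<forall>x\<in>closure \<Omega>. \<bar>u (t, x)\<bar> \<le> max L 1"
    proof (intro ballI)
      fix t x assume "t \<in> {0..T'}" "x \<in> closure \<Omega>"
      then show "\<bar>u (t, x)\<bar> \<le> max L 1"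
        using L[of "(t, x)"] by simp
    qed
  qed simp
qed

lemma continuous_on_slice_integral:
  fixes u :: "real \<times> 'a::euclidean_space \<Rightarrow> real"
  assumes u: "continuous_on ({0..<T} \<times> closure \<Omega>) u" and \<Omega>: "open \<Omega>" "bounded \<Omega>"
  shows "continuous_on {0..<T} (\<lambda>t. LINT x|lebesgue_on \<Omega>. u (t, x))"
  unfolding continuous_on_sequentially o_def
proof (intro ballI allI impI)
  interpret finite_measure "lebesgue_on \<Omega>"
    by (rule finite_measure_lebesgue_on[OF \<Omega>])
  fix X :: "nat \<Rightarrow> real" and t assume t: "t \<in> {0..<T}" and X: "(\<forall>n. X n \<in> {0..<T}) \<and> X \<longlonglongrightarrow> t"
  \<comment> \<open>A time between the limit \<open>t\<close> and \<open>T\<close>: the tail of the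
    sequence stays below it, where a constant majorant is available.\<close>
  define T' where "T' = (t + T) / 2"
  have T': "t < T'" "T' < T" using t by (auto simp: T'_def)
  obtain L where "L > 0" and L: "\<forall>t\<in>{0..T'}. \<forall>x\<in>closure \<Omega>. \<bar>u (t, x)\<bar> \<le> L"
    by (rule cylinder_bound[OF u \<Omega>(2) T'(2)])
  have "\<forall>\<^sub>F n in sequentially. X n < T'"
    using X T'(1) by (intro order_tendstoD(2)) auto
  then obtain N where N: "\<And>n. n \<ge> N \<Longrightarrow> X n < T'"
    unfolding eventually_sequentially by blast
  have m: "(\<lambda>x. u (t, x)) \<in> borel_measurable (lebesgue_on \<Omega>)" if "t \<in> {0..<T}" for t
    by (rule continuous_imp_measurable_lebesgue_on_open[OF continuous_on_slice[OF u that] closure_subset \<Omega>(1)])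
  have "(\<lambda>n. LINT x|lebesgue_on \<Omega>. u (X (n + N), x)) \<longlonglongrightarrow> (LINT x|lebesgue_on \<Omega>. u (t, x))"
  proof (rule integral_dominated_convergence[where w = "\<lambda>_. L"])
    show "AE x in lebesgue_on \<Omega>. norm (u (X (n + N), x)) \<le> L" for n
    proof (rule AE_I2)
      fix x assume "x \<in> space (lebesgue_on \<Omega>)"
      then show "norm (u (X (n + N), x)) \<le> L"
        using L[rule_format, of "X (n + N)" x] X N[of "n + N"] closure_subset[of \<Omega>] by auto
    qed
    show "AE x in lebesgue_on \<Omega>. (\<lambda>n. u (X (n + N), x)) \<longlonglongrightarrow> u (t, x)"
    proof (rule AE_I2)
      fix x assume "x \<in> space (lebesgue_on \<Omega>)"
      then have x: "x \<in> closure \<Omega>" using closure_subset[of \<Omega>] by auto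
      have "(\<lambda>n. (X (n + N), x)) \<longlonglongrightarrow> (t, x)"
        using X by (intro tendsto_Pair tendsto_const LIMSEQ_ignore_initial_segment) simp
      then show "(\<lambda>n. u (X (n + N), x)) \<longlonglongrightarrow> u (t, x)"
        by (rule continuous_on_tendsto_compose[OF u]) (use X t x in auto)
    qed
  qed (use m X t in auto)
  then show "(\<lambda>n. LINT x|lebesgue_on \<Omega>. u (X n, x)) \<longlonglongrightarrow> (LINT x|lebesgue_on \<Omega>. u (t, x))"
    by (rule LIMSEQ_offset)
qed

lemma time_deriv_integrable:
  assumes "has_time_deriv_L2 T \<Omega> u v" and \<Omega>: "open \<Omega>" "bounded \<Omega>"
  shows "integrable (lebesgue_on (cylinder T \<Omega>)) v"
proof -
  have "open (cylinder T \<Omega>)" "bounded (cylinder T \<Omega>)"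
    using \<Omega> by (auto intro: open_Times bounded_Times)
  then interpret finite_measure "lebesgue_on (cylinder T \<Omega>)"
    by (rule finite_measure_lebesgue_on)
  have v: "v \<in> borel_measurable (lebesgue_on (cylinder T \<Omega>))"
    "integrable (lebesgue_on (cylinder T \<Omega>)) (\<lambda>z. (v z)\<^sup>2)"
    using assms(1) by (simp_all add: has_time_deriv_L2_def)
  show ?thesis
    using square_integrable_imp_integrable[OF v] .
qed

text \<open>The kernel is nonnegative, has total mass \<open>1\<close> and lives on
  \<open>{\<tau>..\<tau> + 1 / c}\<close>, so the integral is an average of \<open>U\<close> over a
  shrinking interval to the right of \<open>\<tau>\<close>.\<close>

lemma smooth_step_mollifier:
  fixes U :: "real \<Rightarrow> real" and S' :: "real \<Rightarrow> real"
  assumes S: "\<And>x. (S has_field_derivative S' x) (at x)"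
    and S': "continuous_on UNIV S'" "\<And>x. 0 \<le> S' x" "\<And>x. x \<notin> {0..1} \<Longrightarrow> S' x = 0"
    and S01: "S 0 = 0" "S 1 = 1"
    and U: "continuous_on {0..<T} U" and \<tau>: "0 < \<tau>" "\<tau> < T"
    and int: "\<And>c. c > 0 \<Longrightarrow> \<tau> + 1 / c < T \<Longrightarrow> integrable (lebesgue_on {0<..<T}) (\<lambda>t. c * S' (c * (t - \<tau>)) * U t)"
  shows "((\<lambda>c. LINT t|lebesgue_on {0<..<T}. c * S' (c * (t - \<tau>)) * U t) \<longlongrightarrow> U \<tau>) at_top"
proof (rule tendstoI)
  fix \<epsilon> :: real assume \<epsilon>: "\<epsilon> > 0"
  have "\<tau> \<in> {0..<T}" "\<epsilon> / 2 > 0" using \<tau> \<epsilon> by auto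
  from U[unfolded continuous_on_iff, rule_format, OF this]
  obtain d where d: "d > 0" "\<And>t. t \<in> {0..<T} \<Longrightarrow> dist t \<tau> < d \<Longrightarrow> dist (U t) (U \<tau>) < \<epsilon> / 2"
    by blast
  define e where "e = min d (T - \<tau>)"
  have e: "e > 0" using d \<tau> by (simp add: e_def)
  have "\<forall>\<^sub>F c in at_top. c > 1 / e"
    by (rule eventually_gt_at_top)
  then show "\<forall>\<^sub>F c in at_top. dist (LINT t|lebesgue_on {0<..<T}. c * S' (c * (t - \<tau>)) * U t) (U \<tau>) < \<epsilon>"
  proof eventually_elim
    case (elim c)
    have c0: "c > 0" using elim e by (smt (verit) divide_pos_pos)
    have ce: "1 / c < e" using elim e c0 by (simp add: field_simps)
    let ?b = "\<tau> + 1 / c"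
    let ?m = "\<lambda>t. c * S' (c * (t - \<tau>))"
    have b: "\<tau> < ?b" "?b < T" "?b < \<tau> + d" using ce c0 by (auto simp: e_def)
    have m_int: "(?m has_integral 1) {\<tau>..?b}"
    proof -
      have "(?m has_integral S (c * (?b - \<tau>)) - S (c * (\<tau> - \<tau>))) {\<tau>..?b}"
      proof (rule fundamental_theorem_of_calculus)
        show "((\<lambda>t. S (c * (t - \<tau>))) has_vector_derivative ?m t) (at t within {\<tau>..?b})" for t
        proof -
          have "((\<lambda>t. c * (t - \<tau>)) has_field_derivative c) (at t)"
            by (auto intro!: derivative_eq_intros)
          from DERIV_chain2[OF S this]
          have "((\<lambda>t. S (c * (t - \<tau>))) has_vector_derivative ?m t) (at t)"
            by (simp add: has_real_derivative_iff_has_vector_derivative mult.commute)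
          then show ?thesis by (rule has_vector_derivative_at_within)
        qed
      qed (use b in simp)
      then show ?thesis using c0 S01 by simp
    qed
    have m0: "?m t \<ge> 0" for t using c0 S'(2) by simp
    have mz: "?m t = 0" if "t \<notin> {\<tau>..?b}" for t
    proof -
      have "c * (t - \<tau>) \<notin> {0..1}"
        using that c0 by (auto simp: field_simps zero_le_mult_iff)
      then show ?thesis using S'(3) by simp
    qed
    have contm: "continuous_on A ?m" for A
      by (intro continuous_intros continuous_on_compose2[OF S'(1)]) auto
    have contU: "continuous_on {\<tau>..?b} U"
      using \<tau> b by (intro continuous_on_subset[OF U]) auto
    have sub: "{\<tau>..?b} \<subseteq> {0<..<T}" using \<tau> b by auto
    have "(LINT t|lebesgue_on {0<..<T}. ?m t * U t) = integral {0<..<T} (\<lambda>t. ?m t * U t)"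
      using int[OF c0 b(2)] by (intro lebesgue_integral_eq_integral) auto
    also have "\<dots> = integral {\<tau>..?b} (\<lambda>t. ?m t * U t)"
    proof (rule integral_unique, rule has_integral_on_superset[OF _ _ sub])
      show "((\<lambda>t. ?m t * U t) has_integral integral {\<tau>..?b} (\<lambda>t. ?m t * U t)) {\<tau>..?b}"
        by (intro integrable_integral integrable_continuous_interval continuous_intros contm contU)
    qed (use mz in auto)
    finally have I: "(LINT t|lebesgue_on {0<..<T}. ?m t * U t) = integral {\<tau>..?b} (\<lambda>t. ?m t * U t)" .
    have i1: "((\<lambda>t. ?m t * U t - ?m t * U \<tau>) has_integral
        integral {\<tau>..?b} (\<lambda>t. ?m t * U t) - 1 * U \<tau>) {\<tau>..?b}"
      by (intro has_integral_diff has_integral_mult_left m_int integrable_integral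
          integrable_continuous_interval continuous_intros contm contU)
    have i2: "((\<lambda>t. ?m t * (\<epsilon> / 2)) has_integral 1 * (\<epsilon> / 2)) {\<tau>..?b}"
      by (intro has_integral_mult_left m_int)
    have "norm (integral {\<tau>..?b} (\<lambda>t. ?m t * U t) - 1 * U \<tau>) \<le> 1 * (\<epsilon> / 2)"
      unfolding integral_unique[OF i1, symmetric] integral_unique[OF i2, symmetric]
    proof (rule integral_norm_bound_integral[OF has_integral_integrable[OF i1] has_integral_integrable[OF i2]])
      fix t assume t: "t \<in> {\<tau>..?b}"
      have "\<bar>U t - U \<tau>\<bar> \<le> \<epsilon> / 2"
        using d(2)[of t] t \<tau> b by (auto simp: dist_real_def)
      then have "?m t * \<bar>U t - U \<tau>\<bar> \<le> ?m t * (\<epsilon> / 2)"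
        using m0 by (intro mult_left_mono)
      then show "norm (?m t * U t - ?m t * U \<tau>) \<le> ?m t * (\<epsilon> / 2)"
        unfolding right_diff_distrib[symmetric] real_norm_def
          abs_mult[of "c * S' (c * (t - \<tau>))"] abs_of_nonneg[OF m0] .
    qed
    then show ?case
      using \<epsilon> unfolding I dist_real_def by simp
  qed
qed

lemma smooth_step_bounds:
  fixes S S' :: "real \<Rightarrow> real"
  assumes S: "\<And>x. (S has_field_derivative S' x) (at x)" and S': "\<And>x. 0 \<le> S' x"
    and S0: "\<And>x. x \<le> 0 \<Longrightarrow> S x = 0" and S1: "\<And>x. x \<ge> 1 \<Longrightarrow> S x = 1"
  shows "0 \<le> S x \<and> S x \<le> 1"
proof -
  have mono: "S x \<le> S y" if "x \<le> y" for x y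
    using that by (rule DERIV_nonneg_imp_nondecreasing) (use S S' in blast)
  have "S (min x 0) \<le> S x" "S x \<le> S (max x 1)" by (auto intro: mono)
  then show ?thesis using S0[of "min x 0"] S1[of "max x 1"] by simp
qed

lemma Cc_inf_product:
  fixes b :: "'a::euclidean_space \<Rightarrow> real"
  assumes a: "smooth_on UNIV a" "\<And>t. t \<notin> {c..d} \<Longrightarrow> a t = 0" "{c..d} \<subseteq> {0<..<T}"
    and b: "b \<in> Cc_inf \<Omega>"
  shows "(\<lambda>z. a (fst z) * b (snd z)) \<in> Cc_inf (cylinder T \<Omega>)"
proof -
  let ?\<eta> = "\<lambda>z. a (fst z) * b (snd z)"
  let ?K = "closure {x. b x \<noteq> 0}"
  have sm: "smooth_on UNIV ?\<eta>"
    unfolding smooth_on_def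
  proof
    fix k
    have "Ck_on k UNIV a" "Ck_on k UNIV b"
      using a(1) Cc_inf_smooth[OF b] by (simp_all add: smooth_on_def)
    note Ck_on_compose_affine[OF this(1) bounded_linear_fst, of 0]
      Ck_on_compose_affine[OF this(2) bounded_linear_snd, of 0]
    then show "Ck_on k UNIV ?\<eta>"
      unfolding add_0 by (rule Ck_on_mult)
  qed
  have K: "compact ?K" "?K \<subseteq> \<Omega>" using b by (simp_all add: Cc_inf_def)
  have "{z. ?\<eta> z \<noteq> 0} \<subseteq> {c..d} \<times> ?K"
  proof
    fix z assume "z \<in> {z. ?\<eta> z \<noteq> 0}"
    then have "a (fst z) \<noteq> 0" "b (snd z) \<noteq> 0" by auto
    then have "fst z \<in> {c..d}" "snd z \<in> {x. b x \<noteq> 0}" using a(2)[of "fst z"] by auto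
    then show "z \<in> {c..d} \<times> ?K"
      unfolding mem_Times_iff using subsetD[OF closure_subset, of "snd z" "{x. b x \<noteq> 0}"] by (intro conjI)
  qed
  moreover have comp: "compact ({c..d} \<times> ?K)"
    using K(1) by (intro compact_Times) auto
  ultimately have sub: "closure {z. ?\<eta> z \<noteq> 0} \<subseteq> {c..d} \<times> ?K"
    by (rule closure_minimal[OF _ compact_imp_closed])
  have "compact (closure {z. ?\<eta> z \<noteq> 0})"
    by (rule compact_closure_subset[OF comp sub])
  moreover have "closure {z. ?\<eta> z \<noteq> 0} \<subseteq> cylinder T \<Omega>"
    by (rule order_trans[OF sub Sigma_mono[OF a(3) K(2)]])
  ultimately show ?thesis
    using sm unfolding Cc_inf_def mem_Collect_eq by (intro conjI)
qed

lemma frechet_derivative_product_time: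
  fixes b :: "'a::euclidean_space \<Rightarrow> real"
  assumes "(a has_field_derivative a') (at (fst z))" and "smooth_on UNIV b"
  shows "frechet_derivative (\<lambda>z. a (fst z) * b (snd z)) (at z) (1, 0) = a' * b (snd z)"
proof -
  note db = smooth_on_has_derivative[OF assms(2)]
  have "((\<lambda>z. a (fst z) * b (snd z)) has_derivative
      (\<lambda>h. a (fst z) * frechet_derivative b (at (snd z)) (snd h) + (a' * fst h) * b (snd z))) (at z)"
    by (intro has_derivative_mult has_derivative_compose[OF has_derivative_fst[OF has_derivative_ident]
          assms(1)[unfolded has_field_derivative_def]]
        has_derivative_compose[OF has_derivative_snd[OF has_derivative_ident] db])
  from fun_cong[OF frechet_derivative_at[OF this, symmetric], of "(1, 0)"]
  show ?thesis
    using linear_0[OF has_derivative_linear[OF db]] by simp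
qed

text \<open>The weak time derivative is tested with \<open>A c (fst z) * b (snd z)\<close>, where
  \<open>A c\<close> rises right after \<open>t1\<close> and falls right after \<open>t2\<close>. As
  \<open>c\<close> grows, the derivative of \<open>A c\<close> turns into a unit mass at
  \<open>t1\<close> minus one at \<open>t2\<close>, and \<open>A c\<close> itself into the indicator
  of \<open>{t1<..t2}\<close>.\<close>

lemma integral_time_increment:
  fixes u v :: "real \<times> (real^'n) \<Rightarrow> real"
  assumes \<Omega>: "open \<Omega>" "bounded \<Omega>" and u: "continuous_on ({0..<T} \<times> closure \<Omega>) u"
    and v: "has_time_deriv_L2 T \<Omega> u v" and b: "b \<in> Cc_inf \<Omega>"
    and t: "0 < t1" "t1 < t2" "t2 < T"
  shows "(LINT x|lebesgue_on \<Omega>. (u (t2, x) - u (t1, x)) * b x)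
    = (LINT z|lebesgue_on (cylinder T \<Omega>). indicator {t1<..t2} (fst z) * v z * b (snd z))"
proof (rule smooth_step_exists)
  fix S S' :: "real \<Rightarrow> real"
  assume Ssm: "smooth_on UNIV S" and S: "\<And>x. (S has_field_derivative S' x) (at x)"
    and S'c: "continuous_on UNIV S'" and S'0: "\<And>x. 0 \<le> S' x"
    and S0: "\<And>x. x \<le> 0 \<Longrightarrow> S x = 0" and S1: "\<And>x. x \<ge> 1 \<Longrightarrow> S x = 1"
    and S'z: "\<And>x. x \<notin> {0..1} \<Longrightarrow> S' x = 0"
  let ?C = "lebesgue_on (cylinder T \<Omega>)"
  have C: "open (cylinder T \<Omega>)" "bounded (cylinder T \<Omega>)"
    using \<Omega> by (auto intro: open_Times bounded_Times)
  interpret finite_measure ?C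
    by (rule finite_measure_lebesgue_on[OF C])
  interpret \<Omega>: finite_measure "lebesgue_on \<Omega>"
    by (rule finite_measure_lebesgue_on[OF \<Omega>])
  note S01 = smooth_step_bounds[OF S S'0 S0 S1]
  define U where "U t = (LINT x|lebesgue_on \<Omega>. u (t, x) * b x)" for t
  have contb: "continuous_on UNIV b"
    by (rule smooth_on_imp_continuous_on[OF Cc_inf_smooth[OF b]])
  have ub: "continuous_on ({0..<T} \<times> closure \<Omega>) (\<lambda>z. u z * b (snd z))"
    by (intro continuous_intros u continuous_on_compose2[OF contb]) auto
  have U: "continuous_on {0..<T} U"
    unfolding U_def using continuous_on_slice_integral[OF ub \<Omega>] by simp
  have cyl_sub: "cylinder T \<Omega> \<subseteq> {0..<T} \<times> closure \<Omega>"
    using closure_subset[of \<Omega>] by auto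
  have fst_m: "(\<lambda>z. f (fst z)) \<in> borel_measurable ?C" if "continuous_on UNIV f" for f :: "real \<Rightarrow> real"
    by (rule continuous_imp_measurable_lebesgue_on_open[OF _ subset_UNIV C(1)])
       (intro continuous_on_compose2[OF that] continuous_intros, simp)
  have scaled: "continuous_on UNIV (\<lambda>t. c * S' (c * (t - \<tau>)))" for c \<tau>
    by (intro continuous_intros continuous_on_compose2[OF S'c]) auto
  have mol_int: "integrable ?C (\<lambda>z. c * S' (c * (fst z - \<tau>)) * (u z * b (snd z)))"
    if c: "c > 0" "0 < \<tau>" "\<tau> + 1 / c < T" for c \<tau>
  proof -
    have "continuous_on {\<tau>..\<tau> + 1 / c} (\<lambda>t. c * S' (c * (t - \<tau>)))"
      by (rule continuous_on_subset[OF scaled subset_UNIV])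
    then obtain K where K0: "0 \<le> K" and K: "\<forall>t\<in>{\<tau>..\<tau> + 1 / c}. \<bar>c * S' (c * (t - \<tau>))\<bar> \<le> K"
      by (rule compact_continuous_abs_bound[OF compact_Icc])
    obtain L where L0: "L > 0" and
      L1: "\<forall>t\<in>{0..\<tau> + 1 / c}. \<forall>x\<in>closure \<Omega>. \<bar>u (t, x) * b (snd (t, x))\<bar> \<le> L"
      by (rule cylinder_bound[OF ub \<Omega>(2) c(3)])
    show ?thesis
    proof (rule integrable_const_bound[of _ "K * L"], rule AE_I2)
      fix z assume "z \<in> space ?C"
      then have z: "fst z \<in> {0<..<T}" "snd z \<in> closure \<Omega>" using cyl_sub by auto
      show "norm (c * S' (c * (fst z - \<tau>)) * (u z * b (snd z))) \<le> K * L"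
      proof (cases "fst z \<in> {\<tau>..\<tau> + 1 / c}")
        case True
        then show ?thesis
          unfolding real_norm_def abs_mult[of "c * S' _"]
          using bspec[OF K True] L1[rule_format, of "fst z" "snd z"] z K0 True by (intro mult_mono) auto
      next
        case False
        then have "c * (fst z - \<tau>) \<notin> {0..1}"
          using c(1) by (auto simp: field_simps zero_le_mult_iff)
        then show ?thesis using S'z K0 L0 by simp
      qed
    next
      show "(\<lambda>z. c * S' (c * (fst z - \<tau>)) * (u z * b (snd z))) \<in> borel_measurable ?C"
        by (intro borel_measurable_times[OF fst_m[OF scaled]]
            continuous_imp_measurable_lebesgue_on_open[OF ub cyl_sub C(1)])
    qed
  qed
  have Fub: "integrable (lebesgue_on {0<..<T}) (\<lambda>t. c * S' (c * (t - \<tau>)) * U t)"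
     "(LINT z|?C. c * S' (c * (fst z - \<tau>)) * (u z * b (snd z)))
        = (LINT t|lebesgue_on {0<..<T}. c * S' (c * (t - \<tau>)) * U t)"
    if c: "c > 0" "0 < \<tau>" "\<tau> + 1 / c < T" for c \<tau>
    using Fubini_lebesgue_on(2,3)[OF open_greaterThanLessThan \<Omega>(1) mol_int[OF c]]
    by (simp_all add: U_def)
  have lim1: "((\<lambda>c. LINT z|?C. c * S' (c * (fst z - \<tau>)) * (u z * b (snd z))) \<longlongrightarrow> U \<tau>) at_top"
    if \<tau>: "0 < \<tau>" "\<tau> < T" for \<tau>
  proof -
    have "((\<lambda>c. LINT t|lebesgue_on {0<..<T}. c * S' (c * (t - \<tau>)) * U t) \<longlongrightarrow> U \<tau>) at_top"
      by (rule smooth_step_mollifier[OF S S'c S'0 S'z _ _ U \<tau> Fub(1)])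
         (use \<tau> S0[of 0] S1[of 1] in auto)
    moreover have "\<forall>\<^sub>F c in at_top. (LINT t|lebesgue_on {0<..<T}. c * S' (c * (t - \<tau>)) * U t)
        = (LINT z|?C. c * S' (c * (fst z - \<tau>)) * (u z * b (snd z)))"
      using eventually_gt_at_top[of 0] eventually_gt_at_top[of "1 / (T - \<tau>)"]
    proof eventually_elim
      case (elim c)
      then have "\<tau> + 1 / c < T" using \<tau> by (simp add: field_simps)
      then show ?case using Fub(2)[OF elim(1) \<tau>(1)] by simp
    qed
    ultimately show ?thesis by (rule Lim_transform_eventually)
  qed
  define A where "A c t = S (c * (t - t1)) - S (c * (t - t2))" for c t
  have vint: "integrable ?C v"
    by (rule time_deriv_integrable[OF v \<Omega>])
  have weak: "(LINT z|?C. c * S' (c * (fst z - t1)) * (u z * b (snd z)))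
      - (LINT z|?C. c * S' (c * (fst z - t2)) * (u z * b (snd z)))
      = - (LINT z|?C. v z * (A c (fst z) * b (snd z)))" if c: "c > 0" "t2 + 1 / c < T" for c
  proof -
    have Asm: "smooth_on UNIV (A c)"
      unfolding smooth_on_def
    proof
      fix k
      have "Ck_on k UNIV S" using Ssm unfolding smooth_on_def by blast
      then have "Ck_on k UNIV (\<lambda>t. S (- c * \<tau> + c * t))" for \<tau>
        by (rule Ck_on_compose_affine) (rule bounded_linear_mult_right)
      from Ck_on_add[OF this[of t1] Ck_on_mult[OF Ck_on_const[of k "-1"] this[of t2]]]
      show "Ck_on k UNIV (A c)" unfolding A_def[abs_def] by (simp add: algebra_simps)
    qed
    have A0: "A c s = 0" if "s \<notin> {t1..t2 + 1 / c}" for s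
    proof (cases "s < t1")
      case True
      then have "c * (s - t1) \<le> 0" "c * (s - t2) \<le> 0" using c t by (auto simp: mult_le_0_iff)
      then show ?thesis using S0 by (simp add: A_def)
    next
      case False
      then have "s - t2 > 1 / c" "s - t1 > 1 / c" using that t by auto
      then have "c * (s - t1) \<ge> 1" "c * (s - t2) \<ge> 1" using c(1) by (auto simp: field_simps)
      then show ?thesis using S1 by (simp add: A_def)
    qed
    have \<eta>: "(\<lambda>z. A c (fst z) * b (snd z)) \<in> Cc_inf (cylinder T \<Omega>)"
      by (rule Cc_inf_product[OF Asm A0 _ b]) (use t c in auto)
    have dA: "(A c has_field_derivative c * S' (c * (s - t1)) - c * S' (c * (s - t2))) (at s)" for s
    proof -
      have "((\<lambda>t. c * (t - \<tau>)) has_field_derivative c) (at s)" for \<tau>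
        by (auto intro!: derivative_eq_intros)
      from DERIV_diff[OF DERIV_chain2[OF S this[of t1]] DERIV_chain2[OF S this[of t2]]]
      show ?thesis unfolding A_def[abs_def] by (simp add: mult.commute)
    qed
    have "(LINT z|?C. u z * frechet_derivative (\<lambda>z. A c (fst z) * b (snd z)) (at z) (1, 0))
        = - (LINT z|?C. v z * (A c (fst z) * b (snd z)))"
      using v \<eta> unfolding has_time_deriv_L2_def by blast
    moreover have "u z * frechet_derivative (\<lambda>z. A c (fst z) * b (snd z)) (at z) (1, 0)
        = c * S' (c * (fst z - t1)) * (u z * b (snd z)) - c * S' (c * (fst z - t2)) * (u z * b (snd z))" for z
      unfolding frechet_derivative_product_time[OF dA Cc_inf_smooth[OF b]] by (simp add: algebra_simps)
    moreover have "t1 + 1 / c < T" "0 < t2" using c t by auto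
    ultimately show ?thesis
      using mol_int[of c t1] mol_int[of c t2] c t by simp
  qed
  have lim2: "((\<lambda>n. LINT z|?C. v z * (A (real n) (fst z) * b (snd z)))
      \<longlonglongrightarrow> (LINT z|?C. indicator {t1<..t2} (fst z) * v z * b (snd z)))"
  proof -
    have "compact (closure \<Omega>)" using \<Omega>(2) by simp
    then obtain K where K: "0 \<le> K" "\<forall>x\<in>closure \<Omega>. \<bar>b x\<bar> \<le> K"
      by (rule compact_continuous_abs_bound[OF _ continuous_on_subset[OF contb subset_UNIV]])
    have bm: "(\<lambda>z. b (snd z)) \<in> borel_measurable ?C"
      by (rule continuous_imp_measurable_lebesgue_on_open[OF _ subset_UNIV C(1)])
         (intro continuous_on_compose2[OF contb] continuous_intros, simp)
    have vm: "v \<in> borel_measurable ?C" using vint by simp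
    have Am: "(\<lambda>z. A (real n) (fst z)) \<in> borel_measurable ?C" for n
    proof (rule fst_m)
      show "continuous_on UNIV (A (real n))"
        unfolding A_def
        by (intro continuous_intros continuous_on_compose2[OF smooth_on_imp_continuous_on[OF Ssm]]) auto
    qed
    have im: "(\<lambda>z. indicator {t1<..t2} (fst z) :: real) \<in> borel_measurable ?C"
    proof -
      have "fst \<in> borel_measurable ?C"
        using fst_m[of "\<lambda>t. t"] by (simp add: continuous_on_id)
      then show ?thesis by measurable
    qed
    show ?thesis
    proof (rule integral_dominated_convergence[where w = "\<lambda>z. K * norm (v z)"])
      show "(\<lambda>z. indicator {t1<..t2} (fst z) * v z * b (snd z)) \<in> borel_measurable ?C"
        by (intro borel_measurable_times im vm bm)
      show "(\<lambda>z. v z * (A (real n) (fst z) * b (snd z))) \<in> borel_measurable ?C" for n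
        by (intro borel_measurable_times Am vm bm)
      show "integrable ?C (\<lambda>z. K * norm (v z))"
        using vint by simp
      show "AE z in ?C. (\<lambda>n. v z * (A (real n) (fst z) * b (snd z)))
          \<longlonglongrightarrow> indicator {t1<..t2} (fst z) * v z * b (snd z)"
      proof (rule AE_I2)
        fix z :: "real \<times> (real^'n)"
        have Sn: "(\<lambda>n. S (real n * s)) \<longlonglongrightarrow> (if s > 0 then 1 else 0)" for s
        proof (cases "s > 0")
          case True
          have "\<forall>\<^sub>F n in sequentially. real n \<ge> 1 / s"
            using real_arch_simple[of "1 / s"] eventually_sequentially
            by (meson order_trans of_nat_mono eventually_at_top_linorder)
          then have "\<forall>\<^sub>F n in sequentially. S (real n * s) = 1"
            by eventually_elim (use True in \<open>simp add: S1 field_simps\<close>)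
          then show ?thesis using True by (simp add: tendsto_eventually)
        next
          case False
          then have "S (real n * s) = 0" for n by (simp add: S0 mult_nonneg_nonpos)
          then show ?thesis using False by simp
        qed
        have "(\<lambda>n. A (real n) (fst z)) \<longlonglongrightarrow> (if fst z - t1 > 0 then 1 else 0) - (if fst z - t2 > 0 then 1 else 0)"
          unfolding A_def by (intro tendsto_diff Sn)
        also have "(if fst z - t1 > 0 then 1 else 0) - (if fst z - t2 > 0 then 1 else 0)
            = (indicator {t1<..t2} (fst z) :: real)"
          using t by (auto simp: indicator_def)
        finally have "(\<lambda>n. v z * (A (real n) (fst z) * b (snd z)))
          \<longlonglongrightarrow> v z * (indicator {t1<..t2} (fst z) * b (snd z))"
          by (intro tendsto_intros)
        then show "(\<lambda>n. v z * (A (real n) (fst z) * b (snd z)))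
          \<longlonglongrightarrow> indicator {t1<..t2} (fst z) * v z * b (snd z)"
          by (simp add: algebra_simps)
      qed
      show "AE z in ?C. norm (v z * (A (real n) (fst z) * b (snd z))) \<le> K * norm (v z)" for n
      proof (rule AE_I2)
        fix z assume "z \<in> space ?C"
        then have z: "snd z \<in> closure \<Omega>" using cyl_sub by auto
        have "\<bar>A (real n) (fst z)\<bar> \<le> 1"
          using S01[of "real n * (fst z - t1)"] S01[of "real n * (fst z - t2)"] unfolding A_def by linarith
        then have "\<bar>A (real n) (fst z)\<bar> * \<bar>b (snd z)\<bar> \<le> 1 * K"
          using bspec[OF K(2) z] by (intro mult_mono) auto
        from mult_left_mono[OF this, of "\<bar>v z\<bar>"]
        show "norm (v z * (A (real n) (fst z) * b (snd z))) \<le> K * norm (v z)"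
          by (simp add: abs_mult mult.commute)
      qed
    qed
  qed
  have nat_top: "filterlim real at_top sequentially" by (rule filterlim_real_sequentially)
  have "(\<lambda>n. (LINT z|?C. real n * S' (real n * (fst z - t1)) * (u z * b (snd z)))
      - (LINT z|?C. real n * S' (real n * (fst z - t2)) * (u z * b (snd z)))) \<longlonglongrightarrow> U t1 - U t2"
    using t by (intro tendsto_diff filterlim_compose[OF lim1 nat_top]) auto
  moreover have "\<forall>\<^sub>F n in sequentially.
      (LINT z|?C. real n * S' (real n * (fst z - t1)) * (u z * b (snd z)))
      - (LINT z|?C. real n * S' (real n * (fst z - t2)) * (u z * b (snd z)))
      = - (LINT z|?C. v z * (A (real n) (fst z) * b (snd z)))"
    using filterlim_at_top_dense[THEN iffD1, OF nat_top, rule_format, of 0]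
      filterlim_at_top_dense[THEN iffD1, OF nat_top, rule_format, of "1 / (T - t2)"]
  proof eventually_elim
    case (elim n)
    then have "t2 + 1 / real n < T" using t by (simp add: field_simps)
    then show ?case by (rule weak[OF elim(1)])
  qed
  ultimately have "(\<lambda>n. - (LINT z|?C. v z * (A (real n) (fst z) * b (snd z)))) \<longlonglongrightarrow> U t1 - U t2"
    by (rule Lim_transform_eventually)
  from LIMSEQ_unique[OF this tendsto_minus[OF lim2]]
  have "U t2 - U t1 = (LINT z|?C. indicator {t1<..t2} (fst z) * v z * b (snd z))" by simp
  moreover have "U t2 - U t1 = (LINT x|lebesgue_on \<Omega>. (u (t2, x) - u (t1, x)) * b x)"
  proof -
    have i: "integrable (lebesgue_on \<Omega>) (\<lambda>x. u (s, x) * b x)" if s: "0 \<le> s" "s < T" for s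
    proof -
      obtain L where "L > 0" and
        L: "\<forall>t\<in>{0..s}. \<forall>x\<in>closure \<Omega>. \<bar>u (t, x) * b (snd (t, x))\<bar> \<le> L"
        by (rule cylinder_bound[OF ub \<Omega>(2) s(2)])
      have "continuous_on (closure \<Omega>) (\<lambda>x. u (s, x) * b x)"
        using continuous_on_slice[OF ub, of s] s by simp
      note m = continuous_imp_measurable_lebesgue_on_open[OF this closure_subset \<Omega>(1)]
      show ?thesis
      proof (rule \<Omega>.integrable_const_bound[OF _ m, of L], rule AE_I2)
        fix x assume "x \<in> space (lebesgue_on \<Omega>)"
        then show "norm (u (s, x) * b x) \<le> L"
          using L[rule_format, of s x] s closure_subset[of \<Omega>] by auto
      qed
    qed
    have "U t2 - U t1 = (LINT x|lebesgue_on \<Omega>. u (t2, x) * b x - u (t1, x) * b x)"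
      unfolding U_def using i t by simp
    then show ?thesis by (simp add: left_diff_distrib)
  qed
  ultimately show ?thesis by simp
qed

text \<open>Convexity of \<open>x powr (k + 1)\<close>: the mean value theorem gives a slope between
  \<open>a\<close> and \<open>b\<close>, and monotonicity of \<open>x powr k\<close> compares it
  with the slope at \<open>a\<close>. A zero argument is treated separately, because the derivative
  rule asks for a positive base.\<close>

lemma powr_tangent:
  fixes a b k :: real
  assumes "0 \<le> a" "0 \<le> b" "0 < k"
  shows "(k + 1) * (a powr k * (b - a)) \<le> b powr (k + 1) - a powr (k + 1)"
proof -
  have der: "((\<lambda>x. x powr (k + 1)) has_real_derivative (k + 1) * x powr k) (at x)" if "0 < x" for x
    using has_real_derivative_powr[OF that, of "k + 1"] by simp
  have pos: "0 \<le> k + 1" using assms(3) by simp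
  consider "a = 0" | "b = 0" | "a = b" | "0 < a" "a < b" | "0 < b" "b < a"
    using assms by linarith
  then show ?thesis
  proof cases
    case 1
    then show ?thesis by simp
  next
    case 2
    have "a powr (k + 1) = a powr k * a"
      using assms(1) by (cases "a = 0") (auto simp: powr_add)
    moreover have "0 \<le> k * (a powr k * a)"
      using assms by (intro mult_nonneg_nonneg) auto
    ultimately show ?thesis using 2 by (simp add: algebra_simps)
  next
    case 3
    then show ?thesis by simp
  next
    case 4
    have "\<And>x. a \<le> x \<Longrightarrow> x \<le> b \<Longrightarrow> ((\<lambda>x. x powr (k + 1)) has_real_derivative (k + 1) * x powr k) (at x)"
      using der 4(1) by simp
    from MVT2[OF 4(2) this] obtain \<xi> where \<xi>: "a < \<xi>" "\<xi> < b"
      "b powr (k + 1) - a powr (k + 1) = (b - a) * ((k + 1) * \<xi> powr k)" by blast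
    have "a powr k \<le> \<xi> powr k" using \<xi> 4 assms by (intro powr_mono2) auto
    then have "(k + 1) * (a powr k * (b - a)) \<le> (k + 1) * (\<xi> powr k * (b - a))"
      using pos 4 by (intro mult_left_mono mult_right_mono) auto
    then show ?thesis unfolding \<xi>(3) by (simp add: algebra_simps)
  next
    case 5
    have "\<And>x. b \<le> x \<Longrightarrow> x \<le> a \<Longrightarrow> ((\<lambda>x. x powr (k + 1)) has_real_derivative (k + 1) * x powr k) (at x)"
      using der 5(1) by simp
    from MVT2[OF 5(2) this] obtain \<xi> where \<xi>: "b < \<xi>" "\<xi> < a"
      "a powr (k + 1) - b powr (k + 1) = (a - b) * ((k + 1) * \<xi> powr k)" by blast
    have "\<xi> powr k \<le> a powr k" using \<xi> 5 assms by (intro powr_mono2) auto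
    then have "(k + 1) * (\<xi> powr k * (a - b)) \<le> (k + 1) * (a powr k * (a - b))"
      using pos 5 by (intro mult_left_mono mult_right_mono) auto
    moreover have "b powr (k + 1) - a powr (k + 1) = - ((k + 1) * (\<xi> powr k * (a - b)))"
      using \<xi>(3) by (simp add: algebra_simps)
    moreover have "(k + 1) * (a powr k * (b - a)) = - ((k + 1) * (a powr k * (a - b)))"
      by (simp add: algebra_simps)
    ultimately show ?thesis by linarith
  qed
qed

section \<open>The energy \<open>Y\<close> along a function of the solution class; the equation
  enters later\<close>

locale evolution =
  fixes mul :: "real^'n \<Rightarrow> real^'n \<Rightarrow> real^'n" and w :: "'n \<Rightarrow> nat" and \<Omega> :: "(real^'n) set"
    and m T :: real and u :: "real \<times> (real^'n) \<Rightarrow> real" and g :: "real \<times> (real^'n) \<Rightarrow> real^'n"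
    and v :: "real \<times> (real^'n) \<Rightarrow> real"
  assumes G: "stratified_group mul w" and \<Omega>: "open \<Omega>" "bounded \<Omega>" and m: "1 < m" and T: "0 < T"
    and contu: "continuous_on ({0..<T} \<times> closure \<Omega>) u"
    and u_nonneg: "\<forall>z\<in>{0..<T} \<times> closure \<Omega>. 0 \<le> u z"
    and hg: "has_hgrad_LS0 mul w m T \<Omega> u g" and td: "has_time_deriv_L2 T \<Omega> u v"
begin

abbreviation "\<C> \<equiv> lebesgue_on (cylinder T \<Omega>)"
abbreviation "\<M> \<equiv> lebesgue_on \<Omega>"

lemma open_cylinder: "open (cylinder T \<Omega>)" and bounded_cylinder: "bounded (cylinder T \<Omega>)"
  using \<Omega> by (auto intro: open_Times bounded_Times)

sublocale C: finite_measure \<C>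
  by (rule finite_measure_lebesgue_on[OF open_cylinder bounded_cylinder])

sublocale M: finite_measure \<M>
  by (rule finite_measure_lebesgue_on[OF \<Omega>])

lemma cyl_sub: "cylinder T \<Omega> \<subseteq> {0..<T} \<times> closure \<Omega>"
  using closure_subset[of \<Omega>] by auto

lemma space_C:
  assumes "z \<in> space \<C>"
  shows "0 < fst z" "fst z < T" "snd z \<in> \<Omega>" "snd z \<in> closure \<Omega>" "z \<in> {0..<T} \<times> closure \<Omega>" "0 \<le> u z"
proof -
  have z: "z \<in> cylinder T \<Omega>" using assms by simp
  then show "0 < fst z" "fst z < T" "snd z \<in> \<Omega>" by auto
  show zz: "z \<in> {0..<T} \<times> closure \<Omega>" using z cyl_sub by (rule subsetD[rotated])
  then show "snd z \<in> closure \<Omega>" by auto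
  show "0 \<le> u z" by (rule bspec[OF u_nonneg zz])
qed

lemma contu_powr: "0 < \<kappa> \<Longrightarrow> continuous_on ({0..<T} \<times> closure \<Omega>) (\<lambda>z. u z powr \<kappa>)"
  using u_nonneg by (intro continuous_on_powr' contu continuous_on_const) auto

lemma cont_measurable_C:
  fixes f :: "real \<times> (real^'n) \<Rightarrow> 'b::euclidean_space"
  assumes "continuous_on ({0..<T} \<times> closure \<Omega>) f"
  shows "f \<in> borel_measurable \<C>"
  by (rule continuous_imp_measurable_lebesgue_on_open[OF assms cyl_sub open_cylinder])

lemma cont_slice_measurable:
  fixes f :: "real \<times> (real^'n) \<Rightarrow> real"
  assumes "continuous_on ({0..<T} \<times> closure \<Omega>) f" "0 \<le> t" "t < T"
  shows "(\<lambda>x. f (t, x)) \<in> borel_measurable \<M>"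
  by (rule continuous_imp_measurable_lebesgue_on_open[OF continuous_on_slice[OF assms(1)] closure_subset \<Omega>(1)])
     (use assms in simp)

lemma indicator_measurable_C: "(\<lambda>z. indicator {a<..b} (fst z) :: real) \<in> borel_measurable \<C>"
proof -
  have [measurable]: "fst \<in> borel_measurable \<C>"
    by (rule cont_measurable_C) (rule continuous_on_fst[OF continuous_on_id])
  show ?thesis by measurable
qed

lemma v_integrable: "integrable \<C> v"
  by (rule time_deriv_integrable[OF td \<Omega>])

lemma v_measurable: "v \<in> borel_measurable \<C>"
  by (rule borel_measurable_integrable[OF v_integrable])

lemma g_measurable: "g \<in> borel_measurable \<C>"
  using hg by (simp add: has_hgrad_LS0_def)

lemma u_bound:
  assumes "T' < T"
  obtains L where "0 < L" "\<forall>t\<in>{0..T'}. \<forall>x\<in>closure \<Omega>. u (t, x) \<in> {0..L}"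
proof -
  obtain L where L: "L > 0" "\<forall>t\<in>{0..T'}. \<forall>x\<in>closure \<Omega>. \<bar>u (t, x)\<bar> \<le> L"
    by (rule cylinder_bound[OF contu \<Omega>(2) assms])
  have "\<forall>t\<in>{0..T'}. \<forall>x\<in>closure \<Omega>. u (t, x) \<in> {0..L}"
  proof (intro ballI)
    fix t x assume t: "t \<in> {0..T'}" and x: "x \<in> closure \<Omega>"
    have "0 \<le> u (t, x)" using bspec[OF u_nonneg, of "(t, x)"] t x assms by simp
    then show "u (t, x) \<in> {0..L}" using L(2)[rule_format, OF t x] by simp
  qed
  then show ?thesis by (rule that[OF L(1)])
qed

text \<open>Regularity in space is available only for almost every time, so it is carried as a
  predicate on \<open>t\<close>. Integrability of the gradient power is recorded separately, since
  \<open>has_hgrad_S0\<close> speaks only of differences from test functions.\<close>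

definition good :: "real \<Rightarrow> bool" where
  "good t \<longleftrightarrow> has_hgrad_S0 mul w m \<Omega> (\<lambda>x. u (t, x)) (\<lambda>x. g (t, x)) \<and>
     integrable \<M> (\<lambda>x. norm (g (t, x)) powr m)"

lemma g_integrable: "integrable \<C> (\<lambda>z. norm (g z) powr m)"
proof (rule Bochner_Integration.integrable_bound)
  show "integrable \<C> (\<lambda>z. norm (g z) powr m + \<bar>u z\<bar> powr m)"
    using hg by (simp add: has_hgrad_LS0_def)
  show "(\<lambda>z. norm (g z) powr m) \<in> borel_measurable \<C>"
    using g_measurable by measurable
qed simp

lemma AE_good: "AE t in lebesgue_on {0<..<T}. good t"
proof -
  have "AE t in lebesgue_on {0<..<T}. has_hgrad_S0 mul w m \<Omega> (\<lambda>x. u (t, x)) (\<lambda>x. g (t, x))"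
    using hg by (simp add: has_hgrad_LS0_def)
  moreover have "AE t in lebesgue_on {0<..<T}. integrable \<M> (\<lambda>x. norm (g (t, x)) powr m)"
    using Fubini_lebesgue_on(1)[OF open_greaterThanLessThan \<Omega>(1) g_integrable] .
  ultimately show ?thesis by eventually_elim (simp add: good_def)
qed

lemma good_dense:
  assumes "0 \<le> a" "a < b" "b \<le> T"
  shows "\<exists>t. a < t \<and> t < b \<and> good t"
proof (rule ccontr)
  assume no: "\<not> (\<exists>t. a < t \<and> t < b \<and> good t)"
  have "AE t in lebesgue. t \<in> {0<..<T} \<longrightarrow> good t"
    using AE_good by (simp add: AE_restrict_space_iff)
  then have "AE t in lebesgue. t \<notin> {a<..<b}"
  proof eventually_elim
    case (elim t)
    show ?case
    proof
      assume "t \<in> {a<..<b}"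
      then have "a < t" "t < b" "t \<in> {0<..<T}" using assms by auto
      then show False using no elim by simp
    qed
  qed
  moreover have "(AE t in lebesgue. t \<notin> {a<..<b}) \<longleftrightarrow> emeasure lebesgue {a<..<b} = 0"
    by (rule AE_iff_measurable) auto
  ultimately have "emeasure lebesgue {a<..<b} = 0" by blast
  then show False using assms by simp
qed

text \<open>The weight \<open>u (t1, x) powr k\<close> depends on \<open>x\<close> only and,
  \<open>t1\<close> being good, is an almost everywhere limit of test functions with a common bound
  \<open>K\<close>. Both sides of the identity for these test functions pass to the limit by
  dominated convergence.\<close>

lemma integral_time_increment_powr:
  assumes k: "1 < k" and t: "0 < t1" "t1 < t2" "t2 < T" and good: "good t1"
  shows "(LINT x|\<M>. (u (t2, x) - u (t1, x)) * u (t1, x) powr k)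
    = (LINT z|\<C>. indicator {t1<..t2} (fst z) * v z * u (t1, snd z) powr k)"
proof -
  obtain L where L: "0 < L" "\<forall>t\<in>{0..t2}. \<forall>x\<in>closure \<Omega>. u (t, x) \<in> {0..L}"
    by (rule u_bound[OF t(3)])
  have uL: "u (s, x) \<in> {0..L}" if "s \<in> {0..t2}" "x \<in> \<Omega>" for s x
    using L(2)[rule_format, of s x] that closure_subset[of \<Omega>] by auto
  have uL1: "\<And>x. x \<in> \<Omega> \<Longrightarrow> u (t1, x) \<in> {0..L}"
    using uL[of t1] t by simp
  have g1: "has_hgrad_S0 mul w m \<Omega> (\<lambda>x. u (t1, x)) (\<lambda>x. g (t1, x))"
    "integrable \<M> (\<lambda>x. norm (g (t1, x)) powr m)"
    using good by (simp_all add: good_def)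
  have m0: "0 < m" using m by simp
  let ?f = "\<lambda>y. y powr k" and ?f' = "\<lambda>y. k * y powr (k - 1)"
  show ?thesis
  proof (rule S0_chain[where f = ?f and f' = ?f', OF G \<Omega> g1(1) m0 order_refl g1(2) L(1) uL1])
    show "0 powr k = 0" by simp
    show "(?f has_real_derivative ?f' y) (at y within {0..L})" if "y \<in> {0..L}" for y
      by (rule has_real_derivative_powr_Icc[OF k that])
    show "continuous_on {0..L} ?f'"
      by (rule continuous_on_powr_Icc) (use k in simp)
  next
    fix \<psi> and K :: real
    assume \<psi>: "\<And>n. \<psi> n \<in> Cc_inf \<Omega>" and K: "\<And>n x. \<bar>\<psi> n x\<bar> \<le> K"
      and lim: "AE x in \<M>. (\<lambda>n. \<psi> n x) \<longlonglongrightarrow> u (t1, x) powr k"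
      and fm: "(\<lambda>x. u (t1, x) powr k) \<in> borel_measurable \<M>"
    have K0: "0 \<le> K" using K[of 0 0] by simp
    have cont\<psi>: "continuous_on UNIV (\<psi> n)" for n
      by (rule smooth_on_imp_continuous_on[OF Cc_inf_smooth[OF \<psi>]])
    have \<psi>m: "\<psi> n \<in> borel_measurable \<M>" for n
      by (rule continuous_imp_measurable_lebesgue_on_open[OF cont\<psi> subset_UNIV \<Omega>(1)])
    have dm: "(\<lambda>x. u (t2, x) - u (t1, x)) \<in> borel_measurable \<M>"
      by (intro borel_measurable_diff cont_slice_measurable[OF contu]) (use t in auto)
    have lim1: "(\<lambda>n. LINT x|\<M>. (u (t2, x) - u (t1, x)) * \<psi> n x)
        \<longlonglongrightarrow> (LINT x|\<M>. (u (t2, x) - u (t1, x)) * u (t1, x) powr k)"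
    proof (rule integral_dominated_convergence[where w = "\<lambda>_. L * K"])
      show "(\<lambda>x. (u (t2, x) - u (t1, x)) * u (t1, x) powr k) \<in> borel_measurable \<M>"
        by (rule borel_measurable_times[OF dm fm])
      show "(\<lambda>x. (u (t2, x) - u (t1, x)) * \<psi> n x) \<in> borel_measurable \<M>" for n
        by (rule borel_measurable_times[OF dm \<psi>m])
      show "integrable \<M> (\<lambda>_. L * K)" by simp
      show "AE x in \<M>. (\<lambda>n. (u (t2, x) - u (t1, x)) * \<psi> n x) \<longlonglongrightarrow> (u (t2, x) - u (t1, x)) * u (t1, x) powr k"
        using lim by eventually_elim (rule tendsto_mult_left)
      show "AE x in \<M>. norm ((u (t2, x) - u (t1, x)) * \<psi> n x) \<le> L * K" for n
      proof (rule AE_I2)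
        fix x assume "x \<in> space \<M>"
        then have "u (t2, x) \<in> {0..L}" "u (t1, x) \<in> {0..L}" using uL[of t2 x] uL[of t1 x] t by auto
        then have "\<bar>u (t2, x) - u (t1, x)\<bar> \<le> L" by auto
        then show "norm ((u (t2, x) - u (t1, x)) * \<psi> n x) \<le> L * K"
          unfolding real_norm_def abs_mult using K[of n x] L(1) by (intro mult_mono) auto
      qed
    qed
    have \<psi>m2: "(\<lambda>z. \<psi> n (snd z)) \<in> borel_measurable \<C>" for n
      by (rule cont_measurable_C, rule continuous_on_compose2[OF cont\<psi> continuous_on_snd[OF continuous_on_id]]) simp
    have fm2: "(\<lambda>z. u (t1, snd z) powr k) \<in> borel_measurable \<C>"
    proof (rule cont_measurable_C)
      have k0: "0 < k" using k by simp
      show "continuous_on ({0..<T} \<times> closure \<Omega>) (\<lambda>z. u (t1, snd z) powr k)"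
        by (rule continuous_on_compose2[OF contu_powr[OF k0]
              continuous_on_Pair[OF continuous_on_const continuous_on_snd[OF continuous_on_id]]])
           (use t in auto)
    qed
    have lim2: "(\<lambda>n. LINT z|\<C>. indicator {t1<..t2} (fst z) * v z * \<psi> n (snd z))
        \<longlonglongrightarrow> (LINT z|\<C>. indicator {t1<..t2} (fst z) * v z * u (t1, snd z) powr k)"
    proof (rule integral_dominated_convergence[where w = "\<lambda>z. K * norm (v z)"])
      show "(\<lambda>z. indicator {t1<..t2} (fst z) * v z * u (t1, snd z) powr k) \<in> borel_measurable \<C>"
        by (intro borel_measurable_times indicator_measurable_C v_measurable fm2)
      show "(\<lambda>z. indicator {t1<..t2} (fst z) * v z * \<psi> n (snd z)) \<in> borel_measurable \<C>" for n
        by (intro borel_measurable_times indicator_measurable_C v_measurable \<psi>m2)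
      show "integrable \<C> (\<lambda>z. K * norm (v z))"
        using v_integrable by simp
      have "AE z in \<C>. (\<lambda>n. \<psi> n (snd z)) \<longlonglongrightarrow> u (t1, snd z) powr k"
        using AE_lebesgue_on_Times[OF open_greaterThanLessThan \<Omega>(1) lim] .
      then show "AE z in \<C>. (\<lambda>n. indicator {t1<..t2} (fst z) * v z * \<psi> n (snd z))
          \<longlonglongrightarrow> indicator {t1<..t2} (fst z) * v z * u (t1, snd z) powr k"
        by eventually_elim (rule tendsto_mult_left)
      show "AE z in \<C>. norm (indicator {t1<..t2} (fst z) * v z * \<psi> n (snd z)) \<le> K * norm (v z)" for n
      proof (rule AE_I2)
        fix z
        have "\<bar>indicator {t1<..t2} (fst z) * v z\<bar> \<le> \<bar>v z\<bar>" by (simp add: indicator_def)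
        then have "\<bar>indicator {t1<..t2} (fst z) * v z\<bar> * \<bar>\<psi> n (snd z)\<bar> \<le> \<bar>v z\<bar> * K"
          using K[of n "snd z"] by (intro mult_mono) auto
        then show "norm (indicator {t1<..t2} (fst z) * v z * \<psi> n (snd z)) \<le> K * norm (v z)"
          unfolding real_norm_def abs_mult[of "_ * v z"] by (simp add: mult.commute)
      qed
    qed
    have "(LINT x|\<M>. (u (t2, x) - u (t1, x)) * \<psi> n x)
        = (LINT z|\<C>. indicator {t1<..t2} (fst z) * v z * \<psi> n (snd z))" for n
      by (rule integral_time_increment[OF \<Omega> contu td \<psi> t])
    then show ?thesis
      using LIMSEQ_unique[OF lim1] lim2 by simp
  qed
qed

definition Y :: "real \<Rightarrow> real \<Rightarrow> real" where
  "Y s t = (LINT x|\<M>. u (t, x) powr s)"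

lemma powr_slice_integrable:
  assumes "0 < s" "0 \<le> t" "t < T"
  shows "integrable \<M> (\<lambda>x. u (t, x) powr s)"
proof -
  obtain L where L: "0 < L" "\<forall>t'\<in>{0..t}. \<forall>x\<in>closure \<Omega>. u (t', x) \<in> {0..L}"
    by (rule u_bound[OF assms(3)])
  show ?thesis
  proof (rule M.integrable_const_bound[of _ "L powr s"], rule AE_I2)
    fix x assume "x \<in> space \<M>"
    then have "u (t, x) \<in> {0..L}"
      using L(2)[rule_format, of t x] assms(2) closure_subset[of \<Omega>] by auto
    then show "norm (u (t, x) powr s) \<le> L powr s"
      using powr_mono2[of s "u (t, x)" L] assms(1) by simp
  qed (rule cont_slice_measurable[OF contu_powr[OF assms(1)] assms(2,3)])
qed

lemma continuous_on_Y: "0 < s \<Longrightarrow> continuous_on {0..<T} (Y s)"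
  unfolding Y_def by (rule continuous_on_slice_integral[OF contu_powr \<Omega>])

lemma Y_nonneg: "0 \<le> Y s t"
  unfolding Y_def by (rule Bochner_Integration.integral_nonneg) simp

text \<open>The tangent inequality with \<open>a = u (t1, x)\<close> and
  \<open>b = u (t2, x)\<close> is integrated over \<open>\<Omega>\<close>, and the increment in it
  is expressed through \<open>v\<close>. Taking the earlier time as base point is what gives a lower
  bound for the growth of \<open>Y\<close>.\<close>

lemma Y_increment_good:
  assumes k: "1 < k" and t: "0 < t1" "t1 < t2" "t2 < T" and good: "good t1"
  shows "(k + 1) * (LINT z|\<C>. indicator {t1<..t2} (fst z) * v z * u (t1, snd z) powr k)
    \<le> Y (k + 1) t2 - Y (k + 1) t1"
proof -
  have k0: "0 < k" and k1: "0 < k + 1" using k by auto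
  have i1: "integrable \<M> (\<lambda>x. u (t1, x) powr (k + 1))" and i2: "integrable \<M> (\<lambda>x. u (t2, x) powr (k + 1))"
    by (rule powr_slice_integrable[OF k1]; use t in simp)+
  obtain L where L: "0 < L" "\<forall>t\<in>{0..t2}. \<forall>x\<in>closure \<Omega>. u (t, x) \<in> {0..L}"
    by (rule u_bound[OF t(3)])
  have uL: "u (s, x) \<in> {0..L}" if "s \<in> {0..t2}" "x \<in> \<Omega>" for s x
    using L(2)[rule_format, of s x] that closure_subset[of \<Omega>] by auto
  have i3: "integrable \<M> (\<lambda>x. (u (t2, x) - u (t1, x)) * u (t1, x) powr k)"
  proof (rule M.integrable_const_bound[of _ "L * L powr k"], rule AE_I2)
    fix x assume "x \<in> space \<M>"
    then have *: "u (t2, x) \<in> {0..L}" "u (t1, x) \<in> {0..L}" using uL[of t2 x] uL[of t1 x] t by auto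
    then have "\<bar>u (t2, x) - u (t1, x)\<bar> \<le> L" by auto
    moreover have "u (t1, x) powr k \<le> L powr k" using * k0 by (intro powr_mono2) auto
    ultimately show "norm ((u (t2, x) - u (t1, x)) * u (t1, x) powr k) \<le> L * L powr k"
      unfolding real_norm_def abs_mult using L(1) by (intro mult_mono) auto
  next
    show "(\<lambda>x. (u (t2, x) - u (t1, x)) * u (t1, x) powr k) \<in> borel_measurable \<M>"
      by (intro borel_measurable_times borel_measurable_diff cont_slice_measurable[OF contu]
          cont_slice_measurable[OF contu_powr[OF k0]]) (use t in auto)
  qed
  have "(k + 1) * (LINT x|\<M>. (u (t2, x) - u (t1, x)) * u (t1, x) powr k)
      = (LINT x|\<M>. (k + 1) * ((u (t2, x) - u (t1, x)) * u (t1, x) powr k))"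
    by simp
  also have "\<dots> \<le> (LINT x|\<M>. u (t2, x) powr (k + 1) - u (t1, x) powr (k + 1))"
  proof (rule Bochner_Integration.integral_mono)
    show "integrable \<M> (\<lambda>x. (k + 1) * ((u (t2, x) - u (t1, x)) * u (t1, x) powr k))"
      by (rule integrable_mult_right[OF i3])
    show "integrable \<M> (\<lambda>x. u (t2, x) powr (k + 1) - u (t1, x) powr (k + 1))"
      by (rule Bochner_Integration.integrable_diff[OF i2 i1])
    fix x assume "x \<in> space \<M>"
    then have "0 \<le> u (t2, x)" "0 \<le> u (t1, x)" using uL[of t2 x] uL[of t1 x] t by auto
    from powr_tangent[OF this(2,1) k0]
    show "(k + 1) * ((u (t2, x) - u (t1, x)) * u (t1, x) powr k) \<le> u (t2, x) powr (k + 1) - u (t1, x) powr (k + 1)"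
      by (simp only: mult.commute[of "u (t1, x) powr k"])
  qed
  also have "\<dots> = Y (k + 1) t2 - Y (k + 1) t1"
    unfolding Y_def by (rule Bochner_Integration.integral_diff[OF i2 i1])
  finally show ?thesis
    unfolding integral_time_increment_powr[OF k t good] .
qed

text \<open>The times at which \<open>u\<close> is not known to lie in the Sobolev space are bridged by continuity; the
  error \<open>\<epsilon>\<close> comes from freezing \<open>u\<^sup>k\<close> at the left end of short time intervals.\<close>

lemma Y_increment_eps:
  assumes k: "1 < k" and t: "0 < t1" "t1 < t2" "t2 < T" and \<epsilon>: "0 < \<epsilon>"
  shows "(k + 1) * (LINT z|\<C>. indicator {t1<..t2} (fst z) * (v z * u z powr k - \<epsilon> * \<bar>v z\<bar>))
    \<le> Y (k + 1) t2 - Y (k + 1) t1"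
proof -
  have k0: "0 < k" and k1: "0 < k + 1" using k by auto
  obtain L where L: "0 < L" "\<forall>t\<in>{0..t2}. \<forall>x\<in>closure \<Omega>. u (t, x) \<in> {0..L}"
    by (rule u_bound[OF t(3)])
  define h where "h z = v z * u z powr k - \<epsilon> * \<bar>v z\<bar>" for z
  \<comment> \<open>The left side as a primitive in time: its increments over subintervals add up,
    and it is continuous from the right, which the passage from good times to all times
    uses.\<close>
  define H where "H t = (LINT z|\<C>. indicator {0<..t} (fst z) * h z)" for t
  have hm: "h \<in> borel_measurable \<C>"
    unfolding h_def[abs_def]
    by (intro borel_measurable_diff borel_measurable_times v_measurable borel_measurable_const
        borel_measurable_abs cont_measurable_C[OF contu_powr[OF k0]])
  have hb: "\<bar>h z\<bar> \<le> (L powr k + \<epsilon>) * \<bar>v z\<bar>" if "z \<in> space \<C>" "fst z \<le> t2" for z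
  proof -
    have "u z \<in> {0..L}"
      using L(2)[rule_format, of "fst z" "snd z"] space_C[OF that(1)] that(2) by simp
    then have "u z powr k \<le> L powr k" using k0 by (intro powr_mono2) auto
    then have "\<bar>v z\<bar> * u z powr k \<le> \<bar>v z\<bar> * L powr k" by (intro mult_left_mono) auto
    moreover have "\<bar>h z\<bar> \<le> \<bar>v z\<bar> * u z powr k + \<epsilon> * \<bar>v z\<bar>"
      unfolding h_def using abs_triangle_ineq4[of "v z * u z powr k" "\<epsilon> * \<bar>v z\<bar>"] \<epsilon>
      by (simp add: abs_mult)
    ultimately show ?thesis by (simp add: algebra_simps)
  qed
  have dom: "integrable \<C> (\<lambda>z. (L powr k + \<epsilon>) * \<bar>v z\<bar>)"
    using v_integrable by simp
  have ind_bound: "\<bar>indicator {a<..b} (fst z) * h z\<bar> \<le> (L powr k + \<epsilon>) * \<bar>v z\<bar>"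
    if "z \<in> space \<C>" "b \<le> t2" for a b z
  proof (cases "fst z \<in> {a<..b}")
    case True
    then show ?thesis using hb[OF that(1)] that(2) by simp
  next
    case False
    have "0 \<le> (L powr k + \<epsilon>) * \<bar>v z\<bar>" using \<epsilon> by (intro mult_nonneg_nonneg add_nonneg_nonneg) auto
    then show ?thesis using False by simp
  qed
  have ind_m: "(\<lambda>z. indicator {a<..b} (fst z) * h z) \<in> borel_measurable \<C>" for a b
    by (rule borel_measurable_times[OF indicator_measurable_C hm])
  have ind_int: "integrable \<C> (\<lambda>z. indicator {a<..b} (fst z) * h z)" if "b \<le> t2" for a b
  proof (rule Bochner_Integration.integrable_bound[OF dom ind_m], rule AE_I2)
    fix z assume "z \<in> space \<C>"
    from ind_bound[OF this that, of a]
    show "norm (indicator {a<..b} (fst z) * h z) \<le> norm ((L powr k + \<epsilon>) * \<bar>v z\<bar>)"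
      unfolding real_norm_def by linarith
  qed
  have H_diff: "H b - H a = (LINT z|\<C>. indicator {a<..b} (fst z) * h z)" if "0 < a" "a \<le> b" "b \<le> t2" for a b
  proof -
    have "indicator {0<..b} s - indicator {0<..a} s = (indicator {a<..b} s :: real)" for s :: real
      using that by (auto simp: indicator_def)
    then have e: "indicator {0<..b} (fst z) * h z - indicator {0<..a} (fst z) * h z = indicator {a<..b} (fst z) * h z" for z
      by (simp only: left_diff_distrib[symmetric])
    have "a \<le> t2" using that by simp
    from Bochner_Integration.integral_diff[OF ind_int[OF that(3), of 0] ind_int[OF this, of 0]]
    show ?thesis unfolding H_def e by simp
  qed
  \<comment> \<open>This supplies a step length \<open>\<delta>\<close> below which replacing
    \<open>u z powr k\<close> by its value at the left end of the interval costs at most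
    \<open>\<epsilon>\<close>.\<close>
  have "uniformly_continuous_on ({0..t2} \<times> closure \<Omega>) (\<lambda>z. u z powr k)"
  proof (rule compact_uniformly_continuous)
    show "continuous_on ({0..t2} \<times> closure \<Omega>) (\<lambda>z. u z powr k)"
      using t by (intro continuous_on_subset[OF contu_powr[OF k0]]) auto
    show "compact ({0..t2} \<times> closure \<Omega>)" using \<Omega>(2) by (intro compact_Times) auto
  qed
  then have "\<exists>\<delta>>0. \<forall>z\<in>{0..t2} \<times> closure \<Omega>. \<forall>z'\<in>{0..t2} \<times> closure \<Omega>. dist z' z < \<delta> \<longrightarrow> dist (u z' powr k) (u z powr k) < \<epsilon>"
    using \<epsilon> unfolding uniformly_continuous_on_def by simp
  then obtain \<delta> where \<delta>: "\<delta> > 0" and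
    uc: "\<forall>z\<in>{0..t2} \<times> closure \<Omega>. \<forall>z'\<in>{0..t2} \<times> closure \<Omega>. dist z' z < \<delta> \<longrightarrow> dist (u z' powr k) (u z powr k) < \<epsilon>"
    by (elim exE conjE)
  have loc_good: "(k + 1) * (H b - H a) \<le> Y (k + 1) b - Y (k + 1) a"
    if a: "0 < a" "a < b" "b \<le> t2" "b - a < \<delta>" "good a" for a b
  proof -
    have bT: "b < T" using a t by simp
    have "H b - H a \<le> (LINT z|\<C>. indicator {a<..b} (fst z) * v z * u (a, snd z) powr k)"
      unfolding H_diff[OF a(1) less_imp_le[OF a(2)] a(3)]
    proof (rule Bochner_Integration.integral_mono)
      show "integrable \<C> (\<lambda>z. indicator {a<..b} (fst z) * h z)"
        by (rule ind_int[OF a(3)])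
      show "integrable \<C> (\<lambda>z. indicator {a<..b} (fst z) * v z * u (a, snd z) powr k)"
      proof (rule Bochner_Integration.integrable_bound[OF dom], rule borel_measurable_times[OF borel_measurable_times[OF indicator_measurable_C v_measurable]])
        show "(\<lambda>z. u (a, snd z) powr k) \<in> borel_measurable \<C>"
        proof (rule cont_measurable_C)
          show "continuous_on ({0..<T} \<times> closure \<Omega>) (\<lambda>z. u (a, snd z) powr k)"
            by (rule continuous_on_compose2[OF contu_powr[OF k0]
                  continuous_on_Pair[OF continuous_on_const continuous_on_snd[OF continuous_on_id]]])
               (use a t in auto)
        qed
        show "AE z in \<C>. norm (indicator {a<..b} (fst z) * v z * u (a, snd z) powr k) \<le> norm ((L powr k + \<epsilon>) * \<bar>v z\<bar>)"
        proof (rule AE_I2)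
          fix z assume z: "z \<in> space \<C>"
          have "u (a, snd z) \<in> {0..L}"
            using L(2)[rule_format, of a "snd z"] space_C(4)[OF z] a by simp
          then have *: "u (a, snd z) powr k \<le> L powr k + \<epsilon>"
            using powr_mono2[of k "u (a, snd z)" L] k0 \<epsilon> by simp
          have "\<bar>indicator {a<..b} (fst z) * v z\<bar> \<le> \<bar>v z\<bar>" by (simp add: indicator_def)
          then have "\<bar>indicator {a<..b} (fst z) * v z\<bar> * u (a, snd z) powr k \<le> \<bar>v z\<bar> * (L powr k + \<epsilon>)"
            using * by (intro mult_mono) auto
          moreover have "norm (indicator {a<..b} (fst z) * v z * u (a, snd z) powr k)
              = \<bar>indicator {a<..b} (fst z) * v z\<bar> * u (a, snd z) powr k"
            unfolding real_norm_def abs_mult[of "_ * v z"] by simp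
          moreover have "norm ((L powr k + \<epsilon>) * \<bar>v z\<bar>) \<ge> \<bar>v z\<bar> * (L powr k + \<epsilon>)"
            unfolding real_norm_def by (simp only: mult.commute[of "\<bar>v z\<bar>"] abs_ge_self)
          ultimately show "norm (indicator {a<..b} (fst z) * v z * u (a, snd z) powr k) \<le> norm ((L powr k + \<epsilon>) * \<bar>v z\<bar>)"
            by linarith
        qed
      qed
      fix z assume z: "z \<in> space \<C>"
      show "indicator {a<..b} (fst z) * h z \<le> indicator {a<..b} (fst z) * v z * u (a, snd z) powr k"
      proof (cases "fst z \<in> {a<..b}")
        case True
        note zz = space_C[OF z]
        have in1: "z \<in> {0..t2} \<times> closure \<Omega>" and in2: "(a, snd z) \<in> {0..t2} \<times> closure \<Omega>"
          using True zz(1,4) a by (auto simp: mem_Times_iff)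
        have "dist (a, snd z) z = dist a (fst z)"
          by (simp add: dist_prod_def)
        also have "\<dots> < \<delta>" using True a by (simp add: dist_real_def)
        finally have "dist (u (a, snd z) powr k) (u z powr k) < \<epsilon>"
          by (rule uc[rule_format, OF in1 in2])
        then have "\<bar>u z powr k - u (a, snd z) powr k\<bar> \<le> \<epsilon>"
          unfolding dist_real_def by linarith
        then have "\<bar>v z\<bar> * \<bar>u z powr k - u (a, snd z) powr k\<bar> \<le> \<bar>v z\<bar> * \<epsilon>"
          by (intro mult_left_mono) auto
        then have "v z * (u z powr k - u (a, snd z) powr k) \<le> \<bar>v z\<bar> * \<epsilon>"
          unfolding abs_mult[symmetric] by linarith
        then have "h z \<le> v z * u (a, snd z) powr k"
          unfolding h_def by (simp add: algebra_simps)
        then show ?thesis using True by simp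
      qed simp
    qed
    then have "(k + 1) * (H b - H a) \<le> (k + 1) * (LINT z|\<C>. indicator {a<..b} (fst z) * v z * u (a, snd z) powr k)"
      using k1 by (intro mult_left_mono) auto
    also have "\<dots> \<le> Y (k + 1) b - Y (k + 1) a"
      by (rule Y_increment_good[OF k a(1,2) bT a(5)])
    finally show ?thesis .
  qed
  \<comment> \<open>Good times are dense, so an arbitrary \<open>a\<close> is approached from the
    right by good times \<open>c n\<close>, along which \<open>Y\<close> and \<open>H\<close>
    converge to their values at \<open>a\<close>.\<close>
  have loc: "(k + 1) * (H b - H a) \<le> Y (k + 1) b - Y (k + 1) a"
    if a: "0 < a" "a < b" "b \<le> t2" "b - a < \<delta>" for a b
  proof -
    define e where "e n = (b - a) / real (Suc n)" for n
    have e: "0 < e n" "e n \<le> b - a" for n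
    proof -
      show "0 < e n" using a(2) by (simp add: e_def)
      have "(b - a) / real (Suc n) \<le> (b - a) / 1"
        using a(2) by (intro divide_left_mono) auto
      then show "e n \<le> b - a" by (simp add: e_def)
    qed
    have "\<exists>c. a < c \<and> c < a + e n \<and> good c" for n
      using good_dense[of a "a + e n"] e[of n] a t by simp
    then obtain c where c: "\<And>n. a < c n" "\<And>n. c n < a + e n" "\<And>n. good (c n)"
      by metis
    have e_lim: "e \<longlonglongrightarrow> 0"
      unfolding e_def[abs_def] divide_inverse using tendsto_mult_right_zero[OF LIMSEQ_inverse_real_of_nat] .
    have c_lim: "c \<longlonglongrightarrow> a"
    proof (rule tendsto_sandwich[of "\<lambda>_. a" c sequentially "\<lambda>n. a + e n"])
      show "(\<lambda>n. a + e n) \<longlonglongrightarrow> a" using tendsto_add[OF tendsto_const e_lim, of a] by simp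
    qed (auto intro!: always_eventually less_imp_le c)
    have cb: "c n < b" for n using c(2)[of n] e(2)[of n] by linarith
    have ineq: "(k + 1) * (H b - H (c n)) \<le> Y (k + 1) b - Y (k + 1) (c n)" for n
    proof (rule loc_good)
      show "0 < c n" using c(1)[of n] a(1) by linarith
      show "b - c n < \<delta>" using c(1)[of n] a(4) by linarith
    qed (use cb c(3) a(3) in auto)
    have "(\<lambda>n. Y (k + 1) (c n)) \<longlonglongrightarrow> Y (k + 1) a"
    proof (rule continuous_on_tendsto_compose[OF continuous_on_Y[OF k1] c_lim])
      show "a \<in> {0..<T}" using a t by simp
      have "c n \<in> {0..<T}" for n using c(1)[of n] cb[of n] a t by simp
      then show "\<forall>\<^sub>F n in sequentially. c n \<in> {0..<T}" by (rule always_eventually[OF allI])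
    qed
    moreover have "(\<lambda>n. H (c n)) \<longlonglongrightarrow> H a"
      unfolding H_def
    proof (rule integral_dominated_convergence[where w = "\<lambda>z. (L powr k + \<epsilon>) * \<bar>v z\<bar>"])
      show "AE z in \<C>. norm (indicator {0<..c n} (fst z) * h z) \<le> (L powr k + \<epsilon>) * \<bar>v z\<bar>" for n
      proof (rule AE_I2)
        fix z assume z: "z \<in> space \<C>"
        have "c n \<le> t2" using cb[of n] a(3) by linarith
        from ind_bound[OF z this, of 0]
        show "norm (indicator {0<..c n} (fst z) * h z) \<le> (L powr k + \<epsilon>) * \<bar>v z\<bar>"
          unfolding real_norm_def .
      qed
      show "AE z in \<C>. (\<lambda>n. indicator {0<..c n} (fst z) * h z) \<longlonglongrightarrow> indicator {0<..a} (fst z) * h z"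
      proof (rule AE_I2)
        fix z assume z: "z \<in> space \<C>"
        have "\<forall>\<^sub>F n in sequentially. (indicator {0<..c n} (fst z) :: real) = indicator {0<..a} (fst z)"
        proof (cases "fst z \<le> a")
          case True
          then have "fst z \<le> c n" for n using c(1)[of n] by linarith
          then show ?thesis using True by (simp add: indicator_def)
        next
          case False
          then have "\<forall>\<^sub>F n in sequentially. c n < fst z"
            by (intro order_tendstoD(2)[OF c_lim]) simp
          then show ?thesis
            by eventually_elim (use False in \<open>simp add: indicator_def\<close>)
        qed
        then have "(\<lambda>n. indicator {0<..c n} (fst z) :: real) \<longlonglongrightarrow> indicator {0<..a} (fst z)"
          by (rule tendsto_eventually)
        then show "(\<lambda>n. indicator {0<..c n} (fst z) * h z) \<longlonglongrightarrow> indicator {0<..a} (fst z) * h z"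
          by (rule tendsto_mult_right)
      qed
    qed (rule ind_m dom)+
    ultimately have "(\<lambda>n. (Y (k + 1) b - Y (k + 1) (c n)) - (k + 1) * (H b - H (c n)))
        \<longlonglongrightarrow> (Y (k + 1) b - Y (k + 1) a) - (k + 1) * (H b - H a)"
      by (intro tendsto_diff tendsto_mult tendsto_const)
    moreover have "0 \<le> (Y (k + 1) b - Y (k + 1) (c n)) - (k + 1) * (H b - H (c n))" for n
      using ineq[of n] by linarith
    ultimately have "0 \<le> (Y (k + 1) b - Y (k + 1) a) - (k + 1) * (H b - H a)"
      by (intro LIMSEQ_le_const[where a = 0]) auto
    then show ?thesis by linarith
  qed
  \<comment> \<open>Enough equal steps to make each of them shorter than \<open>\<delta>\<close>;
    the local inequalities then telescope from \<open>t1\<close> to \<open>t2\<close>.\<close>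
  obtain n :: nat where n: "(t2 - t1) / \<delta> < real n"
    using reals_Archimedean2 by blast
  have "0 < (t2 - t1) / \<delta>" using t \<delta> by simp
  then have n0: "0 < real n" using n by linarith
  define \<eta> where "\<eta> = (t2 - t1) / real n"
  have \<eta>: "0 < \<eta>" "\<eta> < \<delta>" "real n * \<eta> = t2 - t1"
    using n n0 t \<delta> by (auto simp: \<eta>_def field_simps)
  have "i \<le> n \<Longrightarrow> (k + 1) * (H (t1 + real i * \<eta>) - H t1) \<le> Y (k + 1) (t1 + real i * \<eta>) - Y (k + 1) t1" for i
  proof (induction i)
    case 0
    then show ?case by simp
  next
    case (Suc i)
    let ?a = "t1 + real i * \<eta>" and ?b = "t1 + real (Suc i) * \<eta>"
    have ab: "?b - ?a = \<eta>" by (simp add: algebra_simps)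
    have "real (Suc i) * \<eta> \<le> real n * \<eta>" using Suc.prems \<eta>(1) by (intro mult_right_mono) auto
    then have "?b \<le> t2" using \<eta>(3) by linarith
    moreover have "0 \<le> real i * \<eta>" using \<eta>(1) by simp
    ultimately have "(k + 1) * (H ?b - H ?a) \<le> Y (k + 1) ?b - Y (k + 1) ?a"
      using ab \<eta>(1,2) t(1) by (intro loc) linarith+
    moreover have "(k + 1) * (H ?a - H t1) \<le> Y (k + 1) ?a - Y (k + 1) t1"
      using Suc by simp
    moreover have "(k + 1) * (H ?b - H t1) = (k + 1) * (H ?b - H ?a) + (k + 1) * (H ?a - H t1)"
      by (simp only: distrib_left[symmetric]) simp
    ultimately show ?case by linarith
  qed
  from this[OF order_refl] have "(k + 1) * (H t2 - H t1) \<le> Y (k + 1) t2 - Y (k + 1) t1"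
    using \<eta>(3) by simp
  then show ?thesis
    unfolding H_diff[OF t(1) less_imp_le[OF t(2)] order_refl] h_def .
qed

lemma powr_weight_integrable:
  assumes "0 < \<kappa>" "b < T" and X: "integrable \<C> X"
  shows "integrable \<C> (\<lambda>z. indicator {a<..b} (fst z) * (X z * u z powr \<kappa>))"
proof -
  obtain L where L: "0 < L" "\<forall>t\<in>{0..b}. \<forall>x\<in>closure \<Omega>. u (t, x) \<in> {0..L}"
    by (rule u_bound[OF assms(2)])
  have "integrable \<C> (\<lambda>z. L powr \<kappa> * \<bar>X z\<bar>)" using X by simp
  then show ?thesis
  proof (rule Bochner_Integration.integrable_bound)
    show "(\<lambda>z. indicator {a<..b} (fst z) * (X z * u z powr \<kappa>)) \<in> borel_measurable \<C>"
      by (intro borel_measurable_times indicator_measurable_C borel_measurable_integrable[OF X]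
          cont_measurable_C[OF contu_powr[OF assms(1)]])
    show "AE z in \<C>. norm (indicator {a<..b} (fst z) * (X z * u z powr \<kappa>)) \<le> norm (L powr \<kappa> * \<bar>X z\<bar>)"
    proof (rule AE_I2)
      fix z assume z: "z \<in> space \<C>"
      show "norm (indicator {a<..b} (fst z) * (X z * u z powr \<kappa>)) \<le> norm (L powr \<kappa> * \<bar>X z\<bar>)"
      proof (cases "fst z \<in> {a<..b}")
        case True
        have "u z \<in> {0..L}"
          using L(2)[rule_format, of "fst z" "snd z"] space_C[OF z] True by simp
        then have "u z powr \<kappa> \<le> L powr \<kappa>" using assms(1) by (intro powr_mono2) auto
        then have "\<bar>X z\<bar> * u z powr \<kappa> \<le> \<bar>X z\<bar> * L powr \<kappa>" by (intro mult_left_mono) auto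
        then show ?thesis using True by (simp add: abs_mult mult.commute)
      qed simp
    qed
  qed
qed

text \<open>The error in the preceding estimate is a multiple of \<open>\<epsilon>\<close> whose
  factor contains the integral of \<open>\<bar>v z\<bar>\<close> and is finite, so
  \<open>\<epsilon>\<close> can tend to zero.\<close>

lemma Y_increment:
  assumes k: "1 < k" and t: "0 < t1" "t1 < t2" "t2 < T"
  shows "(k + 1) * (LINT z|\<C>. indicator {t1<..t2} (fst z) * (v z * u z powr k)) \<le> Y (k + 1) t2 - Y (k + 1) t1"
proof -
  let ?I = "LINT z|\<C>. indicator {t1<..t2} (fst z) * (v z * u z powr k)"
  let ?V = "LINT z|\<C>. indicator {t1<..t2} (fst z) * \<bar>v z\<bar>"
  have k0: "0 < k" using k by simp
  have iV: "integrable \<C> (\<lambda>z. indicator {t1<..t2} (fst z) * \<bar>v z\<bar>)"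
  proof (rule Bochner_Integration.integrable_bound[OF v_integrable])
    show "(\<lambda>z. indicator {t1<..t2} (fst z) * \<bar>v z\<bar>) \<in> borel_measurable \<C>"
      by (intro borel_measurable_times indicator_measurable_C borel_measurable_abs v_measurable)
    show "AE z in \<C>. norm (indicator {t1<..t2} (fst z) * \<bar>v z\<bar>) \<le> norm (v z)"
      by (rule AE_I2) (simp add: indicator_def)
  qed
  note iI = powr_weight_integrable[OF k0 t(3) v_integrable, of t1]
  have *: "(k + 1) * (?I - \<epsilon> * ?V) \<le> Y (k + 1) t2 - Y (k + 1) t1" if "0 < \<epsilon>" for \<epsilon>
  proof -
    have "(LINT z|\<C>. indicator {t1<..t2} (fst z) * (v z * u z powr k - \<epsilon> * \<bar>v z\<bar>))
        = (LINT z|\<C>. indicator {t1<..t2} (fst z) * (v z * u z powr k) - \<epsilon> * (indicator {t1<..t2} (fst z) * \<bar>v z\<bar>))"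
      by (simp add: algebra_simps)
    also have "\<dots> = ?I - \<epsilon> * ?V"
      using Bochner_Integration.integral_diff[OF iI integrable_mult_right[OF iV, of \<epsilon>]] by simp
    finally show ?thesis using Y_increment_eps[OF k t that] by simp
  qed
  have "((\<lambda>\<epsilon>. (k + 1) * (?I - \<epsilon> * ?V)) \<longlongrightarrow> (k + 1) * (?I - 0 * ?V)) (at_right 0)"
    by (intro tendsto_intros)
  moreover have "\<forall>\<^sub>F \<epsilon> in at_right 0. (k + 1) * (?I - \<epsilon> * ?V) \<le> Y (k + 1) t2 - Y (k + 1) t1"
    using eventually_at_right_less[of 0] by eventually_elim (rule *)
  ultimately have "(k + 1) * (?I - 0 * ?V) \<le> Y (k + 1) t2 - Y (k + 1) t1"
    by (intro tendsto_upperbound[where F = "at_right 0" and f = "\<lambda>\<epsilon>. (k + 1) * (?I - \<epsilon> * ?V)"]) auto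
  then show ?thesis by simp
qed

end

subsection \<open>Super-solutions\<close>

text \<open>Since \<open>Y\<close> is only continuous, it is compared with \<open>Z\<close>, the
  primitive of \<open>c / 2 * Y t powr \<gamma>\<close> that starts at \<open>Y \<tau>\<close>.
  Above \<open>M\<close>, half of the growth term pays for \<open>C\<close>; hence
  \<open>Z \<le> Y\<close>, and the derivative of \<open>Z\<close> is at least
  \<open>c / 2 * Z t powr \<gamma>\<close>. Then \<open>Z t powr (1 - \<gamma>)\<close> stays
  positive and decreases at least at the rate \<open>(\<gamma> - 1) * (c / 2)\<close>, which limits
  the length of the interval.\<close>

lemma blow_up_time_bound:
  fixes Y :: "real \<Rightarrow> real"
  assumes cont: "continuous_on {0..<T} Y" and \<tau>: "0 < \<tau>" "\<tau> < T"
    and c: "0 < c" and \<gamma>: "1 < \<gamma>" and M: "0 < M" "2 * C \<le> c * M powr \<gamma>"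
    and start: "M < Y \<tau>"
    and ineq: "\<And>t1 t2. \<lbrakk>0 < t1; t1 < t2; t2 < T\<rbrakk> \<Longrightarrow>
      integral {t1..t2} (\<lambda>t. c * Y t powr \<gamma> - C) \<le> Y t2 - Y t1"
  shows "T \<le> \<tau> + 2 * M powr (1 - \<gamma>) / (c * (\<gamma> - 1))"
proof -
  have contI: "continuous_on {a..b} Y" if "0 < a" "b < T" for a b
    by (rule continuous_on_subset[OF cont]) (use that in auto)
  have half: "c / 2 * y powr \<gamma> \<le> c * y powr \<gamma> - C" if "M \<le> y" for y
  proof -
    have "M powr \<gamma> \<le> y powr \<gamma>" using that M \<gamma> by (intro powr_mono2) auto
    then have "c * M powr \<gamma> \<le> c * y powr \<gamma>" using c by (intro mult_left_mono) auto
    moreover have "c * y powr \<gamma> = 2 * (c / 2 * y powr \<gamma>)" by simp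
    ultimately show ?thesis using M(2) by linarith
  qed
  \<comment> \<open>Suppose \<open>s\<close> is the first time with \<open>Y s = M\<close>. On
    \<open>{\<tau>..s}\<close> one has \<open>Y \<ge> M\<close>, so the integrand of the growth
    inequality is nonnegative there, which gives \<open>Y s \<ge> Y \<tau> > M\<close>, a
    contradiction.\<close>
  have above: "M < Y t" if t: "\<tau> \<le> t" "t < T" for t
  proof (rule ccontr)
    assume "\<not> M < Y t"
    then have Yt: "Y t \<le> M" by simp
    have cY: "continuous_on {\<tau>..t} Y" by (rule contI[OF \<tau>(1) t(2)])
    define A where "A = {s \<in> {\<tau>..t}. Y s = M}"
    have "\<exists>s\<ge>\<tau>. s \<le> t \<and> Y s = M"
      by (rule IVT2'[of Y t M \<tau>]) (use Yt start t cY in auto)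
    then have "A \<noteq> {}" unfolding A_def by auto
    moreover have "compact A"
    proof -
      have "A = {\<tau>..t} \<inter> Y -` {M}" by (auto simp: A_def)
      moreover have "closed ({\<tau>..t} \<inter> Y -` {M})"
        by (rule continuous_closed_preimage[OF cY]) auto
      ultimately show ?thesis
        using compact_Int_closed[of "{\<tau>..t}" "{\<tau>..t} \<inter> Y -` {M}"] by (simp add: Int_absorb1)
    qed
    ultimately obtain s where s: "s \<in> A" "\<forall>s'\<in>A. s \<le> s'"
      using compact_attains_inf by metis
    have s1: "\<tau> \<le> s" "s \<le> t" "Y s = M" using s(1) by (auto simp: A_def)
    have "\<tau> < s" using s1 start by (cases "\<tau> = s") auto
    have pos: "M \<le> Y s'" if s': "s' \<in> {\<tau>..s}" for s'
    proof (rule ccontr)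
      assume "\<not> M \<le> Y s'"
      then have "Y s' \<le> M" by simp
      moreover have "continuous_on {\<tau>..s'} Y"
        by (rule continuous_on_subset[OF cY]) (use s' s1 in auto)
      ultimately have "\<exists>x\<ge>\<tau>. x \<le> s' \<and> Y x = M"
        using start s' by (intro IVT2') auto
      then obtain x where x: "\<tau> \<le> x" "x \<le> s'" "Y x = M" by blast
      then have "x \<in> A" using s' s1 by (simp add: A_def)
      then have "s \<le> x" using s(2) by blast
      then have "s' = s" using x s' by simp
      then show False using \<open>\<not> M \<le> Y s'\<close> s1 by simp
    qed
    have "0 \<le> integral {\<tau>..s} (\<lambda>t. c * Y t powr \<gamma> - C)"
    proof (rule integral_nonneg)
      have "continuous_on {\<tau>..s} Y" by (rule contI[OF \<tau>(1)]) (use s1 t in simp)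
      then show "(\<lambda>t. c * Y t powr \<gamma> - C) integrable_on {\<tau>..s}"
        using pos M(1) \<gamma> by (intro integrable_continuous_interval continuous_intros) fastforce+
      show "0 \<le> c * Y x powr \<gamma> - C" if "x \<in> {\<tau>..s}" for x
      proof -
        have "0 \<le> c / 2 * Y x powr \<gamma>" using c by simp
        then show ?thesis using half[OF pos[OF that]] by linarith
      qed
    qed
    also have "\<dots> \<le> Y s - Y \<tau>"
      by (rule ineq[OF \<tau>(1) \<open>\<tau> < s\<close>]) (use s1 t in simp)
    finally show False using s1 start by simp
  qed
  have bound: "t1 \<le> \<tau> + 2 * M powr (1 - \<gamma>) / (c * (\<gamma> - 1))" if t1: "\<tau> < t1" "t1 < T" for t1
  proof -
    have cY: "continuous_on {\<tau>..t1} Y" by (rule contI[OF \<tau>(1) t1(2)])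
    have Ypos: "M < Y t" if "t \<in> {\<tau>..t1}" for t using above that t1 by simp
    have cF: "continuous_on {\<tau>..t1} (\<lambda>t. c / 2 * Y t powr \<gamma>)"
      using Ypos M(1) by (intro continuous_intros cY) fastforce+
    define Z where "Z t = Y \<tau> + integral {\<tau>..t} (\<lambda>t. c / 2 * Y t powr \<gamma>)" for t
    have Z_le: "Z t \<le> Y t" if t: "t \<in> {\<tau>..t1}" for t
    proof (cases "t = \<tau>")
      case False
      have sub: "{\<tau>..t} \<subseteq> {\<tau>..t1}" using t by auto
      have "integral {\<tau>..t} (\<lambda>t. c / 2 * Y t powr \<gamma>) \<le> integral {\<tau>..t} (\<lambda>t. c * Y t powr \<gamma> - C)"
      proof (rule integral_le)
        show "(\<lambda>t. c / 2 * Y t powr \<gamma>) integrable_on {\<tau>..t}"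
          by (rule integrable_continuous_interval[OF continuous_on_subset[OF cF sub]])
        have "(\<lambda>t. 2 * (c / 2 * Y t powr \<gamma>) - C) integrable_on {\<tau>..t}"
          by (intro integrable_continuous_interval continuous_on_diff continuous_on_mult_left
              continuous_on_const continuous_on_subset[OF cF sub])
        then show "(\<lambda>t. c * Y t powr \<gamma> - C) integrable_on {\<tau>..t}" by simp
        show "c / 2 * Y x powr \<gamma> \<le> c * Y x powr \<gamma> - C" if "x \<in> {\<tau>..t}" for x
          by (rule half) (use Ypos[of x] that sub in auto)
      qed
      also have "\<dots> \<le> Y t - Y \<tau>"
        by (rule ineq[OF \<tau>(1)]) (use t False t1 in auto)
      finally show ?thesis by (simp add: Z_def)
    qed (simp add: Z_def)
    have Z_ge: "Y \<tau> \<le> Z t" if t: "t \<in> {\<tau>..t1}" for t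
    proof -
      have sub: "{\<tau>..t} \<subseteq> {\<tau>..t1}" using t by auto
      have "0 \<le> integral {\<tau>..t} (\<lambda>t. c / 2 * Y t powr \<gamma>)"
        by (rule integral_nonneg[OF integrable_continuous_interval[OF continuous_on_subset[OF cF sub]]])
           (use c in simp)
      then show ?thesis by (simp add: Z_def)
    qed
    have Zpos: "0 < Z t" if "t \<in> {\<tau>..t1}" for t using Z_ge[OF that] start M(1) by linarith
    have Z_der: "(Z has_real_derivative c / 2 * Y t powr \<gamma>) (at t within {\<tau>..t1})" if "t \<in> {\<tau>..t1}" for t
      unfolding Z_def using DERIV_add[OF DERIV_const integral_has_real_derivative[OF cF that]] by simp
    define W where "W t = Z t powr (1 - \<gamma>)" for t
    have W_cont: "continuous_on {\<tau>..t1} W"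
    proof -
      have "continuous_on {\<tau>..t1} Z"
        by (rule DERIV_continuous_on[OF Z_der])
      then show ?thesis
        unfolding W_def using Zpos by (intro continuous_intros) fastforce+
    qed
    have W_der: "(W has_real_derivative (1 - \<gamma>) * Z t powr (- \<gamma>) * (c / 2 * Y t powr \<gamma>)) (at t)"
      if t: "\<tau> < t" "t < t1" for t
    proof -
      have tI: "t \<in> {\<tau>..t1}" using t by simp
      have zd: "(Z has_real_derivative c / 2 * Y t powr \<gamma>) (at t)"
        using Z_der[OF tI] t by (simp add: at_within_Icc_at)
      have "((\<lambda>z. z powr (1 - \<gamma>)) has_real_derivative (1 - \<gamma>) * Z t powr (1 - \<gamma> - 1)) (at (Z t))"
        by (rule has_real_derivative_powr[OF Zpos[OF tI]])
      from DERIV_chain2[OF this zd] show ?thesis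
        unfolding W_def by simp
    qed
    \<comment> \<open>The decay rate of \<open>W\<close> is bounded at every interior point, so a
      single mean value point replaces an integration.\<close>
    obtain \<xi> where \<xi>: "\<tau> < \<xi>" "\<xi> < t1"
      "W t1 - W \<tau> = (t1 - \<tau>) * ((1 - \<gamma>) * Z \<xi> powr (- \<gamma>) * (c / 2 * Y \<xi> powr \<gamma>))"
    proof -
      have "\<exists>l z. \<tau> < z \<and> z < t1 \<and> DERIV W z :> l \<and> W t1 - W \<tau> = (t1 - \<tau>) * l"
        by (rule MVT[OF t1(1) W_cont]) (use W_der real_differentiable_def in blast)
      then obtain l z where z: "\<tau> < z" "z < t1" "DERIV W z :> l" "W t1 - W \<tau> = (t1 - \<tau>) * l" by blast
      have "l = (1 - \<gamma>) * Z z powr (- \<gamma>) * (c / 2 * Y z powr \<gamma>)"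
        by (rule DERIV_unique[OF z(3) W_der[OF z(1,2)]])
      then show ?thesis using that[OF z(1,2)] z(4) by simp
    qed
    have \<xi>I: "\<xi> \<in> {\<tau>..t1}" using \<xi> by simp
    have "Z \<xi> powr \<gamma> \<le> Y \<xi> powr \<gamma>"
      using Z_le[OF \<xi>I] Zpos[OF \<xi>I] \<gamma> by (intro powr_mono2) auto
    then have "Z \<xi> powr (- \<gamma>) * Z \<xi> powr \<gamma> \<le> Z \<xi> powr (- \<gamma>) * Y \<xi> powr \<gamma>"
      by (intro mult_left_mono) auto
    moreover have "Z \<xi> powr (- \<gamma>) * Z \<xi> powr \<gamma> = 1"
      using Zpos[OF \<xi>I] by (simp flip: powr_add)
    ultimately have q1: "1 \<le> Z \<xi> powr (- \<gamma>) * Y \<xi> powr \<gamma>" by simp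
    have "(t1 - \<tau>) * ((\<gamma> - 1) * (c / 2)) * 1
        \<le> (t1 - \<tau>) * ((\<gamma> - 1) * (c / 2)) * (Z \<xi> powr (- \<gamma>) * Y \<xi> powr \<gamma>)"
      using q1 t1 \<gamma> c by (intro mult_left_mono) auto
    also have "\<dots> = W \<tau> - W t1"
    proof -
      have "a * ((1 - \<gamma>) * x * (d * y)) = - (a * ((\<gamma> - 1) * d) * (x * y))" for a d x y :: real
        by (simp add: algebra_simps)
      then show ?thesis using \<xi>(3) by simp
    qed
    also have "\<dots> \<le> W \<tau>"
      by (simp add: W_def)
    also have "W \<tau> \<le> M powr (1 - \<gamma>)"
    proof -
      have "Z \<tau> = Y \<tau>" by (simp add: Z_def)
      then show ?thesis
        unfolding W_def using start M(1) \<gamma> by (intro powr_mono2') auto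
    qed
    finally have "(t1 - \<tau>) * (c * (\<gamma> - 1)) \<le> 2 * M powr (1 - \<gamma>)" by (simp add: algebra_simps)
    then have "t1 - \<tau> \<le> 2 * M powr (1 - \<gamma>) / (c * (\<gamma> - 1))"
      using c \<gamma> by (simp add: pos_le_divide_eq)
    then show ?thesis by simp
  qed
  show ?thesis
  proof (rule ccontr)
    assume *: "\<not> ?thesis"
    \<comment> \<open>If \<open>T\<close> exceeded this number, the midpoint between the two would
      be an admissible time violating \<open>bound\<close>.\<close>
    define R where "R = \<tau> + 2 * M powr (1 - \<gamma>) / (c * (\<gamma> - 1))"
    have "\<tau> \<le> R" using c \<gamma> M(1) by (simp add: R_def)
    then have "\<tau> < (R + T) / 2" "(R + T) / 2 < T" using * \<tau> by (auto simp: R_def)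
    from bound[OF this] show False using * by (simp add: R_def)
  qed
qed

section \<open>Testing a super-solution with \<open>u powr k\<close> and a cutoff in time\<close>

locale supersolution = evolution mul w \<Omega> r T u g v
  for mul :: "real^'n \<Rightarrow> real^'n \<Rightarrow> real^'n" and w :: "'n \<Rightarrow> nat" and \<Omega> :: "(real^'n) set"
    and r T :: real and u g v +
  fixes p q \<alpha> \<beta> :: real
  assumes p: "1 < p" "p < r" and q: "0 < q"
    and boundary: "\<forall>z\<in>cylinder T (frontier \<Omega>). u z = 0"
    and weak: "\<And>\<phi> h. test_function mul w \<Omega> p T \<phi> h \<Longrightarrow>
      weak_rhs \<Omega> q r \<alpha> \<beta> T u g \<phi> \<le> weak_lhs \<Omega> p T g v \<phi> h"
begin

definition k :: real where "k = r / (r - p)"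

lemma k: "1 < k" "0 < k" "k - 1 = p / (r - p)" "0 < k - 1"
  using p by (auto simp: k_def field_simps)

lemma gp_integrable: "integrable \<C> (\<lambda>z. norm (g z) powr p)"
  by (rule C.integrable_norm_powr_mono[OF g_integrable g_measurable]) (use p in auto)

text \<open>Vanishing from time \<open>b\<close> on keeps all integrals in the range where
  \<open>u\<close> is bounded. Continuity is the right regularity, because the weak formulation
  contains no time derivative of the test function; it admits piecewise linear cutoffs.\<close>

definition cutoff :: "real \<Rightarrow> (real \<Rightarrow> real) \<Rightarrow> bool" where
  "cutoff b \<zeta> \<longleftrightarrow> continuous_on UNIV \<zeta> \<and> (\<forall>t. 0 \<le> \<zeta> t \<and> \<zeta> t \<le> 1) \<and> (\<forall>t\<ge>b. \<zeta> t = 0)"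

lemma cutoff_weight_integrable:
  assumes \<zeta>: "cutoff b \<zeta>" and b: "b < T" and \<kappa>: "0 < \<kappa>" and X: "integrable \<C> X"
  shows "integrable \<C> (\<lambda>z. \<zeta> (fst z) * (X z * u z powr \<kappa>))"
proof (rule Bochner_Integration.integrable_bound[OF powr_weight_integrable[OF \<kappa> b X, of 0]])
  have c\<zeta>: "continuous_on UNIV \<zeta>" using \<zeta> by (simp add: cutoff_def)
  have "(\<lambda>z. \<zeta> (fst z)) \<in> borel_measurable \<C>"
    by (rule cont_measurable_C, rule continuous_on_compose2[OF c\<zeta> continuous_on_fst[OF continuous_on_id]]) simp
  then show "(\<lambda>z. \<zeta> (fst z) * (X z * u z powr \<kappa>)) \<in> borel_measurable \<C>"
    by (intro borel_measurable_times borel_measurable_integrable[OF X] cont_measurable_C[OF contu_powr[OF \<kappa>]])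
  show "AE z in \<C>. norm (\<zeta> (fst z) * (X z * u z powr \<kappa>)) \<le> norm (indicator {0<..b} (fst z) * (X z * u z powr \<kappa>))"
  proof (rule AE_I2)
    fix z assume z: "z \<in> space \<C>"
    show "norm (\<zeta> (fst z) * (X z * u z powr \<kappa>)) \<le> norm (indicator {0<..b} (fst z) * (X z * u z powr \<kappa>))"
    proof (cases "fst z \<le> b")
      case True
      have "\<bar>\<zeta> (fst z)\<bar> \<le> 1" using \<zeta> by (simp add: cutoff_def)
      then have "\<bar>\<zeta> (fst z)\<bar> * \<bar>X z * u z powr \<kappa>\<bar> \<le> 1 * \<bar>X z * u z powr \<kappa>\<bar>"
        by (intro mult_right_mono) auto
      then show ?thesis
        using True space_C(1)[OF z] by (simp add: abs_mult)
    next
      case False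
      then show ?thesis using \<zeta> by (simp add: cutoff_def)
    qed
  qed
qed

text \<open>The case distinction fixes the value at time \<open>T\<close>, where nothing is known
  about \<open>u\<close>; continuity on the closed cylinder comes from gluing with zero at time
  \<open>b\<close>. At good times the gradient is the chain rule for
  \<open>\<zeta> t * y powr k\<close>, whose derivative is continuous down to \<open>y = 0\<close>
  because \<open>k > 1\<close>.\<close>

lemma powr_test_function:
  assumes \<zeta>: "cutoff b \<zeta>" and b: "0 < b" "b < T"
  shows "test_function mul w \<Omega> p T
    (\<lambda>z. if fst z < T then \<zeta> (fst z) * u z powr k else 0)
    (\<lambda>z. (\<zeta> (fst z) * (k * u z powr (k - 1))) *\<^sub>R g z)"
proof -
  let ?\<phi> = "\<lambda>z. if fst z < T then \<zeta> (fst z) * u z powr k else 0"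
  let ?h = "\<lambda>z. (\<zeta> (fst z) * (k * u z powr (k - 1))) *\<^sub>R g z"
  have c\<zeta>: "continuous_on UNIV \<zeta>" and \<zeta>01: "\<And>t. 0 \<le> \<zeta> t" "\<And>t. \<zeta> t \<le> 1" and \<zeta>0: "\<And>t. b \<le> t \<Longrightarrow> \<zeta> t = 0"
    using \<zeta> by (simp_all add: cutoff_def)
  have c\<zeta>f: "continuous_on S (\<lambda>z::real \<times> (real^'n). \<zeta> (fst z))" for S
    by (rule continuous_on_compose2[OF c\<zeta> continuous_on_fst[OF continuous_on_id]]) simp
  have c1: "continuous_on ({0..<T} \<times> closure \<Omega>) (\<lambda>z. \<zeta> (fst z) * u z powr k)"
    by (rule continuous_on_mult[OF c\<zeta>f contu_powr[OF k(2)]])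
  have clos: "closure (cylinder T \<Omega>) = {0..T} \<times> closure \<Omega>"
    using T by (simp add: closure_Times)
  have cont: "continuous_on (closure (cylinder T \<Omega>)) ?\<phi>"
  proof -
    have "{0..T} \<times> closure \<Omega> = ({0..b} \<times> closure \<Omega>) \<union> ({b..T} \<times> closure \<Omega>)"
      using b by auto
    moreover have "continuous_on (({0..b} \<times> closure \<Omega>) \<union> ({b..T} \<times> closure \<Omega>)) ?\<phi>"
    proof (rule continuous_on_closed_Un)
      have "continuous_on ({0..b} \<times> closure \<Omega>) (\<lambda>z. \<zeta> (fst z) * u z powr k)"
        by (rule continuous_on_subset[OF c1]) (use b in auto)
      then show "continuous_on ({0..b} \<times> closure \<Omega>) ?\<phi>"
        by (rule continuous_on_eq) (use b in auto)
      have "continuous_on ({b..T} \<times> closure \<Omega>) (\<lambda>z. 0::real)" by (rule continuous_on_const)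
      then show "continuous_on ({b..T} \<times> closure \<Omega>) ?\<phi>"
        by (rule continuous_on_eq) (use \<zeta>0 in auto)
    qed (auto intro: closed_Times)
    ultimately show ?thesis unfolding clos by simp
  qed
  have nonneg: "\<forall>z\<in>closure (cylinder T \<Omega>). 0 \<le> ?\<phi> z"
    using \<zeta>01(1) by simp
  have bdry: "\<forall>z\<in>cylinder T (frontier \<Omega>). ?\<phi> z = 0"
    using boundary by simp
  have \<phi>m: "?\<phi> \<in> borel_measurable \<C>"
  proof -
    have "(\<lambda>z. \<zeta> (fst z) * u z powr k) \<in> borel_measurable \<C>"
      by (rule cont_measurable_C[OF c1])
    then show ?thesis
    proof (rule measurable_lebesgue_cong[THEN iffD1, rotated])
      show "\<zeta> (fst z) * u z powr k = ?\<phi> z" if "z \<in> cylinder T \<Omega>" for z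
        using that by auto
    qed
  qed
  have weight_m: "(\<lambda>z. \<zeta> (fst z) * (k * u z powr (k - 1))) \<in> borel_measurable \<C>"
    by (rule cont_measurable_C) (intro continuous_on_mult c\<zeta>f continuous_on_const contu_powr k)
  have hm: "?h \<in> borel_measurable \<C>"
    by (rule borel_measurable_scaleR[OF weight_m g_measurable])
  have ae: "AE t in lebesgue_on {0<..<T}. has_hgrad_S0 mul w p \<Omega> (\<lambda>x. ?\<phi> (t, x)) (\<lambda>x. ?h (t, x))"
    using AE_good AE_space[of "lebesgue_on {0<..<T}"]
  proof eventually_elim
    case (elim t)
    then have t: "0 < t" "t < T" by auto
    obtain L where L: "0 < L" "\<forall>t'\<in>{0..t}. \<forall>x\<in>closure \<Omega>. u (t', x) \<in> {0..L}"
      by (rule u_bound[OF t(2)])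
    have uL: "\<And>x. x \<in> \<Omega> \<Longrightarrow> u (t, x) \<in> {0..L}"
      using L(2)[rule_format, of t] t closure_subset[of \<Omega>] by auto
    have g1: "has_hgrad_S0 mul w r \<Omega> (\<lambda>x. u (t, x)) (\<lambda>x. g (t, x))"
      "integrable \<M> (\<lambda>x. norm (g (t, x)) powr r)"
      using elim(1) by (simp_all add: good_def)
    have p0: "0 < p" "p \<le> r" using p by auto
    have f0: "\<zeta> t * 0 powr k = 0" by simp
    have f: "((\<lambda>y. \<zeta> t * y powr k) has_real_derivative \<zeta> t * (k * y powr (k - 1))) (at y within {0..L})"
      if "y \<in> {0..L}" for y
      by (rule DERIV_cmult[OF has_real_derivative_powr_Icc[OF k(1) that]])
    have f': "continuous_on {0..L} (\<lambda>y. \<zeta> t * (k * y powr (k - 1)))"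
      by (rule continuous_on_mult_left[OF continuous_on_powr_Icc[OF k(4)]])
    from has_hgrad_S0_chain[where f = "\<lambda>y. \<zeta> t * y powr k" and f' = "\<lambda>y. \<zeta> t * (k * y powr (k - 1))",
        OF G \<Omega> g1(1) p0 g1(2) L(1) uL f0 f f']
    show ?case using t by simp
  qed
  have int: "integrable \<C> (\<lambda>z. norm (?h z) powr p + \<bar>?\<phi> z\<bar> powr p)"
  proof (rule Bochner_Integration.integrable_add)
    obtain L where L: "0 < L" "\<forall>t\<in>{0..b}. \<forall>x\<in>closure \<Omega>. u (t, x) \<in> {0..L}"
      by (rule u_bound[OF b(2)])
    have uL: "u z powr \<kappa> \<le> L powr \<kappa>" if "z \<in> space \<C>" "fst z \<le> b" "0 < \<kappa>" for z \<kappa>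
    proof -
      have "u z \<in> {0..L}" using L(2)[rule_format, of "fst z" "snd z"] space_C[OF that(1)] that(2) by simp
      then show ?thesis using that(3) by (intro powr_mono2) auto
    qed
    let ?K = "k * L powr (k - 1)"
    show "integrable \<C> (\<lambda>z. norm (?h z) powr p)"
    proof (rule Bochner_Integration.integrable_bound[OF integrable_mult_right[OF gp_integrable, of "?K powr p"]])
      show "(\<lambda>z. norm (?h z) powr p) \<in> borel_measurable \<C>"
        using hm by measurable
      show "AE z in \<C>. norm (norm (?h z) powr p) \<le> norm (?K powr p * norm (g z) powr p)"
      proof (rule AE_I2)
        fix z assume z: "z \<in> space \<C>"
        have "\<zeta> (fst z) * (k * u z powr (k - 1)) \<le> 1 * ?K"
        proof (cases "fst z \<le> b")
          case True
          then show ?thesis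
            using uL[OF z True k(4)] \<zeta>01 k by (intro mult_mono mult_nonneg_nonneg) auto
        next
          case False
          then show ?thesis using \<zeta>0 k by simp
        qed
        moreover have "0 \<le> \<zeta> (fst z) * (k * u z powr (k - 1))"
          using \<zeta>01 k by simp
        ultimately have "norm (?h z) \<le> ?K * norm (g z)"
          by (simp add: mult_right_mono)
        then have "norm (?h z) powr p \<le> (?K * norm (g z)) powr p"
          using p by (intro powr_mono2) auto
        also have "\<dots> = ?K powr p * norm (g z) powr p"
          by (rule powr_mult)
        finally show "norm (norm (?h z) powr p) \<le> norm (?K powr p * norm (g z) powr p)"
          by simp
      qed
    qed
    show "integrable \<C> (\<lambda>z. \<bar>?\<phi> z\<bar> powr p)"
    proof (rule C.integrable_const_bound[of _ "(L powr k) powr p"], rule AE_I2)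
      fix z assume z: "z \<in> space \<C>"
      have "\<bar>?\<phi> z\<bar> \<le> 1 * L powr k"
      proof (cases "fst z \<le> b")
        case True
        have "\<zeta> (fst z) * u z powr k \<le> 1 * L powr k"
          using uL[OF z True k(2)] \<zeta>01 by (intro mult_mono) auto
        then show ?thesis using \<zeta>01 by simp
      next
        case False
        then show ?thesis using \<zeta>0 by simp
      qed
      then show "norm (\<bar>?\<phi> z\<bar> powr p) \<le> (L powr k) powr p"
        using powr_mono2[of p "\<bar>?\<phi> z\<bar>" "L powr k"] p by simp
    next
      show "(\<lambda>z. \<bar>?\<phi> z\<bar> powr p) \<in> borel_measurable \<C>"
        using \<phi>m by measurable
    qed
  qed
  show ?thesis
    unfolding test_function_def has_hgrad_LS0_def
    by (intro conjI cont nonneg bdry \<phi>m hm ae int)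
qed

text \<open>What testing with \<open>u powr k\<close> leaves besides the time derivative: the two
  source terms minus the diffusion term, in which the gradient of the test function produces the
  factor \<open>k * u z powr (k - 1)\<close>. The weak inequality says that \<open>D\<close>,
  weighted with any cutoff, has a nonnegative integral.\<close>

definition R :: "real \<times> (real^'n) \<Rightarrow> real" where
  "R z = \<alpha> * u z powr (q + k) + \<beta> * (norm (g z) powr r * u z powr k)
     - k * (norm (g z) powr p * u z powr (k - 1))"

definition D :: "real \<times> (real^'n) \<Rightarrow> real" where
  "D z = v z * u z powr k - R z"

lemma weak_cutoff:
  assumes \<zeta>: "cutoff b \<zeta>" and b: "0 < b" "b < T"
  shows "0 \<le> (LINT z|\<C>. \<zeta> (fst z) * D z)"
proof -
  let ?\<phi> = "\<lambda>z. if fst z < T then \<zeta> (fst z) * u z powr k else 0"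
  let ?h = "\<lambda>z. (\<zeta> (fst z) * (k * u z powr (k - 1))) *\<^sub>R g z"
  let ?v = "\<lambda>z. \<zeta> (fst z) * (v z * u z powr k)"
  let ?p = "\<lambda>z. \<zeta> (fst z) * (norm (g z) powr p * u z powr (k - 1))"
  let ?q = "\<lambda>z. \<zeta> (fst z) * (1 * u z powr (q + k))"
  let ?r = "\<lambda>z. \<zeta> (fst z) * (norm (g z) powr r * u z powr k)"
  note cw = cutoff_weight_integrable[OF \<zeta> b(2)]
  have i: "integrable \<C> ?v" "integrable \<C> ?p" "integrable \<C> ?q" "integrable \<C> ?r"
    by (rule cw[OF k(2) v_integrable] cw[OF k(4) gp_integrable] cw[OF add_pos_pos[OF q k(2)] C.integrable_const]
        cw[OF k(2) g_integrable])+
  have "weak_rhs \<Omega> q r \<alpha> \<beta> T u g ?\<phi> \<le> weak_lhs \<Omega> p T g v ?\<phi> ?h"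
    by (rule weak[OF powr_test_function[OF \<zeta> b]])
  moreover have "weak_rhs \<Omega> q r \<alpha> \<beta> T u g ?\<phi> = (LINT z|\<C>. \<alpha> * ?q z + \<beta> * ?r z)"
    unfolding weak_rhs_def
  proof (rule Bochner_Integration.integral_cong[OF refl])
    fix z assume z: "z \<in> space \<C>"
    have u0: "0 \<le> u z" by (rule space_C(6)[OF z])
    have "\<bar>u z\<bar> powr (q - 1) * u z * u z powr k = u z powr (q + k)"
    proof (cases "u z = 0")
      case False
      then have up: "0 < u z" using u0 by simp
      have "u z powr (q - 1) * u z = u z powr q"
        using up by (simp add: powr_diff)
      then show ?thesis using up by (simp add: powr_add)
    qed simp
    moreover have "(\<alpha> * \<bar>u z\<bar> powr (q - 1) * u z + \<beta> * norm (g z) powr r) * ?\<phi> z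
        = \<alpha> * (\<zeta> (fst z) * (\<bar>u z\<bar> powr (q - 1) * u z * u z powr k)) + \<beta> * ?r z"
      using space_C(2)[OF z] by (simp add: algebra_simps)
    ultimately show "(\<alpha> * \<bar>u z\<bar> powr (q - 1) * u z + \<beta> * norm (g z) powr r) * ?\<phi> z = \<alpha> * ?q z + \<beta> * ?r z"
      by simp
  qed
  moreover have "weak_lhs \<Omega> p T g v ?\<phi> ?h = (LINT z|\<C>. ?v z + k * ?p z)"
    unfolding weak_lhs_def
  proof (rule Bochner_Integration.integral_cong[OF refl])
    fix z assume z: "z \<in> space \<C>"
    \<comment> \<open>Where the gradient vanishes both sides are zero, since
      \<open>0 powr x = 0\<close> for every exponent, also for the negative \<open>p - 2\<close>
      when \<open>p < 2\<close>.\<close>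
    have "norm (g z) powr (p - 2) * (g z \<bullet> g z) = norm (g z) powr p"
    proof (cases "g z = 0")
      case False
      have "norm (g z) powr (p - 2) * (norm (g z))\<^sup>2 = norm (g z) powr (p - 2) * norm (g z) powr 2"
        using False by (simp add: powr_numeral)
      also have "\<dots> = norm (g z) powr p" unfolding powr_add[symmetric] by simp
      finally show ?thesis by (simp add: power2_norm_eq_inner)
    qed simp
    then have "(norm (g z) powr (p - 2) *\<^sub>R g z) \<bullet> ?h z = k * ?p z"
      by (simp add: mult_ac)
    then show "v z * ?\<phi> z + (norm (g z) powr (p - 2) *\<^sub>R g z) \<bullet> ?h z = ?v z + k * ?p z"
      using space_C(2)[OF z] by (simp add: mult_ac)
  qed
  moreover have "(LINT z|\<C>. \<zeta> (fst z) * D z) = (LINT z|\<C>. (?v z + k * ?p z) - (\<alpha> * ?q z + \<beta> * ?r z))"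
    unfolding D_def R_def by (rule Bochner_Integration.integral_cong[OF refl]) (simp add: algebra_simps)
  moreover have "\<dots> = (LINT z|\<C>. ?v z + k * ?p z) - (LINT z|\<C>. \<alpha> * ?q z + \<beta> * ?r z)"
    by (intro Bochner_Integration.integral_diff Bochner_Integration.integrable_add integrable_mult_right i)
  ultimately show ?thesis by linarith
qed

lemma R_integrable:
  assumes "b < T"
  shows "integrable \<C> (\<lambda>z. indicator {a<..b} (fst z) * R z)"
proof -
  note pw = powr_weight_integrable[OF _ assms, of _ _ a]
  have "integrable \<C> (\<lambda>z. \<alpha> * (indicator {a<..b} (fst z) * (1 * u z powr (q + k)))
      + \<beta> * (indicator {a<..b} (fst z) * (norm (g z) powr r * u z powr k))
      - k * (indicator {a<..b} (fst z) * (norm (g z) powr p * u z powr (k - 1))))"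
    by (intro Bochner_Integration.integrable_diff Bochner_Integration.integrable_add integrable_mult_right)
       (rule pw[OF add_pos_pos[OF q k(2)] C.integrable_const] pw[OF k(2) g_integrable] pw[OF k(4) gp_integrable])+
  then show ?thesis
    unfolding R_def by (simp add: algebra_simps)
qed

lemma D_integrable:
  assumes "b < T"
  shows "integrable \<C> (\<lambda>z. indicator {a<..b} (fst z) * D z)"
  using Bochner_Integration.integrable_diff[OF powr_weight_integrable[OF k(2) assms v_integrable, of a] R_integrable[OF assms, of a]]
  unfolding D_def right_diff_distrib .

text \<open>Continuous cutoffs converge pointwise to the indicator of \<open>{t1<..t2}\<close>. They
  all vanish from a common time \<open>b < T\<close> on, so \<open>D\<close> restricted to times up
  to \<open>b\<close> provides an integrable majorant.\<close>

lemma weak_interval: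
  assumes t: "0 < t1" "t1 < t2" "t2 < T"
  shows "(LINT z|\<C>. indicator {t1<..t2} (fst z) * R z)
    \<le> (LINT z|\<C>. indicator {t1<..t2} (fst z) * (v z * u z powr k))"
proof -
  define b where "b = (t2 + T) / 2"
  have b: "0 < b" "b < T" "t2 < b" using t by (auto simp: b_def)
  \<comment> \<open>For large \<open>c\<close> this rises from \<open>0\<close> to \<open>1\<close>
    on \<open>{t1..t1 + 1 / c}\<close> and falls back to \<open>0\<close> on
    \<open>{t2..t2 + 1 / c}\<close>.\<close>
  define \<zeta> where "\<zeta> c s = max 0 (min 1 (min (c * (s - t1)) (1 - c * (s - t2))))" for c s :: real
  \<comment> \<open>Slopes are taken at least \<open>N\<close>, so that the descent after
    \<open>t2\<close> is completed before \<open>b\<close>.\<close>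
  obtain N :: nat where N: "1 / (b - t2) < real N" using reals_Archimedean2 by blast
  have N0: "0 < real N"
  proof -
    have "0 < 1 / (b - t2)" using b by simp
    then show ?thesis using N by linarith
  qed
  have \<zeta>: "cutoff b (\<zeta> (real (n + N)))" for n
  proof -
    have "1 < real (n + N) * (b - t2)"
    proof -
      have "1 < real N * (b - t2)" using N b by (simp add: field_simps)
      also have "\<dots> \<le> real (n + N) * (b - t2)" using b by (intro mult_right_mono) auto
      finally show ?thesis .
    qed
    moreover have "real (n + N) * (b - t2) \<le> real (n + N) * (s - t2)" if "b \<le> s" for s
      using that by (intro mult_left_mono) auto
    ultimately have "1 - real (n + N) * (s - t2) \<le> 0" if "b \<le> s" for s
      using that by fastforce
    then have "\<zeta> (real (n + N)) s = 0" if "b \<le> s" for s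
      using that unfolding \<zeta>_def by (simp add: min_le_iff_disj)
    moreover have "continuous_on UNIV (\<zeta> (real (n + N)))"
      unfolding \<zeta>_def by (intro continuous_on_max continuous_on_min continuous_on_const
          continuous_on_mult_left continuous_on_diff continuous_on_id)
    moreover have "0 \<le> \<zeta> (real (n + N)) s \<and> \<zeta> (real (n + N)) s \<le> 1" for s
      unfolding \<zeta>_def by simp
    ultimately show ?thesis unfolding cutoff_def by blast
  qed
  have \<zeta>_lim: "(\<lambda>n. \<zeta> (real (n + N)) s) \<longlonglongrightarrow> indicator {t1<..t2} s" for s
  proof -
    have top: "filterlim (\<lambda>n. real (n + N)) at_top sequentially"
      by (rule filterlim_compose[OF filterlim_real_sequentially filterlim_add_const_nat_at_top])
    consider "s \<le> t1" | "t1 < s" "s \<le> t2" | "t2 < s" by linarith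
    then show ?thesis
    proof cases
      case 1
      then have "real (n + N) * (s - t1) \<le> 0" for n by (intro mult_nonneg_nonpos) auto
      then have "\<zeta> (real (n + N)) s = 0" for n unfolding \<zeta>_def by (simp add: min_le_iff_disj)
      then show ?thesis using 1 by simp
    next
      case 2
      have "\<forall>\<^sub>F n in sequentially. 1 / (s - t1) \<le> real (n + N)"
        using top unfolding filterlim_at_top by blast
      then have "\<forall>\<^sub>F n in sequentially. \<zeta> (real (n + N)) s = 1"
      proof eventually_elim
        case (elim n)
        then have "1 \<le> real (n + N) * (s - t1)" using 2 by (simp add: field_simps)
        moreover have "real (n + N) * (s - t2) \<le> 0" using 2 by (intro mult_nonneg_nonpos) auto
        ultimately show ?case unfolding \<zeta>_def by simp
      qed
      then show ?thesis using 2 by (simp add: tendsto_eventually)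
    next
      case 3
      have "\<forall>\<^sub>F n in sequentially. 1 / (s - t2) \<le> real (n + N)"
        using top unfolding filterlim_at_top by blast
      then have "\<forall>\<^sub>F n in sequentially. \<zeta> (real (n + N)) s = 0"
      proof eventually_elim
        case (elim n)
        then have "1 \<le> real (n + N) * (s - t2)" using 3 by (simp add: field_simps)
        then show ?case unfolding \<zeta>_def by (simp add: min_le_iff_disj)
      qed
      then show ?thesis using 3 by (simp add: tendsto_eventually)
    qed
  qed
  have dom: "integrable \<C> (\<lambda>z. norm (indicator {0<..b} (fst z) * D z))"
    using D_integrable[OF b(2), of 0] by simp
  have Dm: "D \<in> borel_measurable \<C>"
    unfolding D_def[abs_def] R_def
    by (intro borel_measurable_diff borel_measurable_add borel_measurable_times borel_measurable_const v_measurable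
        borel_measurable_integrable[OF g_integrable] borel_measurable_integrable[OF gp_integrable]
        cont_measurable_C contu_powr add_pos_pos q k)
  have "(\<lambda>n. LINT z|\<C>. \<zeta> (real (n + N)) (fst z) * D z) \<longlonglongrightarrow> (LINT z|\<C>. indicator {t1<..t2} (fst z) * D z)"
  proof (rule integral_dominated_convergence[OF _ _ dom])
    show "(\<lambda>z. indicator {t1<..t2} (fst z) * D z) \<in> borel_measurable \<C>"
      by (rule borel_measurable_times[OF indicator_measurable_C Dm])
    show "(\<lambda>z. \<zeta> (real (n + N)) (fst z) * D z) \<in> borel_measurable \<C>" for n
    proof (rule borel_measurable_times[OF _ Dm], rule cont_measurable_C)
      have "continuous_on UNIV (\<zeta> (real (n + N)))" using \<zeta>[of n] by (simp add: cutoff_def)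
      then show "continuous_on ({0..<T} \<times> closure \<Omega>) (\<lambda>z. \<zeta> (real (n + N)) (fst z))"
        by (rule continuous_on_compose2[OF _ continuous_on_fst[OF continuous_on_id]]) simp
    qed
    show "AE z in \<C>. (\<lambda>n. \<zeta> (real (n + N)) (fst z) * D z) \<longlonglongrightarrow> indicator {t1<..t2} (fst z) * D z"
      by (rule AE_I2) (rule tendsto_mult_right[OF \<zeta>_lim])
    show "AE z in \<C>. norm (\<zeta> (real (n + N)) (fst z) * D z) \<le> norm (indicator {0<..b} (fst z) * D z)" for n
    proof (rule AE_I2)
      fix z assume z: "z \<in> space \<C>"
      show "norm (\<zeta> (real (n + N)) (fst z) * D z) \<le> norm (indicator {0<..b} (fst z) * D z)"
      proof (cases "fst z \<le> b")
        case True
        have "\<bar>\<zeta> (real (n + N)) (fst z)\<bar> \<le> 1" using \<zeta>[of n] by (simp add: cutoff_def)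
        then have "\<bar>\<zeta> (real (n + N)) (fst z)\<bar> * \<bar>D z\<bar> \<le> 1 * \<bar>D z\<bar>" by (intro mult_right_mono) auto
        then show ?thesis using True space_C(1)[OF z] by (simp add: abs_mult)
      next
        case False
        then show ?thesis using \<zeta>[of n] by (simp add: cutoff_def)
      qed
    qed
  qed
  then have "0 \<le> (LINT z|\<C>. indicator {t1<..t2} (fst z) * D z)"
    by (rule LIMSEQ_le_const) (use weak_cutoff[OF \<zeta> b(1,2)] in auto)
  also have "\<dots> = (LINT z|\<C>. indicator {t1<..t2} (fst z) * (v z * u z powr k)) - (LINT z|\<C>. indicator {t1<..t2} (fst z) * R z)"
    using Bochner_Integration.integral_diff[OF powr_weight_integrable[OF k(2) t(3) v_integrable, of t1] R_integrable[OF t(3), of t1]]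
    unfolding D_def right_diff_distrib .
  finally show ?thesis by simp
qed

end

text \<open>The splitting point \<open>\<epsilon>\<close> is chosen so that
  \<open>A * \<epsilon> powr (p - r) = \<delta>\<close>; the values below it contribute the constant
  \<open>A * \<epsilon> powr p\<close>.\<close>

lemma powr_interpolation:
  fixes A \<delta> p r :: real
  assumes "0 \<le> A" "0 < \<delta>" "0 < p" "p < r"
  shows "\<exists>c\<ge>0. \<forall>a\<ge>0. A * a powr p \<le> \<delta> * a powr r + c"
proof (cases "A = 0")
  case True
  then show ?thesis using assms by (intro exI[of _ 0]) simp
next
  case False
  define \<epsilon> where "\<epsilon> = (\<delta> / A) powr (1 / (p - r))"
  have A: "0 < A" using False assms by simp
  have \<epsilon>: "0 < \<epsilon>" using A assms by (simp add: \<epsilon>_def)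
  have e: "\<epsilon> powr (p - r) = \<delta> / A"
    using A assms by (simp add: \<epsilon>_def powr_powr)
  have "A * a powr p \<le> \<delta> * a powr r + A * \<epsilon> powr p" if "0 \<le> a" for a
  proof -
    have "a powr p \<le> \<epsilon> powr p + \<delta> / A * a powr r"
      using powr_le_epsilon[OF that \<epsilon> assms(3) less_imp_le[OF assms(4)]] unfolding e .
    then have "A * a powr p \<le> A * (\<epsilon> powr p + \<delta> / A * a powr r)"
      using A by (intro mult_left_mono) auto
    also have "\<dots> = \<delta> * a powr r + A * \<epsilon> powr p"
      using A by (simp add: distrib_left)
    finally show ?thesis .
  qed
  moreover have "0 \<le> A * \<epsilon> powr p" using A by simp
  ultimately show ?thesis by blast
qed

section \<open>From the integrated equation to a growth inequality in \<open>Y\<close> alone\<close>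

context evolution
begin

text \<open>Jensen's inequality, by integrating the tangent inequality of
  \<open>x powr \<gamma>\<close> at \<open>a = Y s t / V\<close>. The measure of
  \<open>\<Omega>\<close> enters with the factor \<open>- (\<gamma> - 1) * a powr \<gamma>\<close>,
  so putting a larger \<open>V\<close> in its place preserves the inequality; this permits a
  \<open>V\<close> that is positive in every case.\<close>

lemma Y_power_le:
  assumes s: "0 < s" "s < s'" and t: "0 \<le> t" "t < T" and V: "0 < V" "measure \<M> \<Omega> \<le> V"
  shows "V powr (1 - s' / s) * Y s t powr (s' / s) \<le> Y s' t"
proof -
  define \<gamma> where "\<gamma> = s' / s"
  have \<gamma>: "1 < \<gamma>" using s by (simp add: \<gamma>_def)
  define a where "a = Y s t / V"
  have a0: "0 \<le> a" using V Y_nonneg by (simp add: a_def)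
  have s'0: "0 < s'" using s by simp
  have i1: "integrable \<M> (\<lambda>x. u (t, x) powr s)" and i2: "integrable \<M> (\<lambda>x. u (t, x) powr s')"
    by (rule powr_slice_integrable[OF s(1) t] powr_slice_integrable[OF s'0 t])+
  have g0: "0 < \<gamma> - 1" using \<gamma> by simp
  have pw: "a powr \<gamma> + \<gamma> * (a powr (\<gamma> - 1) * (u (t, x) powr s - a)) \<le> u (t, x) powr s'" for x
  proof -
    have "(\<gamma> - 1 + 1) * (a powr (\<gamma> - 1) * (u (t, x) powr s - a))
        \<le> (u (t, x) powr s) powr (\<gamma> - 1 + 1) - a powr (\<gamma> - 1 + 1)"
      by (rule powr_tangent[OF a0 _ g0]) simp
    moreover have "(u (t, x) powr s) powr \<gamma> = u (t, x) powr s'"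
      using s by (simp add: powr_powr \<gamma>_def)
    ultimately show ?thesis by simp
  qed
  have agg: "a powr (\<gamma> - 1) * a = a powr \<gamma>"
    using a0 \<gamma> by (cases "a = 0") (auto simp: powr_diff)
  have Ya: "Y s t = a * V" using V by (simp add: a_def)
  have "V powr (1 - \<gamma>) * Y s t powr \<gamma> = a powr \<gamma> * V"
    unfolding Ya using V by (simp add: powr_mult powr_diff)
  also have "\<dots> = \<gamma> * (a powr (\<gamma> - 1) * Y s t) - (\<gamma> - 1) * a powr \<gamma> * V"
    unfolding Ya agg[symmetric] by (simp add: algebra_simps)
  also have "\<dots> \<le> \<gamma> * (a powr (\<gamma> - 1) * Y s t) - (\<gamma> - 1) * a powr \<gamma> * measure \<M> \<Omega>"
    using V \<gamma> by (intro diff_left_mono mult_left_mono) auto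
  also have "\<dots> = (LINT x|\<M>. a powr \<gamma> + \<gamma> * (a powr (\<gamma> - 1) * (u (t, x) powr s - a)))"
  proof -
    have "(LINT x|\<M>. a powr \<gamma> + \<gamma> * (a powr (\<gamma> - 1) * (u (t, x) powr s - a)))
        = (LINT x|\<M>. (a powr \<gamma> - \<gamma> * (a powr (\<gamma> - 1) * a)) + (\<gamma> * a powr (\<gamma> - 1)) * u (t, x) powr s)"
      by (rule Bochner_Integration.integral_cong[OF refl]) (simp add: algebra_simps)
    also have "\<dots> = (LINT x|\<M>. a powr \<gamma> - \<gamma> * (a powr (\<gamma> - 1) * a)) + (LINT x|\<M>. (\<gamma> * a powr (\<gamma> - 1)) * u (t, x) powr s)"
      by (rule Bochner_Integration.integral_add[OF M.integrable_const integrable_mult_right[OF i1]])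
    also have "\<dots> = (a powr \<gamma> - \<gamma> * (a powr (\<gamma> - 1) * a)) * measure \<M> \<Omega> + (\<gamma> * a powr (\<gamma> - 1)) * Y s t"
      by (simp add: Y_def)
    also have "\<dots> = \<gamma> * (a powr (\<gamma> - 1) * Y s t) - (\<gamma> - 1) * a powr \<gamma> * measure \<M> \<Omega>"
      unfolding agg by (simp add: algebra_simps)
    finally show ?thesis by simp
  qed
  also have "\<dots> \<le> Y s' t"
    unfolding Y_def
    by (rule Bochner_Integration.integral_mono[OF _ i2 pw])
       (intro Bochner_Integration.integrable_add M.integrable_const integrable_mult_right
          Bochner_Integration.integrable_diff i1)
  finally show ?thesis unfolding \<gamma>_def .
qed

end

context supersolution
begin

text \<open>How \<open>\<beta>\<close> is spent: a quarter absorbs the diffusion term up to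
  \<open>C1\<close>. The other three quarters become \<open>3 * \<beta> / (4 * cP)\<close> times
  \<open>Y (k + r) t\<close> by the Poincare inequality; of this, \<open>\<beta> / (4 * cP)\<close>
  pays for the \<open>\<alpha>\<close>-term up to \<open>C2\<close>, and
  \<open>\<beta> / (2 * cP)\<close> is left.\<close>

lemma slice_lower_bound:
  assumes j: "w j = 1" and B: "0 < B" "\<forall>x\<in>\<Omega>. \<bar>x $ j\<bar> \<le> B" and \<beta>: "0 < \<beta>"
    and cP: "cP = (2 * ((k + r) * B)) powr r"
    and C1: "\<forall>a\<ge>0. k * a powr p \<le> \<beta> / 4 * a powr r + C1"
    and C2: "\<forall>a\<ge>0. \<bar>\<alpha>\<bar> * a powr (q + k) \<le> \<beta> / (4 * cP) * a powr (k + r) + C2"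
    and t: "0 < t" "t < T" "good t" and iR: "integrable \<M> (\<lambda>x. R (t, x))"
  shows "\<beta> / (2 * cP) * Y (k + r) t - (C1 + C2) * measure \<M> \<Omega> \<le> (LINT x|\<M>. R (t, x))"
proof -
  have kr: "0 < k + r" using k(2) p by linarith
  have cP0: "0 < cP" unfolding cP using kr B by simp
  obtain L where L: "0 < L" "\<forall>t'\<in>{0..t}. \<forall>x\<in>closure \<Omega>. u (t', x) \<in> {0..L}"
    by (rule u_bound[OF t(2)])
  have uL: "\<And>x. x \<in> \<Omega> \<Longrightarrow> u (t, x) \<in> {0..L}"
    using L(2)[rule_format, of t] t closure_subset[of \<Omega>] by auto
  have g1: "has_hgrad_S0 mul w r \<Omega> (\<lambda>x. u (t, x)) (\<lambda>x. g (t, x))"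
    "integrable \<M> (\<lambda>x. norm (g (t, x)) powr r)"
    using t(3) by (simp_all add: good_def)
  have Bx: "\<And>x. x \<in> \<Omega> \<Longrightarrow> \<bar>x $ j\<bar> \<le> B" using B(2) by simp
  have r1: "1 < r" using p by simp
  note P = horizontal_poincare[OF G j \<Omega> g1(1) r1 order_refl k(2) g1(2) L(1) uL Bx, folded cP Y_def]
  let ?P = "\<lambda>x. u (t, x) powr k * norm (g (t, x)) powr r"
  let ?Q = "\<lambda>x. u (t, x) powr (k + r)"
  have pw: "3 * \<beta> / 4 * ?P x - \<beta> / (4 * cP) * ?Q x - (C1 + C2) \<le> R (t, x)" if x: "x \<in> \<Omega>" for x
  proof -
    have u0: "0 \<le> u (t, x)" using uL[OF x] by simp
    define a where "a = u (t, x) powr (1 / (r - p)) * norm (g (t, x))"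
    have ap: "a powr p = norm (g (t, x)) powr p * u (t, x) powr (k - 1)"
      unfolding a_def k(3) by (simp add: powr_mult powr_powr)
    have ar: "a powr r = ?P x"
      unfolding a_def k_def by (simp add: powr_mult powr_powr)
    have "0 \<le> a" by (simp add: a_def)
    then have "k * (norm (g (t, x)) powr p * u (t, x) powr (k - 1)) \<le> \<beta> / 4 * ?P x + C1"
      using C1 unfolding ap[symmetric] ar[symmetric] by simp
    moreover have "\<bar>\<alpha>\<bar> * u (t, x) powr (q + k) \<le> \<beta> / (4 * cP) * ?Q x + C2"
      using C2 u0 by simp
    moreover have "- (\<bar>\<alpha>\<bar> * u (t, x) powr (q + k)) \<le> \<alpha> * u (t, x) powr (q + k)"
    proof -
      have "- \<bar>\<alpha>\<bar> * u (t, x) powr (q + k) \<le> \<alpha> * u (t, x) powr (q + k)"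
        by (intro mult_right_mono) auto
      then show ?thesis by simp
    qed
    moreover have "\<beta> * (norm (g (t, x)) powr r * u (t, x) powr k) = 3 * \<beta> / 4 * ?P x + \<beta> / 4 * ?P x"
      by (simp add: field_simps)
    ultimately show ?thesis
      unfolding R_def by linarith
  qed
  have i: "integrable \<M> (\<lambda>x. 3 * \<beta> / 4 * ?P x)" "integrable \<M> (\<lambda>x. \<beta> / (4 * cP) * ?Q x)"
    using P(2) powr_slice_integrable[OF kr less_imp_le[OF t(1)] t(2)] by simp_all
  have "\<beta> / cP * Y (k + r) t \<le> \<beta> / cP * (cP * (LINT x|\<M>. ?P x))"
    using P(3) \<beta> cP0 by (intro mult_left_mono) auto
  also have "\<dots> = \<beta> * (LINT x|\<M>. ?P x)" using cP0 by simp
  finally have PQ: "\<beta> / cP * Y (k + r) t \<le> \<beta> * (LINT x|\<M>. ?P x)" .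
  have "\<beta> / (2 * cP) * Y (k + r) t - (C1 + C2) * measure \<M> \<Omega>
      = 3 / 4 * (\<beta> / cP * Y (k + r) t) - \<beta> / (4 * cP) * Y (k + r) t - (C1 + C2) * measure \<M> \<Omega>"
    using cP0 by (simp add: field_simps)
  also have "\<dots> \<le> 3 / 4 * (\<beta> * (LINT x|\<M>. ?P x)) - \<beta> / (4 * cP) * Y (k + r) t - (C1 + C2) * measure \<M> \<Omega>"
    using PQ by (intro diff_right_mono mult_left_mono) auto
  also have "\<dots> = (LINT x|\<M>. 3 * \<beta> / 4 * ?P x) - (LINT x|\<M>. \<beta> / (4 * cP) * ?Q x) - (LINT x|\<M>. C1 + C2)"
    by (simp add: Y_def mult.commute)
  also have "\<dots> = (LINT x|\<M>. 3 * \<beta> / 4 * ?P x - \<beta> / (4 * cP) * ?Q x - (C1 + C2))"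
    unfolding Bochner_Integration.integral_diff[OF Bochner_Integration.integrable_diff[OF i] M.integrable_const]
      Bochner_Integration.integral_diff[OF i] ..
  also have "\<dots> \<le> (LINT x|\<M>. R (t, x))"
    by (rule Bochner_Integration.integral_mono[OF Bochner_Integration.integrable_diff[OF
          Bochner_Integration.integrable_diff[OF i] M.integrable_const] iR])
       (use pw in simp)
  finally show ?thesis .
qed

text \<open>The bound on slices holds at almost every time, so it is integrated over
  \<open>{t1<..t2}\<close> by Fubini and then chained with \<open>weak_interval\<close> and
  \<open>Y_increment\<close>. The factor \<open>k + 1\<close> is the one of the tangent
  inequality.\<close>

lemma Y_growth:
  assumes slice: "\<And>t. 0 < t \<Longrightarrow> t < T \<Longrightarrow> good t \<Longrightarrow> integrable \<M> (\<lambda>x. R (t, x)) \<Longrightarrow>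
      c * Y (k + 1) t powr \<gamma> - C \<le> (LINT x|\<M>. R (t, x))"
    and \<gamma>: "0 < \<gamma>" and t: "0 < t1" "t1 < t2" "t2 < T"
  shows "integral {t1..t2} (\<lambda>t. (k + 1) * c * Y (k + 1) t powr \<gamma> - (k + 1) * C) \<le> Y (k + 1) t2 - Y (k + 1) t1"
proof -
  let ?F = "\<lambda>t. c * Y (k + 1) t powr \<gamma> - C"
  let ?T = "lebesgue_on {0<..<T}"
  have k1: "0 < k + 1" using k by simp
  have contF: "continuous_on {t1..t2} ?F"
  proof (intro continuous_on_diff continuous_on_mult_left continuous_on_const continuous_on_powr')
    show "continuous_on {t1..t2} (Y (k + 1))"
      by (rule continuous_on_subset[OF continuous_on_Y[OF k1]]) (use t in auto)
  qed (use Y_nonneg \<gamma> in auto)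
  have hF: "((\<lambda>s. indicator {t1<..t2} s * ?F s) has_integral integral {t1..t2} ?F) {0<..<T}"
  proof (rule has_integral_on_superset)
    have F: "(?F has_integral integral {t1..t2} ?F) {t1..t2}"
      by (rule integrable_integral[OF integrable_continuous_interval[OF contF]])
    \<comment> \<open>The half-open indicator differs from the closed interval only at the point
      \<open>t1\<close>.\<close>
    show "((\<lambda>s. indicator {t1<..t2} s * ?F s) has_integral integral {t1..t2} ?F) {t1..t2}"
      by (rule has_integral_spike_finite[of "{t1}", OF _ _ F]) (auto simp: indicator_def)
    show "indicator {t1<..t2} s * ?F s = 0" if "s \<notin> {t1..t2}" for s
      using that by (simp add: indicator_def)
    show "{t1..t2} \<subseteq> {0<..<T}" using t by auto
  qed
  have absF: "integrable ?T (\<lambda>s. indicator {t1<..t2} s * ?F s)"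
  proof -
    have T: "open {0<..<T}" "bounded {0<..<T}" by auto
    interpret T: finite_measure ?T by (rule finite_measure_lebesgue_on[OF T])
    obtain K where K: "0 \<le> K" "\<forall>s\<in>{t1..t2}. \<bar>?F s\<bar> \<le> K"
      by (rule compact_continuous_abs_bound[OF compact_Icc contF])
    show ?thesis
    proof (rule T.integrable_const_bound[of _ K], rule AE_I2)
      show "norm (indicator {t1<..t2} s * ?F s) \<le> K" for s
        using K by (cases "s \<in> {t1<..t2}") auto
      have "continuous_on {0..<T} ?F"
        using continuous_on_Y[OF k1] Y_nonneg \<gamma>
        by (intro continuous_on_diff continuous_on_mult_left continuous_on_const continuous_on_powr') auto
      then have "?F \<in> borel_measurable ?T"
        by (rule continuous_imp_measurable_lebesgue_on_open) auto
      moreover have "(indicator {t1<..t2} :: real \<Rightarrow> real) \<in> borel_measurable ?T"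
      proof -
        have "(\<lambda>s. s) \<in> borel_measurable ?T"
          by (rule continuous_imp_measurable_lebesgue_on_open[OF continuous_on_id subset_UNIV T(1)])
        then show ?thesis by measurable
      qed
      ultimately show "(\<lambda>s. indicator {t1<..t2} s * ?F s) \<in> borel_measurable ?T"
        by (rule borel_measurable_times[rotated])
    qed
  qed
  have "integral {t1..t2} ?F = (LINT s|?T. indicator {t1<..t2} s * ?F s)"
    using lebesgue_integral_eq_integral[OF absF] integral_unique[OF hF] by simp
  also have "\<dots> \<le> (LINT s|?T. (LINT x|\<M>. indicator {t1<..t2} s * R (s, x)))"
  proof (rule integral_mono_AE[OF absF])
    note Fub = Fubini_lebesgue_on[OF open_greaterThanLessThan \<Omega>(1) R_integrable[OF t(3), of t1]]
    show "integrable ?T (\<lambda>s. LINT x|\<M>. indicator {t1<..t2} s * R (s, x))"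
      using Fub(2) by simp
    have "AE s in ?T. integrable \<M> (\<lambda>x. indicator {t1<..t2} s * R (s, x))"
      using Fub(1) by simp
    then show "AE s in ?T. indicator {t1<..t2} s * ?F s \<le> (LINT x|\<M>. indicator {t1<..t2} s * R (s, x))"
      using AE_good AE_space[of ?T]
    proof eventually_elim
      case (elim s)
      show ?case
      proof (cases "s \<in> {t1<..t2}")
        case True
        then have "integrable \<M> (\<lambda>x. R (s, x))" using elim(1) by simp
        then have "?F s \<le> (LINT x|\<M>. R (s, x))"
          using elim by (intro slice) auto
        then show ?thesis using True by simp
      qed simp
    qed
  qed
  also have "\<dots> = (LINT z|\<C>. indicator {t1<..t2} (fst z) * R z)"
    using Fubini_lebesgue_on(3)[OF open_greaterThanLessThan \<Omega>(1) R_integrable[OF t(3), of t1]] by simp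
  also have "\<dots> \<le> (LINT z|\<C>. indicator {t1<..t2} (fst z) * (v z * u z powr k))"
    by (rule weak_interval[OF t])
  finally have "(k + 1) * integral {t1..t2} ?F \<le> (k + 1) * (LINT z|\<C>. indicator {t1<..t2} (fst z) * (v z * u z powr k))"
    using k1 by (intro mult_left_mono) auto
  also have "\<dots> \<le> Y (k + 1) t2 - Y (k + 1) t1"
    by (rule Y_increment[OF k(1) t])
  also have "(k + 1) * integral {t1..t2} ?F = integral {t1..t2} (\<lambda>t. (k + 1) * ?F t)"
    by simp
  finally show ?thesis by (simp add: algebra_simps)
qed

text \<open>The growth inequality is known only for positive times. Continuity of \<open>Y\<close>
  at \<open>0\<close> supplies a starting time \<open>X n\<close>, below both \<open>1\<close> and
  \<open>T\<close>, at which \<open>Y\<close> still exceeds \<open>M\<close>; estimating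
  \<open>X n\<close> by \<open>1\<close> makes the bound independent of the solution.\<close>

lemma existence_time_bound:
  assumes growth: "\<And>t1 t2. 0 < t1 \<Longrightarrow> t1 < t2 \<Longrightarrow> t2 < T \<Longrightarrow>
      integral {t1..t2} (\<lambda>t. c * Y (k + 1) t powr \<gamma> - C) \<le> Y (k + 1) t2 - Y (k + 1) t1"
    and c: "0 < c" and \<gamma>: "1 < \<gamma>" and M: "0 < M" "2 * C \<le> c * M powr \<gamma>" and start: "M < Y (k + 1) 0"
  shows "T \<le> 1 + 2 * M powr (1 - \<gamma>) / (c * (\<gamma> - 1))"
proof -
  have k1: "0 < k + 1" using k by simp
  note cY = continuous_on_Y[OF k1]
  define X where "X n = min 1 T * inverse (real (Suc n)) / 2" for n
  have "X \<longlonglongrightarrow> min 1 T * 0 / 2"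
    unfolding X_def by (intro tendsto_divide tendsto_mult_left LIMSEQ_inverse_real_of_nat tendsto_const) simp
  then have X0: "X \<longlonglongrightarrow> 0" by simp
  have X: "0 < X n" "X n < T" "X n < 1" for n
  proof -
    have i: "0 < inverse (real (Suc n))" "inverse (real (Suc n)) \<le> 1" by (auto simp: field_simps)
    have mT: "0 < min 1 T" using T by simp
    show "0 < X n" using i mT unfolding X_def by simp
    have "min 1 T * inverse (real (Suc n)) \<le> min 1 T * 1" using i mT by (intro mult_left_mono) auto
    then show "X n < T" "X n < 1" using mT unfolding X_def by auto
  qed
  have "(\<lambda>n. Y (k + 1) (X n)) \<longlonglongrightarrow> Y (k + 1) 0"
  proof (rule continuous_on_tendsto_compose[OF cY X0])
    show "(0::real) \<in> {0..<T}" using T by simp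
    have "X n \<in> {0..<T}" for n using X[of n] by simp
    then show "\<forall>\<^sub>F n in sequentially. X n \<in> {0..<T}" by (rule always_eventually[OF allI])
  qed
  then have "\<forall>\<^sub>F n in sequentially. M < Y (k + 1) (X n)"
    using start by (rule order_tendstoD(1))
  then obtain n where n: "M < Y (k + 1) (X n)"
    unfolding eventually_sequentially by blast
  have "T \<le> X n + 2 * M powr (1 - \<gamma>) / (c * (\<gamma> - 1))"
    by (rule blow_up_time_bound[OF cY X(1,2) c \<gamma> M n growth])
  then show ?thesis using X(3)[of n] by linarith
qed

end

theorem theorem3p3:
  fixes mul :: "real^'n \<Rightarrow> real^'n \<Rightarrow> real^'n" and w :: "'n \<Rightarrow> nat"
    and \<Omega> :: "(real^'n) set" and p r :: real
  assumes "stratified_group mul w"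
    and "open \<Omega>" and "bounded \<Omega>" and "smooth_boundary \<Omega>"
    and "p > 1" and "r > 1"
  shows "\<exists>\<Lambda>>0. \<forall>q \<alpha> \<beta> :: real.
    q > 0 \<and> \<alpha> < 0 \<and> \<beta> > 0 \<and>
    (r > max p q \<or> (r = q \<and> q > p \<and> \<beta> \<ge> \<Lambda> * \<bar>\<alpha>\<bar>)) \<longrightarrow>
    (\<exists>M>0. \<forall>u0. u0 \<in> S0_inf mul w \<Omega> \<and> (\<forall>x\<in>\<Omega>. u0 x \<ge> 0) \<and> (\<exists>x\<in>\<Omega>. u0 x \<noteq> 0) \<and>
       (LINT x|lebesgue_on \<Omega>. u0 x powr ((2 * r - p) / (r - p))) > M \<longrightarrow>
       T_max mul w \<Omega> p q r \<alpha> \<beta> u0 < \<infinity>)"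
proof -
  obtain \<rho> where "range w = {1..\<rho>}"
    using assms(1) by (auto simp: stratified_group_def)
  \<comment> \<open>There is at least one coordinate, so \<open>\<rho> \<ge> 1\<close> and the first
    layer is not empty.\<close>
  moreover from this have "w undefined \<in> {1..\<rho>}" by blast
  then have "1 \<in> {1..\<rho>}" by simp
  ultimately have "1 \<in> range w" by simp
  then obtain j where j: "w j = 1" by (elim rangeE) simp
  obtain B where B: "0 < B" "\<forall>x\<in>\<Omega>. norm x \<le> B"
    using assms(3) bounded_pos by blast
  have Bj: "\<forall>x\<in>\<Omega>. \<bar>x $ j\<bar> \<le> B"
    using B(2) order_trans[OF component_le_norm_cart] by blast
  define \<kappa> where "\<kappa> = r / (r - p)"
  define cP where "cP = (2 * ((\<kappa> + r) * B)) powr r"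
  show ?thesis
  \<comment> \<open>The factor \<open>4 * cP\<close> makes \<open>\<bar>\<alpha>\<bar>\<close> at
    most \<open>\<beta> / (4 * cP)\<close> when \<open>q = r\<close>, the share set aside for it in
    \<open>slice_lower_bound\<close>. The maximum with \<open>1\<close> gives positivity at a point
    where \<open>p < r\<close>, and with it \<open>cP > 0\<close>, is not yet available.\<close>
  proof (rule exI[of _ "max 1 (4 * cP)"], intro conjI allI impI)
    show "0 < max 1 (4 * cP)" by simp
    fix q \<alpha> \<beta> :: real
    assume hyp: "q > 0 \<and> \<alpha> < 0 \<and> \<beta> > 0 \<and>
      (r > max p q \<or> (r = q \<and> q > p \<and> \<beta> \<ge> max 1 (4 * cP) * \<bar>\<alpha>\<bar>))"
    then have q: "0 < q" and \<beta>: "0 < \<beta>" and pr: "p < r" and qr: "q \<le> r" by auto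
    have \<kappa>: "1 < \<kappa>" using pr assms(5) by (simp add: \<kappa>_def field_simps)
    have cP: "0 < cP" using \<kappa> assms(6) B by (simp add: cP_def)
    have "\<exists>c\<ge>0. \<forall>a\<ge>0. \<kappa> * a powr p \<le> \<beta> / 4 * a powr r + c"
      using \<kappa> \<beta> assms(5) pr by (intro powr_interpolation) auto
    then obtain C1 where C1: "0 \<le> C1" "\<forall>a\<ge>0. \<kappa> * a powr p \<le> \<beta> / 4 * a powr r + C1" by blast
    \<comment> \<open>For \<open>q < r\<close> this is interpolation between different powers. For
      \<open>q = r\<close> the powers coincide, so only the coefficients are compared and the
      constant is \<open>0\<close>.\<close>
    have "\<exists>c\<ge>0. \<forall>a\<ge>0. \<bar>\<alpha>\<bar> * a powr (q + \<kappa>) \<le> \<beta> / (4 * cP) * a powr (\<kappa> + r) + c"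
    proof (cases "q < r")
      case True
      then show ?thesis
        using \<kappa> \<beta> cP q by (intro powr_interpolation) auto
    next
      case False
      then have q_eq: "q = r" and "max 1 (4 * cP) * \<bar>\<alpha>\<bar> \<le> \<beta>" using hyp by auto
      moreover have "4 * cP * \<bar>\<alpha>\<bar> \<le> max 1 (4 * cP) * \<bar>\<alpha>\<bar>"
        by (intro mult_right_mono) auto
      ultimately have "\<bar>\<alpha>\<bar> \<le> \<beta> / (4 * cP)" using cP by (simp add: field_simps)
      then have "\<bar>\<alpha>\<bar> * a powr (\<kappa> + r) \<le> \<beta> / (4 * cP) * a powr (\<kappa> + r)" for a
        by (rule mult_right_mono) simp
      then have "\<forall>a\<ge>0. \<bar>\<alpha>\<bar> * a powr (q + \<kappa>) \<le> \<beta> / (4 * cP) * a powr (\<kappa> + r) + 0"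
        unfolding q_eq add.commute[of r \<kappa>] by simp
      then show ?thesis by blast
    qed
    then obtain C2 where C2: "0 \<le> C2" "\<forall>a\<ge>0. \<bar>\<alpha>\<bar> * a powr (q + \<kappa>) \<le> \<beta> / (4 * cP) * a powr (\<kappa> + r) + C2"
      by blast
    define s where "s = \<kappa> + 1"
    define \<gamma> where "\<gamma> = (\<kappa> + r) / s"
    have s: "0 < s" "s < \<kappa> + r" using \<kappa> assms(6) by (auto simp: s_def)
    have \<gamma>: "1 < \<gamma>" using s by (simp add: \<gamma>_def)
    define V where "V = measure (lebesgue_on \<Omega>) \<Omega> + 1"
    have V: "0 < V" "measure (lebesgue_on \<Omega>) \<Omega> \<le> V"
      by (auto simp: V_def add_nonneg_pos)
    define C where "C = (C1 + C2) * measure (lebesgue_on \<Omega>) \<Omega>"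
    define c where "c = \<beta> / (2 * cP) * V powr (1 - \<gamma>)"
    have c: "0 < c" using \<beta> cP V by (simp add: c_def)
    have C: "0 \<le> C" using C1 C2 by (simp add: C_def)
    \<comment> \<open>Then \<open>c * M powr \<gamma> = c + 2 * C\<close>, so above \<open>M\<close>
      half of the growth term covers \<open>C\<close>. The summand \<open>1\<close> keeps
      \<open>M\<close> positive when \<open>C = 0\<close>.\<close>
    define M where "M = (1 + 2 * C / c) powr (1 / \<gamma>)"
    have Cc: "0 \<le> 2 * C / c" using C c by simp
    have M: "0 < M" using Cc by (simp add: M_def add_nonneg_eq_0_iff)
    have "M powr \<gamma> = 1 + 2 * C / c" using \<gamma> Cc by (simp add: M_def powr_powr)
    then have "c * M powr \<gamma> = c + 2 * C" using c by (simp add: distrib_left)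
    then have cM: "2 * C \<le> c * M powr \<gamma>" using c by simp
    \<comment> \<open>The common bound for all existence times. The growth inequality of
      \<open>Y\<close> carries the factor \<open>s = \<kappa> + 1\<close>, whence
      \<open>s * c\<close>; the datum \<open>u0\<close> does not enter.\<close>
    define b where "b = 1 + 2 * M powr (1 - \<gamma>) / (s * c * (\<gamma> - 1))"
    show "\<exists>M>0. \<forall>u0. u0 \<in> S0_inf mul w \<Omega> \<and> (\<forall>x\<in>\<Omega>. u0 x \<ge> 0) \<and> (\<exists>x\<in>\<Omega>. u0 x \<noteq> 0) \<and>
       (LINT x|lebesgue_on \<Omega>. u0 x powr ((2 * r - p) / (r - p))) > M \<longrightarrow>
       T_max mul w \<Omega> p q r \<alpha> \<beta> u0 < \<infinity>"
    proof (rule exI[of _ M], intro conjI allI impI M)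
      fix u0
      assume "u0 \<in> S0_inf mul w \<Omega> \<and> (\<forall>x\<in>\<Omega>. u0 x \<ge> 0) \<and> (\<exists>x\<in>\<Omega>. u0 x \<noteq> 0) \<and>
        (LINT x|lebesgue_on \<Omega>. u0 x powr ((2 * r - p) / (r - p))) > M"
      then have u0: "\<forall>x\<in>\<Omega>. 0 \<le> u0 x" and big: "M < (LINT x|lebesgue_on \<Omega>. u0 x powr ((2 * r - p) / (r - p)))"
        by auto
      have "(2 * r - p) / (r - p) = s"
        using pr by (simp add: s_def \<kappa>_def field_simps)
      with big have big: "M < (LINT x|lebesgue_on \<Omega>. u0 x powr s)" by simp
      \<comment> \<open>A non-integrable function has integral \<open>0\<close> by convention, which
        contradicts \<open>big\<close> because \<open>M > 0\<close>.\<close>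
      have i0: "integrable (lebesgue_on \<Omega>) (\<lambda>x. u0 x powr s)"
      proof (rule ccontr)
        assume "\<not> integrable (lebesgue_on \<Omega>) (\<lambda>x. u0 x powr s)"
        then show False using big M by (simp add: not_integrable_integral_eq)
      qed
      have bound: "T \<le> b" if T: "0 < T" and sol: "weak_solution mul w \<Omega> p q r \<alpha> \<beta> u0 T u" for T u
      proof -
        have super: "weak_super_solution mul w \<Omega> p q r \<alpha> \<beta> u0 T u"
          and sub: "weak_sub_solution mul w \<Omega> p q r \<alpha> \<beta> u0 T u"
          using sol by (simp_all add: weak_solution_def)
        obtain g v where cls: "solution_class mul w \<Omega> p q r T u g v"
          and init: "\<forall>x\<in>\<Omega>. u (0, x) \<ge> u0 x"
          and ge: "\<forall>z\<in>cylinder T (frontier \<Omega>). u z \<ge> 0"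
          and weak: "\<forall>\<phi> h. test_function mul w \<Omega> p T \<phi> h \<longrightarrow>
           weak_lhs \<Omega> p T g v \<phi> h \<ge> weak_rhs \<Omega> q r \<alpha> \<beta> T u g \<phi>"
          using super unfolding weak_super_solution_def by (elim exE conjE)
        \<comment> \<open>Together with \<open>ge\<close> this forces \<open>u = 0\<close> on the
          lateral boundary, so that \<open>u powr k\<close> vanishes there, as a test function
          must.\<close>
        have le: "\<forall>z\<in>cylinder T (frontier \<Omega>). u z \<le> 0"
          using sub unfolding weak_sub_solution_def by (elim exE conjE)
        \<comment> \<open>The solution class therefore provides the integrability exponent
          \<open>r\<close>, which is the one that \<open>supersolution\<close> passes to
          \<open>evolution\<close>.\<close>
        have maxr: "Max {p, q, r} = r" using pr qr by simp
        interpret supersolution mul w \<Omega> r T u g v p q \<alpha> \<beta>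
        proof
          show "\<forall>z\<in>cylinder T (frontier \<Omega>). u z = 0"
            using le ge by (auto intro!: antisym)
        qed (use assms(1-6) T cls weak q pr in \<open>simp_all add: solution_class_def maxr\<close>)
        have k\<kappa>: "k = \<kappa>" by (simp add: k_def \<kappa>_def)
        have slice: "c * Y (k + 1) t powr \<gamma> - C \<le> (LINT x|\<M>. R (t, x))"
          if t: "0 < t" "t < T" "good t" and iR: "integrable \<M> (\<lambda>x. R (t, x))" for t
        proof -
          have "\<beta> / (2 * cP) * Y (\<kappa> + r) t - C \<le> (LINT x|\<M>. R (t, x))"
            unfolding C_def
            by (rule slice_lower_bound[OF j B(1) Bj \<beta> _ _ _ t iR, unfolded k\<kappa>, OF cP_def C1(2) C2(2)])
          moreover have "V powr (1 - \<gamma>) * Y s t powr \<gamma> \<le> Y (\<kappa> + r) t"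
            unfolding \<gamma>_def using Y_power_le[OF s less_imp_le[OF t(1)] t(2) V] .
          then have "\<beta> / (2 * cP) * (V powr (1 - \<gamma>) * Y s t powr \<gamma>) \<le> \<beta> / (2 * cP) * Y (\<kappa> + r) t"
            using \<beta> cP by (intro mult_left_mono) auto
          ultimately show ?thesis
            unfolding c_def k\<kappa> s_def[symmetric] by (simp add: mult.assoc)
        qed
        have growth: "integral {t1..t2} (\<lambda>t. s * c * Y (k + 1) t powr \<gamma> - s * C) \<le> Y (k + 1) t2 - Y (k + 1) t1"
          if "0 < t1" "t1 < t2" "t2 < T" for t1 t2
          using Y_growth[where c = c and \<gamma> = \<gamma> and C = C, OF slice _ that] \<gamma> unfolding k\<kappa> s_def by simp
        have start: "M < Y (k + 1) 0"
        proof -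
          have "(LINT x|\<M>. u0 x powr s) \<le> (LINT x|\<M>. u (0, x) powr s)"
          proof (rule Bochner_Integration.integral_mono[OF i0 powr_slice_integrable[OF s(1) order_refl T]])
            show "u0 x powr s \<le> u (0, x) powr s" if "x \<in> space \<M>" for x
              using that init u0 s(1) by (intro powr_mono2) auto
          qed
          then show ?thesis using big by (simp add: Y_def k\<kappa> s_def)
        qed
        have sM: "2 * (s * C) \<le> s * c * M powr \<gamma>"
          using mult_left_mono[OF cM less_imp_le[OF s(1)]] by (simp add: mult_ac)
        have sc: "0 < s * c" using s c by simp
        show ?thesis
          unfolding b_def by (rule existence_time_bound[OF growth sc \<gamma> M sM start])
      qed
      have "T_max mul w \<Omega> p q r \<alpha> \<beta> u0 \<le> ennreal b"
        unfolding T_max_def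
      proof (rule Sup_least)
        fix x assume "x \<in> ennreal ` {T. 0 < T \<and> (\<exists>u. weak_solution mul w \<Omega> p q r \<alpha> \<beta> u0 T u)}"
        then obtain T u where "x = ennreal T" "0 < T" "weak_solution mul w \<Omega> p q r \<alpha> \<beta> u0 T u" by blast
        then show "x \<le> ennreal b" using bound by (simp add: ennreal_leI)
      qed
      also have "\<dots> < \<infinity>" by simp
      finally show "T_max mul w \<Omega> p q r \<alpha> \<beta> u0 < \<infinity>" .
    qed
  qed
qed

end
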